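(* Let $S$ be a surface containing a full MSIB $(U,V)$. Then $S$ is not homotopy equivalent to a CW-complex.
   Context: A manifold is a connected Hausdorff space locally homeomorphic to some $\mathbb{R}^n$ (no metrizability or second countability is assumed). A manifold with boundary (bordered manifold) is defined similarly, with local models $\mathbb{R}^n$ or $\mathbb{R}^{n-1}\times\mathbb{R}_{\ge 0}$. A surface is a $2$-dimensional manifold. For a bordered manifold $M$, $\partial M$ denotes its manifold boundary and $\mathrm{int}(M)=M-\partial M$ its manifold interior (these are not the topological boundary and interior in an ambient space). MSIB: let $M$ be an $n$-dimensional manifold. A manifold-system of infinitesimal bridges (MSIB) in $M$ consists of two $n$-dimensional connected bordered submanifolds $U,V\subset M$ such that $\mathrm{int}(U)\cap\mathrm{int}(V)=\varnothing$, $\mathrm{int}(U)\cup\mathrm{int}(V)$ is metrizable, but $\mathrm{int}(U)\cup\mathrm{int}(V)\cup(\partial U\cap\partial V)$ is not metrizable. Full: an MSIB $(U,V)$ in a manifold $M$ is full if $\partial U=\partial V$, and whenever $A$ is a boundary component (connected component) of $\partial U$, then $A$ is closed in $M$. *)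

theory Defs
  imports "HOL-Analysis.Analysis" "HOL-Library.Disjoint_Sets"
begin

text \<open>
  The local model $\mathbb{R}^{n-1} \times \mathbb{R}_{\ge 0}$. For \<open>n = 0\<close> the truncated
  subtraction makes this meaningless, so every use below is guarded by \<open>n \<ge> 1\<close>.
\<close>
definition half_space :: "nat \<Rightarrow> ((nat \<Rightarrow> real) \<times> real) topology" where
  "half_space n = prod_topology (Euclidean_space (n - 1)) (top_of_set {0..})"

definition manifold :: "nat \<Rightarrow> 'a topology \<Rightarrow> bool" where
  "manifold n X \<longleftrightarrow>
     connected_space X \<and> Hausdorff_space X \<and>
     (\<forall>x\<in>topspace X. \<exists>W. openin X W \<and> x \<in> W \<and>
        subtopology X W homeomorphic_space Euclidean_space n)"

definition bordered_manifold :: "nat \<Rightarrow> 'a topology \<Rightarrow> bool" where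
  "bordered_manifold n X \<longleftrightarrow>
     connected_space X \<and> Hausdorff_space X \<and>
     (\<forall>x\<in>topspace X. \<exists>W. openin X W \<and> x \<in> W \<and>
        (subtopology X W homeomorphic_space Euclidean_space n \<or>
         n \<ge> 1 \<and> subtopology X W homeomorphic_space half_space n))"

abbreviation surface :: "'a topology \<Rightarrow> bool" where
  "surface X \<equiv> manifold 2 X"

text \<open>
  The manifold boundary and interior are intrinsic to the space. For a subset \<open>U\<close> of a manifold
  \<open>M\<close> they are taken in \<open>subtopology M U\<close>, and are unrelated to \<open>frontier_of\<close> and \<open>interior_of\<close>.
\<close>
definition manifold_boundary :: "nat \<Rightarrow> 'a topology \<Rightarrow> 'a set" where
  "manifold_boundary n X =
     {x \<in> topspace X. n \<ge> 1 \<and>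
        (\<exists>W f. openin X W \<and> x \<in> W \<and>
           homeomorphic_map (subtopology X W) (half_space n) f \<and> snd (f x) = 0)}"

definition manifold_interior :: "nat \<Rightarrow> 'a topology \<Rightarrow> 'a set" where
  "manifold_interior n X = topspace X - manifold_boundary n X"

definition bordered_submanifold :: "nat \<Rightarrow> 'a topology \<Rightarrow> 'a set \<Rightarrow> bool" where
  "bordered_submanifold n M U \<longleftrightarrow> U \<subseteq> topspace M \<and> bordered_manifold n (subtopology M U)"

definition MSIB :: "nat \<Rightarrow> 'a topology \<Rightarrow> 'a set \<Rightarrow> 'a set \<Rightarrow> bool" where
  "MSIB n M U V \<longleftrightarrow>
     bordered_submanifold n M U \<and> bordered_submanifold n M V \<and>
     (let intU = manifold_interior n (subtopology M U);
          intV = manifold_interior n (subtopology M V);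
          bdU = manifold_boundary n (subtopology M U);
          bdV = manifold_boundary n (subtopology M V)
      in intU \<inter> intV = {} \<and>
         metrizable_space (subtopology M (intU \<union> intV)) \<and>
         \<not> metrizable_space (subtopology M (intU \<union> intV \<union> (bdU \<inter> bdV))))"

definition full_MSIB :: "nat \<Rightarrow> 'a topology \<Rightarrow> 'a set \<Rightarrow> 'a set \<Rightarrow> bool" where
  "full_MSIB n M U V \<longleftrightarrow>
     MSIB n M U V \<and>
     manifold_boundary n (subtopology M U) = manifold_boundary n (subtopology M V) \<and>
     (\<forall>A \<in> connected_components_of (subtopology M (manifold_boundary n (subtopology M U))).
        closedin M A)"

text \<open>For \<open>n = 0\<close> the disc and the open ball are a single point and the sphere is empty.\<close>
definition disc :: "nat \<Rightarrow> (nat \<Rightarrow> real) topology" where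
  "disc n = subtopology (Euclidean_space n) {x. (\<Sum>i<n. (x i)\<^sup>2) \<le> 1}"

definition open_ball_set :: "nat \<Rightarrow> (nat \<Rightarrow> real) set" where
  "open_ball_set n = {x \<in> topspace (Euclidean_space n). (\<Sum>i<n. (x i)\<^sup>2) < 1}"

definition sphere_set :: "nat \<Rightarrow> (nat \<Rightarrow> real) set" where
  "sphere_set n = {x \<in> topspace (Euclidean_space n). (\<Sum>i<n. (x i)\<^sup>2) = 1}"

text \<open>
  A CW structure in Whitehead's sense: \<open>E\<close> is the set of open cells, \<open>d\<close> gives their dimensions
  and \<open>\<Phi>\<close> their characteristic maps. The condition on the attaching spheres combines
  closure-finiteness with the requirement that the boundary of a cell lies in cells of lower
  dimension; the last condition is the weak topology (its converse holds trivially).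
\<close>
definition CW_structure ::
  "'a topology \<Rightarrow> 'a set set \<Rightarrow> ('a set \<Rightarrow> nat) \<Rightarrow> ('a set \<Rightarrow> (nat \<Rightarrow> real) \<Rightarrow> 'a) \<Rightarrow> bool" where
  "CW_structure X E d \<Phi> \<longleftrightarrow>
     Hausdorff_space X \<and>
     partition_on (topspace X) E \<and>
     (\<forall>e\<in>E. continuous_map (disc (d e)) X (\<Phi> e) \<and>
        homeomorphic_map (subtopology (disc (d e)) (open_ball_set (d e))) (subtopology X e) (\<Phi> e) \<and>
        (\<exists>F. finite F \<and> F \<subseteq> E \<and> (\<forall>c\<in>F. d c < d e) \<and> \<Phi> e ` sphere_set (d e) \<subseteq> \<Union>F)) \<and>
     (\<forall>C. C \<subseteq> topspace X \<longrightarrow> (\<forall>e\<in>E. closedin X (C \<inter> X closure_of e)) \<longrightarrow> closedin X C)"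

definition CW_complex :: "'a topology \<Rightarrow> bool" where
  "CW_complex X \<longleftrightarrow> (\<exists>E d \<Phi>. CW_structure X E d \<Phi>)"

end

theory Submission
  imports Defs
begin

text \<open>
  Let \<open>X = U \<union> V\<close>, and let \<open>B\<close> be the common boundary of \<open>U\<close> and \<open>V\<close>. Call a subset of \<open>S\<close> small if
  it lies in an open second countable subset of \<open>S\<close>. The interiors of \<open>U\<close> and \<open>V\<close> are connected
  and metrizable, hence small (\<open>connected_metrizable_imp_small\<close>). If \<open>B\<close> were small as well, then \<open>X\<close>
  would be second countable and regular, hence metrizable, which an MSIB excludes. So \<open>B\<close> is not
  small, although it lies in the closure of a countable set \<open>D\<close>.

  Now suppose that \<open>S\<close> is homotopy equivalent to a CW complex. The image of \<open>D\<close> lies in a countable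
  subcomplex, which is closed and \<open>\<sigma>\<close>-compact. Going to the complex and back therefore deforms the
  inclusion of \<open>X\<close> into a map whose values lie in one small open set \<open>M\<close>
  (\<open>homotopic_into_small\<close>). The failure of \<open>B\<close> to be small has one of two reasons, and each of
  them contradicts this deformation.

  Either \<open>B\<close> has uncountably many components. Only countably many of them meet \<open>M\<close>, so some component
  \<open>A\<close> misses \<open>M\<close>. A loop that runs from another component to \<open>A\<close> inside \<open>U\<close> and returns inside \<open>V\<close>
  crosses \<open>A\<close> once, whereas the deformed loop avoids \<open>A\<close>. Since \<open>A\<close> is closed in \<open>S\<close> and has the two
  sides \<open>U\<close> and \<open>V\<close>, the parity of crossings with \<open>A\<close> is a homotopy invariant. This is expressed
  through the double cover of \<open>S\<close> that interchanges its sheets along \<open>A\<close>, pulled back to squares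
  (\<open>two_sided_crossing_persists\<close>).

  Or some component \<open>A\<close> of \<open>B\<close> is not small. Interiors that are second countable do not prevent this:
  \<open>A\<close> can contain a long ray. Then \<open>A\<close> contains a transfinite continuous sequence of points in which
  every countable set of indices is bounded (\<open>non_small_imp_long_line\<close>). Along such a sequence a map
  into a small open set is eventually constant, and the set of times at which the deformation is
  eventually constant is open and closed in the unit interval. It contains 1 but not 0
  (\<open>long_line_no_homotopy_into_small\<close>).
\<close>

section \<open>Metrizability and small sets\<close>

text \<open>
  Urysohn's metrization theorem: countably many Urysohn functions, one for each nested pair of basic
  open sets, embed the space in a countable power of the real line.
\<close>
lemma regular_second_countable_imp_metrizable:
  assumes "regular_space X" "Hausdorff_space X" "second_countable X"
  shows "metrizable_space X"
proof -
  have "normal_space X"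
    using assms regular_Lindelof_imp_normal_space second_countable_imp_Lindelof_space by blast
  obtain \<B> where \<B>: "countable \<B>" "\<And>V. V \<in> \<B> \<Longrightarrow> openin X V"
    and base: "\<And>O' x. openin X O' \<Longrightarrow> x \<in> O' \<Longrightarrow> \<exists>V\<in>\<B>. x \<in> V \<and> V \<subseteq> O'"
    using assms(3) unfolding second_countable_def by metis
  define Q where "Q \<equiv> \<lambda>W V f. continuous_map X euclideanreal f \<and>
          (openin X V \<and> X closure_of W \<subseteq> V \<longrightarrow> (\<forall>x\<in>W \<inter> topspace X. f x = 0) \<and> (\<forall>x\<in>topspace X - V. f x = (1::real)))"
  have "\<exists>f. Q W V f" for W V
  proof (cases "openin X V \<and> X closure_of W \<subseteq> V")
    case True
    have "closedin X (topspace X - V)" "disjnt (X closure_of W) (topspace X - V)"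
      using True by (auto simp: disjnt_def)
    then obtain f where "continuous_map X euclideanreal f" "f ` (X closure_of W) \<subseteq> {0}" "f ` (topspace X - V) \<subseteq> {1}"
      using Urysohn_lemma_alt[OF \<open>normal_space X\<close> closedin_closure_of] by metis
    moreover have "W \<inter> topspace X \<subseteq> X closure_of W"
      by (metis Int_commute closure_of_subset_Int)
    ultimately have "continuous_map X euclideanreal f \<and> (\<forall>x\<in>W \<inter> topspace X. f x = 0) \<and> (\<forall>x\<in>topspace X - V. f x = 1)"
      by blast
    then show ?thesis
      unfolding Q_def by blast
  next
    case False
    have "continuous_map X euclideanreal (\<lambda>x. 0)"
      by simp
    with False show ?thesis
      unfolding Q_def by blast
  qed
  then obtain F where "\<And>W V. Q W V (F W V)"
    by metis
  then have F: "\<And>W V. continuous_map X euclideanreal (F W V)"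
    and F01: "\<And>W V x. openin X V \<Longrightarrow> X closure_of W \<subseteq> V \<Longrightarrow> x \<in> W \<inter> topspace X \<Longrightarrow> F W V x = 0"
      "\<And>W V x. openin X V \<Longrightarrow> X closure_of W \<subseteq> V \<Longrightarrow> x \<in> topspace X - V \<Longrightarrow> F W V x = 1"
    unfolding Q_def by blast+
  define p where "p \<equiv> from_nat_into (\<B> \<times> \<B>)"
  define e where "e \<equiv> \<lambda>x (n::nat). F (fst (p n)) (snd (p n)) x"
  have sep: "\<exists>n. e x n = 0 \<and> (\<forall>y\<in>topspace X - O'. e y n = 1)" if O': "openin X O'" "x \<in> O'" for x O'
  proof -
    obtain V where V: "V \<in> \<B>" "x \<in> V" "V \<subseteq> O'"
      using base O' by metis
    obtain P Q where P: "openin X P" "closedin X Q" "x \<in> P" "P \<subseteq> Q" "Q \<subseteq> V"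
      using assms(1) \<B>(2) V unfolding neighbourhood_base_of_closedin[symmetric] neighbourhood_base_of by metis
    obtain W where W: "W \<in> \<B>" "x \<in> W" "W \<subseteq> P"
      using base P by metis
    have clW: "X closure_of W \<subseteq> V"
      using P W by (meson closure_of_minimal subset_trans)
    have "(W, V) \<in> \<B> \<times> \<B>"
      using V W by auto
    then obtain n where "p n = (W, V)"
      unfolding p_def using \<B>(1) from_nat_into_surj[of "\<B> \<times> \<B>" "(W, V)"] by auto
    moreover have "x \<in> W \<inter> topspace X"
      using openin_subset[OF O'(1)] O' W by auto
    ultimately show ?thesis
      using F01[OF \<B>(2)[OF V(1)] clW] V(3) by (intro exI[of _ n]) (auto simp: e_def)
  qed
  have cont: "continuous_map X euclidean e"
    unfolding euclidean_product_topology[symmetric] continuous_map_componentwise_UNIV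
    by (simp add: e_def F)
  have inj: "inj_on e (topspace X)"
  proof (rule inj_onI, rule ccontr)
    fix x y assume xy: "x \<in> topspace X" "y \<in> topspace X" "e x = e y" "x \<noteq> y"
    then obtain O' O'' where O': "openin X O'" "x \<in> O'" "y \<in> O''" "disjnt O' O''"
      using assms(2) unfolding Hausdorff_space_def by blast
    then obtain n where "e x n = 0" "\<forall>z\<in>topspace X - O'. e z n = 1"
      using sep by blast
    moreover have "y \<in> topspace X - O'"
      using xy O' by (auto simp: disjnt_iff)
    ultimately show False
      using xy by fastforce
  qed
  have "open_map X (top_of_set (e ` topspace X)) e"
    unfolding open_map_def
  proof (intro allI impI)
    fix O' assume O': "openin X O'"
    show "openin (top_of_set (e ` topspace X)) (e ` O')"
    proof (subst openin_subopen, intro ballI)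
      fix z assume "z \<in> e ` O'"
      then obtain x where x: "x \<in> O'" "z = e x" by auto
      obtain n where n: "e x n = 0" "\<And>y. y\<in>topspace X - O' \<Longrightarrow> e y n = 1"
        using sep[OF O' x(1)] by auto
      have "open {g :: nat \<Rightarrow> real. g n < 1}"
        by (intro open_Collect_less continuous_intros continuous_on_product_coordinates)
      then have "openin (top_of_set (e ` topspace X)) (e ` topspace X \<inter> {g. g n < 1})"
        by blast
      moreover have "z \<in> e ` topspace X \<inter> {g. g n < 1}"
        using x n O' openin_subset by fastforce
      moreover have "e ` topspace X \<inter> {g. g n < 1} \<subseteq> e ` O'"
        using n by fastforce
      ultimately show "\<exists>T. openin (top_of_set (e ` topspace X)) T \<and> z \<in> T \<and> T \<subseteq> e ` O'"
        by blast
    qed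
  qed
  then have "homeomorphic_map X (top_of_set (e ` topspace X)) e"
    using cont inj by (intro bijective_open_imp_homeomorphic_map) (auto simp: continuous_map_in_subtopology)
  moreover have "metrizable_space (top_of_set (e ` topspace X))"
    by (simp add: metrizable_space_subtopology metrizable_space_euclidean)
  ultimately show ?thesis
    using homeomorphic_map_imp_homeomorphic_space homeomorphic_metrizable_space by blast
qed

text \<open>
  The small sets form a \<open>\<sigma>\<close>-ideal. In a surface they are the sets that are covered by countably
  many charts, and they take over the role of the Lindeloef subsets.
\<close>
definition small_in :: "'a topology \<Rightarrow> 'a set \<Rightarrow> bool" where
  "small_in S Y \<longleftrightarrow> (\<exists>M. openin S M \<and> second_countable (subtopology S M) \<and> Y \<subseteq> M)"

lemma small_in_subset: "small_in S Y \<Longrightarrow> Z \<subseteq> Y \<Longrightarrow> small_in S Z"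
  unfolding small_in_def by blast

lemma small_in_imp_second_countable:
  "small_in S Y \<Longrightarrow> second_countable (subtopology S Y)"
  unfolding small_in_def
  by (metis inf.absorb2 second_countable_subtopology subtopology_subtopology)

text \<open>
  The union of countable bases of countably many open subspaces is a base of their union.
\<close>
lemma small_in_UN:
  assumes "countable I" "\<And>i. i \<in> I \<Longrightarrow> small_in S (Y i)"
  shows "small_in S (\<Union>i\<in>I. Y i)"
proof -
  obtain M where M: "\<And>i. i \<in> I \<Longrightarrow> openin S (M i)" "\<And>i. i \<in> I \<Longrightarrow> second_countable (subtopology S (M i))"
    "\<And>i. i \<in> I \<Longrightarrow> Y i \<subseteq> M i"
    using assms(2) unfolding small_in_def by metis
  then have "\<forall>i\<in>I. \<exists>\<B>. countable \<B> \<and> (\<forall>V\<in>\<B>. openin (subtopology S (M i)) V) \<and>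
       (\<forall>O' x. openin (subtopology S (M i)) O' \<and> x \<in> O' \<longrightarrow> (\<exists>V\<in>\<B>. x \<in> V \<and> V \<subseteq> O'))"
    unfolding second_countable_def by blast
  then obtain \<B> where \<B>: "\<And>i. i \<in> I \<Longrightarrow> countable (\<B> i)"
    "\<And>i V. i \<in> I \<Longrightarrow> V \<in> \<B> i \<Longrightarrow> openin (subtopology S (M i)) V"
    "\<And>i O' x. i \<in> I \<Longrightarrow> openin (subtopology S (M i)) O' \<Longrightarrow> x \<in> O' \<Longrightarrow> \<exists>V\<in>\<B> i. x \<in> V \<and> V \<subseteq> O'"
    by metis
  have "second_countable (subtopology S (\<Union>i\<in>I. M i))"
    unfolding second_countable_def
  proof (intro exI[of _ "\<Union>i\<in>I. \<B> i"] conjI ballI allI impI)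
    show "countable (\<Union>i\<in>I. \<B> i)"
      using assms(1) \<B>(1) by blast
    fix V assume "V \<in> (\<Union>i\<in>I. \<B> i)"
    then obtain i where i: "i \<in> I" "V \<in> \<B> i" by auto
    then have "openin S V" "V \<subseteq> M i"
      using \<B>(2)[OF i] M(1) by (auto simp: openin_open_subtopology)
    then show "openin (subtopology S (\<Union>i\<in>I. M i)) V"
      using i by (metis openin_subset_topspace_eq UN_upper openin_subtopology_Int2 order_trans inf.absorb_iff2 openin_subtopology)
  next
    fix O' x assume "openin (subtopology S (\<Union>i\<in>I. M i)) O' \<and> x \<in> O'"
    moreover have "openin S (\<Union>i\<in>I. M i)" using M by auto
    ultimately have O': "openin S O'" "x \<in> O'" "O' \<subseteq> (\<Union>i\<in>I. M i)"
      by (auto simp: openin_open_subtopology)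
    then obtain i where i: "i \<in> I" "x \<in> M i" by auto
    have "openin (subtopology S (M i)) (O' \<inter> M i)"
      using O' by (simp add: openin_subtopology_Int)
    then obtain V where "V \<in> \<B> i" "x \<in> V" "V \<subseteq> O' \<inter> M i"
      using \<B>(3)[OF i(1)] O' i by blast
    then show "\<exists>V\<in>\<Union>i\<in>I. \<B> i. x \<in> V \<and> V \<subseteq> O'"
      using i by blast
  qed
  moreover have "openin S (\<Union>i\<in>I. M i)"
    using M(1) by auto
  moreover have "(\<Union>i\<in>I. Y i) \<subseteq> (\<Union>i\<in>I. M i)"
    using M(3) by (intro UN_mono) auto
  ultimately show ?thesis
    unfolding small_in_def by blast
qed

lemma small_in_Un: "small_in S Y \<Longrightarrow> small_in S Z \<Longrightarrow> small_in S (Y \<union> Z)"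
  using small_in_UN[of "{True,False}" S "\<lambda>b. if b then Y else Z"]
  by (auto simp: Un_commute)

lemma small_in_separable:
  assumes "small_in S Y" "Y \<subseteq> topspace S"
  obtains D where "countable D" "D \<subseteq> Y" "Y \<subseteq> S closure_of D"
proof -
  have "separable_space (subtopology S Y)"
    using assms small_in_imp_second_countable second_countable_imp_separable_space by blast
  then obtain D where "countable D" "D \<subseteq> Y" "subtopology S Y closure_of D = topspace S \<inter> Y"
    unfolding separable_space_def by auto
  then show ?thesis
    using that[of D] assms(2) closure_of_subtopology_subset[of S Y D] by auto
qed

definition locally_second_countable :: "'a topology \<Rightarrow> bool" where
  "locally_second_countable S \<longleftrightarrow> (\<forall>x\<in>topspace S. \<exists>W. openin S W \<and> x \<in> W \<and> second_countable (subtopology S W))"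

lemma locally_small_in:
  assumes "locally_second_countable S" "x \<in> topspace S"
  obtains W where "openin S W" "x \<in> W" "small_in S W"
  using assms unfolding locally_second_countable_def small_in_def by blast

lemma small_in_compact:
  assumes "locally_second_countable S" "compactin S Y"
  shows "small_in S Y"
proof -
  obtain \<F> where \<F>: "finite \<F>" "\<F> \<subseteq> {W. openin S W \<and> small_in S W}" "Y \<subseteq> \<Union>\<F>"
  proof -
    have "Y \<subseteq> \<Union>{W. openin S W \<and> small_in S W}"
      using locally_small_in[OF assms(1)] compactin_subset_topspace[OF assms(2)] by blast
    then show thesis
      using that assms(2) unfolding compactin_def by (metis (no_types, lifting) mem_Collect_eq)
  qed
  then have "small_in S (\<Union>W\<in>\<F>. W)"
    by (intro small_in_UN) (auto simp: countable_finite)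
  then show ?thesis
    using \<F>(3) small_in_subset[of S "\<Union>W\<in>\<F>. W" Y] by simp
qed

text \<open>
  A form of Alexandroff's theorem that a connected, locally separable metrizable space is separable.
  Starting with one point, repeatedly adjoin countable dense subsets of small balls around the
  points found so far. If the radii are chosen nearly as large as smallness of the ball permits, the
  balls around all points so obtained have a closed union: close to a limit point all these radii
  are bounded from below. By connectedness the union is everything.
\<close>
lemma connected_metrizable_imp_small:
  assumes lsc: "locally_second_countable S" and conn: "connectedin S G"
    and met: "metrizable_space (subtopology S G)"
  shows "small_in S G"
proof (cases "G = {}")
  case True
  have "small_in S {}"
    using small_in_UN[of "{}" S "\<lambda>x. {}"] by simp
  then show ?thesis using True by simp
next
  case False
  have GS: "G \<subseteq> topspace S"
    using conn connectedin_subset_topspace by blast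
  obtain M d where Md: "Metric_space M d" "subtopology S G = Metric_space.mtopology M d"
    using met unfolding metrizable_space_def by blast
  interpret Metric_space M d by fact
  have MG: "M = G"
    using arg_cong[OF Md(2), of topspace] GS by auto
  have open_ball: "\<exists>O'. openin S O' \<and> mball x e = O' \<inter> G" for x e
  proof -
    have "openin (subtopology S G) (mball x e)"
      by (simp only: Md(2) openin_mball)
    then show ?thesis by (simp only: openin_subtopology)
  qed
  have ex: "\<exists>e>0. e \<le> 1 \<and> small_in S (mball x e)" if "x \<in> G" for x
  proof -
    have "x \<in> topspace S" using that GS by blast
    then obtain W where W: "openin S W" "x \<in> W" "small_in S W"
      by (rule locally_small_in[OF lsc])
    have "openin mtopology (W \<inter> G)"
      using W(1) openin_subtopology_Int[of S W G] by (simp only: Md(2))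
    then have "\<forall>y. y \<in> W \<inter> G \<longrightarrow> (\<exists>e>0. mball y e \<subseteq> W \<inter> G)"
      by (simp add: openin_mtopology)
    moreover have "x \<in> W \<inter> G" using W(2) that by simp
    ultimately obtain e where e: "e > 0" "mball x e \<subseteq> W \<inter> G"
      by metis
    have "mball x (min e 1) \<subseteq> W"
      using e mball_subset_concentric[of "min e 1" e x] by auto
    then show ?thesis
      using W(3) e(1) small_in_subset by (intro exI[of _ "min e 1"]) auto
  qed
  \<comment> \<open>radii that are at least half as large as possible\<close>
  have "\<exists>r>0. small_in S (mball x r) \<and> (\<forall>e\<le>1. small_in S (mball x e) \<longrightarrow> e \<le> 2 * r)" if "x \<in> G" for x
  proof -
    define R where "R = {e. 0 < e \<and> e \<le> 1 \<and> small_in S (mball x e)}"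
    have R: "R \<noteq> {}" "bdd_above R"
      using ex[OF that] unfolding R_def by (auto simp: bdd_above_def)
    obtain e0 where "e0 \<in> R" using R by auto
    then have pos: "Sup R > 0"
      using R cSup_upper[of e0 R] unfolding R_def by auto
    then have "Sup R / 2 < Sup R" by simp
    then obtain r where r: "r \<in> R" "Sup R / 2 < r"
      using less_cSup_iff[OF R] by blast
    have "e \<le> 2 * r" if "e \<le> 1" "small_in S (mball x e)" for e
    proof (cases "e > 0")
      case True
      then have "e \<le> Sup R" using that R by (intro cSup_upper) (auto simp: R_def)
      then show ?thesis using r by simp
    next
      case False
      then show ?thesis using r pos by simp
    qed
    then show ?thesis
      using r unfolding R_def by blast
  qed
  then obtain r where r: "\<And>x. x \<in> G \<Longrightarrow> r x > 0" "\<And>x. x \<in> G \<Longrightarrow> small_in S (mball x (r x))"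
    "\<And>x e. x \<in> G \<Longrightarrow> e \<le> 1 \<Longrightarrow> small_in S (mball x e) \<Longrightarrow> e \<le> 2 * r x"
    by metis
  have "\<exists>E. countable E \<and> E \<subseteq> mball x (r x) \<and> mball x (r x) \<subseteq> S closure_of E" if "x \<in> G" for x
  proof -
    have "mball x (r x) \<subseteq> topspace S"
      using mball_subset_mspace[of x "r x"] MG GS by auto
    from small_in_separable[OF r(2)[OF that] this] show ?thesis
      by metis
  qed
  then obtain E where E: "\<And>x. x \<in> G \<Longrightarrow> countable (E x)" "\<And>x. x \<in> G \<Longrightarrow> E x \<subseteq> mball x (r x)"
    "\<And>x. x \<in> G \<Longrightarrow> mball x (r x) \<subseteq> S closure_of (E x)"
    by metis
  obtain x0 where x0: "x0 \<in> G" using False by auto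
  define D where "D = rec_nat {x0} (\<lambda>n Z. \<Union>y\<in>Z. E y)"
  have D0: "D 0 = {x0}" and DS: "\<And>n. D (Suc n) = (\<Union>y\<in>D n. E y)"
    by (simp_all add: D_def)
  have DG: "D n \<subseteq> G" for n
  proof (induction n)
    case (Suc n)
    then have "E y \<subseteq> G" if "y \<in> D n" for y
      using that E(2)[of y] mball_subset_mspace[of y "r y"] MG by blast
    then show ?case unfolding DS by blast
  qed (use x0 D0 in auto)
  have Dc: "countable (D n)" for n
  proof (induction n)
    case (Suc n)
    then show ?case unfolding DS using E(1) DG by (intro countable_UN) auto
  qed (simp add: D0)
  define C where "C = (\<Union>y\<in>(\<Union>n. D n). mball y (r y))"
  have "openin mtopology C"
    unfolding C_def by auto
  moreover have "closedin mtopology C"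
    unfolding closedin_metric
  proof (intro conjI allI impI)
    show "C \<subseteq> M" unfolding C_def by auto
    fix x assume x: "x \<in> M - C"
    obtain e where e: "e > 0" "e \<le> 1" "small_in S (mball x e)"
      using ex x MG by auto
    \<comment> \<open>a centre \<open>w\<close> at distance less than \<open>e/4\<close> from \<open>x\<close> has a small ball of radius \<open>3*e/4\<close>, so \<open>r w\<close> exceeds \<open>e/4\<close>\<close>
    have "disjnt C (mball x (e/8))"
    proof (rule ccontr)
      assume "\<not> disjnt C (mball x (e/8))"
      then obtain z n y where z: "d x z < e/8" "z \<in> M" "y \<in> D n" "z \<in> mball y (r y)"
        unfolding C_def disjnt_iff in_mball UN_iff by blast
      obtain O' where O': "openin S O'" "mball z (e/8) = O' \<inter> G"
        using open_ball by blast
      have "y \<in> G" using z(3) DG by blast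
      then have "z \<in> S closure_of (E y)"
        using E(3) z(4) by blast
      moreover have "z \<in> O'"
        using O'(2) e(1) z(2) centre_in_mball_iff[of z "e/8"] by auto
      ultimately have "\<exists>w\<in>E y. w \<in> O'"
        using O'(1) unfolding in_closure_of by blast
      then obtain w where w: "w \<in> E y" "w \<in> O'"
        by blast
      have wD: "w \<in> D (Suc n)" using w z unfolding DS by blast
      then have wG: "w \<in> G" using DG by blast
      then have "d z w < e/8" using w O'(2) by (metis IntI in_mball)
      then have xw: "d x w < e/4"
        using triangle[of x z w] x z wG MG by auto
      have xwM: "x \<in> M" "w \<in> M" using x wG MG by auto
      have "mball w (3*e/4) \<subseteq> mball x e"
      proof
        fix v assume v: "v \<in> mball w (3*e/4)"
        then have "d x v \<le> d x w + d w v"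
          using triangle xwM by auto
        then show "v \<in> mball x e"
          using v xw xwM by auto
      qed
      then have "small_in S (mball w (3*e/4))"
        using e(3) small_in_subset by blast
      then have "3*e/4 \<le> 2 * r w"
        using r(3)[OF wG, of "3*e/4"] e by auto
      then have "x \<in> mball w (r w)"
        using xw xwM e by (auto simp: commute[of x w])
      then show False
        using x wD unfolding C_def by blast
    qed
    then show "\<exists>r>0. disjnt C (mball x r)"
      using e(1) by (intro exI[of _ "e/8"]) auto
  qed
  moreover have "connected_space mtopology"
    using conn Md(2) by (simp add: connectedin_def)
  moreover have "x0 \<in> C"
  proof -
    have "x0 \<in> mball x0 (r x0)"
      using r(1)[OF x0] x0 MG centre_in_mball_iff[of x0 "r x0"] by simp
    moreover have "x0 \<in> (\<Union>n. D n)" using D0 by blast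
    ultimately show ?thesis unfolding C_def by blast
  qed
  ultimately have "C = G"
    using MG by (metis connected_space_clopen_in empty_iff topspace_mtopology)
  moreover have "small_in S C"
    unfolding C_def using Dc DG r(2) by (intro small_in_UN) auto
  ultimately show ?thesis by simp
qed

section \<open>Countable subcomplexes of CW complexes\<close>

lemma compact_space_disc: "compact_space (disc n)"
proof -
  let ?Z = "{x :: nat \<Rightarrow> real. \<forall>i\<ge>n. x i = 0}" and ?D = "{x :: nat \<Rightarrow> real. (\<Sum>i<n. (x i)\<^sup>2) \<le> 1}"
  let ?P = "PiE UNIV (\<lambda>i. if i < n then {-1..1} else {0}) :: (nat \<Rightarrow> real) set"
  have "\<forall>i\<in>UNIV. compactin euclideanreal (if i < n then {-1..1} else {0})"
    by simp
  then have "compactin (powertop_real UNIV) ?P"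
    unfolding compactin_PiE by blast
  then have "compact ?P"
    by (simp add: euclidean_product_topology)
  have "closed ?D"
    by (intro closed_Collect_le continuous_intros continuous_on_product_coordinates)
  moreover have "closed ?Z"
    using closedin_Euclidean_space[of n] by (simp add: topspace_Euclidean_space euclidean_product_topology)
  moreover have "?Z \<inter> ?D \<subseteq> ?P"
  proof
    fix x assume x: "x \<in> ?Z \<inter> ?D"
    have "\<bar>x i\<bar> \<le> 1" if "i < n" for i
    proof -
      have "(x i)\<^sup>2 \<le> (\<Sum>i<n. (x i)\<^sup>2)"
        using that by (intro member_le_sum) auto
      then have "(x i)\<^sup>2 \<le> 1"
        using x by auto
      then show ?thesis
        by (simp add: abs_square_le_1)
    qed
    then show "x \<in> ?P"
      using x by (auto simp: abs_le_iff PiE_iff minus_le_iff)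
  qed
  ultimately have "compact (?Z \<inter> ?D)"
    using compact_Int_closed[OF \<open>compact ?P\<close>, of "?Z \<inter> ?D"]
    by (simp add: closed_Int inf.absorb2)
  moreover have "disc n = top_of_set (?Z \<inter> ?D)"
    unfolding disc_def Euclidean_space_def by (simp add: euclidean_product_topology subtopology_subtopology)
  ultimately show ?thesis
    by (simp add: compact_space_subtopology)
qed

text \<open>
  A countable set meets only countably many cells, and each cell lies in a finite subcomplex by
  induction on the dimension. The union of these finite subcomplexes is a countable subcomplex \<open>T\<close>. It is
  closed by the weak topology: the closure of a cell lies in a finite subcomplex, whose intersection
  with \<open>T\<close> is again a finite subcomplex and so compact.
\<close>
lemma CW_structure_countable_hull:
  assumes CW: "CW_structure K E d \<Phi>" and D: "countable D" "D \<subseteq> topspace K"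
  obtains T where "countable T" "D \<subseteq> \<Union>T" "closedin K (\<Union>T)" "\<And>e. e \<in> T \<Longrightarrow> \<exists>C. compactin K C \<and> e \<subseteq> C"
proof -
  have haus: "Hausdorff_space K" and part: "partition_on (topspace K) E"
    and cont: "\<And>e. e \<in> E \<Longrightarrow> continuous_map (disc (d e)) K (\<Phi> e)"
    and homeo: "\<And>e. e \<in> E \<Longrightarrow> homeomorphic_map (subtopology (disc (d e)) (open_ball_set (d e))) (subtopology K e) (\<Phi> e)"
    and fin: "\<forall>e\<in>E. \<exists>F. finite F \<and> F \<subseteq> E \<and> (\<forall>c\<in>F. d c < d e) \<and> \<Phi> e ` sphere_set (d e) \<subseteq> \<Union>F"
    and weak: "\<And>C. C \<subseteq> topspace K \<Longrightarrow> (\<forall>e\<in>E. closedin K (C \<inter> K closure_of e)) \<Longrightarrow> closedin K C"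
    using CW unfolding CW_structure_def by blast+
  obtain F where F0: "\<forall>e\<in>E. finite (F e) \<and> F e \<subseteq> E \<and> (\<forall>c\<in>F e. d c < d e) \<and> \<Phi> e ` sphere_set (d e) \<subseteq> \<Union>(F e)"
    using bchoice[OF fin] by (rule exE)
  have F: "\<And>e. e \<in> E \<Longrightarrow> finite (F e)" "\<And>e. e \<in> E \<Longrightarrow> F e \<subseteq> E"
    "\<And>e c. e \<in> E \<Longrightarrow> c \<in> F e \<Longrightarrow> d c < d e" "\<And>e. e \<in> E \<Longrightarrow> \<Phi> e ` sphere_set (d e) \<subseteq> \<Union>(F e)"
    using F0 by simp_all
  define cl where "cl e = \<Phi> e ` topspace (disc (d e))" for e
  have ES: "\<Union>E = topspace K"
    using part by (simp add: partition_on_def)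
  have cl_compact: "compactin K (cl e)" if "e \<in> E" for e
    unfolding cl_def using cont[OF that] compact_space_disc[of "d e"]
    by (intro image_compactin[of "disc (d e)"]) (auto simp: compact_space_def)
  have disc_split: "topspace (disc n) = open_ball_set n \<union> sphere_set n" for n
    unfolding disc_def open_ball_set_def sphere_set_def by auto
  have ball: "\<Phi> e ` open_ball_set (d e) = e" if "e \<in> E" for e
  proof -
    have "\<Phi> e ` topspace (subtopology (disc (d e)) (open_ball_set (d e))) = topspace (subtopology K e)"
      using homeo[OF that] homeomorphic_imp_surjective_map by blast
    moreover have "topspace (subtopology (disc (d e)) (open_ball_set (d e))) = open_ball_set (d e)"
      using disc_split by auto
    moreover have "topspace (subtopology K e) = e"
      using ES that by auto
    ultimately show ?thesis by simp
  qed
  have cl_lower: "e \<subseteq> cl e" and cl_upper: "cl e \<subseteq> e \<union> \<Union>(F e)" if "e \<in> E" for e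
    using ball[OF that] F(4)[OF that] unfolding cl_def disc_split by auto
  \<comment> \<open>subcomplexes: with each cell they contain the finitely many lower cells \<open>F e\<close> that carry its attaching sphere\<close>
  define sub where "sub T \<longleftrightarrow> T \<subseteq> E \<and> (\<forall>e\<in>T. F e \<subseteq> T)" for T
  have cl_sub: "cl e \<subseteq> \<Union>T" if "sub T" "e \<in> T" for T e
    using that cl_upper[of e] unfolding sub_def by blast
  have fin_closed: "closedin K (\<Union>T)" if "finite T" "sub T" for T
  proof -
    have TE: "T \<subseteq> E" using that unfolding sub_def by blast
    have "\<Union>T = (\<Union>e\<in>T. cl e)"
      using cl_sub[OF that(2)] cl_lower TE by blast
    moreover have "compactin K (\<Union>e\<in>T. cl e)"
      using that TE cl_compact by (intro compactin_Union) auto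
    ultimately show ?thesis
      using haus compactin_imp_closedin by fastforce
  qed
  have hull: "\<exists>T. finite T \<and> sub T \<and> e \<in> T" if "e \<in> E" for e
    using that
  proof (induction "d e" arbitrary: e rule: less_induct)
    case less
    have "\<forall>c\<in>F e. \<exists>T. finite T \<and> sub T \<and> c \<in> T"
      using less F by blast
    then obtain H where H: "\<forall>c\<in>F e. finite (H c) \<and> sub (H c) \<and> c \<in> H c"
      by (rule bchoice[THEN exE])
    let ?T = "insert e (\<Union>c\<in>F e. H c)"
    have "finite ?T" using H F(1)[OF less.prems] by auto
    moreover have "sub ?T"
      using H less.prems unfolding sub_def by blast
    ultimately show ?case by blast
  qed
  have sub_closed: "closedin K (\<Union>T)" if "sub T" for T
  proof (rule weak)
    show "\<Union>T \<subseteq> topspace K"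
      using that ES unfolding sub_def by blast
    show "\<forall>e\<in>E. closedin K (\<Union>T \<inter> K closure_of e)"
    proof
      fix e assume e: "e \<in> E"
      obtain H where H: "finite H" "sub H" "e \<in> H"
        using hull[OF e] by blast
      have "K closure_of e \<subseteq> cl e"
        using cl_lower[OF e] compactin_imp_closedin[OF haus cl_compact[OF e]] by (rule closure_of_minimal)
      then have "K closure_of e \<subseteq> \<Union>H"
        using cl_sub[OF H(2,3)] by blast
      moreover have "\<Union>T \<inter> \<Union>H = \<Union>(T \<inter> H)"
      proof -
        have "c = c'" if "c \<in> T" "c' \<in> H" "x \<in> c" "x \<in> c'" for c c' x
        proof -
          have "c \<in> E" "c' \<in> E" using that \<open>sub T\<close> H(2) unfolding sub_def by auto
          then show ?thesis
            using part that unfolding partition_on_def disjoint_def by blast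
        qed
        then show ?thesis by blast
      qed
      ultimately have "\<Union>T \<inter> K closure_of e = \<Union>(T \<inter> H) \<inter> K closure_of e"
        by blast
      moreover have "closedin K (\<Union>(T \<inter> H))"
        using H that by (intro fin_closed) (auto simp: sub_def)
      ultimately show "closedin K (\<Union>T \<inter> K closure_of e)"
        by (simp add: closedin_Int)
    qed
  qed
  have "\<forall>x\<in>D. \<exists>T. finite T \<and> sub T \<and> x \<in> \<Union>T"
  proof
    fix x assume "x \<in> D"
    then obtain e where "e \<in> E" "x \<in> e" using D(2) ES by blast
    then show "\<exists>T. finite T \<and> sub T \<and> x \<in> \<Union>T" using hull by blast
  qed
  then obtain H where H: "\<forall>x\<in>D. finite (H x) \<and> sub (H x) \<and> x \<in> \<Union>(H x)"
    by (rule bchoice[THEN exE])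
  let ?T = "\<Union>x\<in>D. H x"
  show thesis
  proof (rule that)
    show "countable ?T"
      using D(1) H by (intro countable_UN) (auto simp: countable_finite)
    show "D \<subseteq> \<Union>?T" using H by blast
    have "sub ?T" using H unfolding sub_def by blast
    then show "closedin K (\<Union>?T)" by (rule sub_closed)
    fix e assume "e \<in> ?T"
    then have "e \<in> E" using \<open>sub ?T\<close> unfolding sub_def by blast
    then show "\<exists>C. compactin K C \<and> e \<subseteq> C" using cl_compact cl_lower by blast
  qed
qed

text \<open>
  Smallness is gained only after the return to \<open>S\<close>: a countable subcomplex is \<open>\<sigma>\<close>-compact, and a
  \<open>\<sigma>\<close>-compact subset of \<open>S\<close> is covered by countably many second countable open sets. Closedness of
  the subcomplex carries the image of the countable set \<open>D\<close> over to the image of its closure.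
\<close>
lemma homotopic_into_small:
  assumes CW: "CW_complex K" and eq: "S homotopy_equivalent_space K"
    and lsc: "locally_second_countable S"
    and D: "countable D" "D \<subseteq> topspace S" and X: "X \<subseteq> S closure_of D"
  obtains H M where "continuous_map (prod_topology (top_of_set {0..1}) (subtopology S X)) S H"
    "\<And>x. x \<in> X \<Longrightarrow> H (0::real, x) = x" "\<And>x. x \<in> X \<Longrightarrow> H (1, x) \<in> M"
    "openin S M" "small_in S M"
proof -
  obtain g h where g: "continuous_map S K g" and h: "continuous_map K S h"
    and hom: "homotopic_with (\<lambda>x. True) S S (h \<circ> g) id"
    using eq unfolding homotopy_equivalent_space_def by blast
  obtain E d \<Phi> where E: "CW_structure K E d \<Phi>"
    using CW unfolding CW_complex_def by blast
  have gD: "countable (g ` D)" "g ` D \<subseteq> topspace K"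
    using D continuous_map_image_subset_topspace[OF g] by auto
  obtain T where T: "countable T" "g ` D \<subseteq> \<Union>T" "closedin K (\<Union>T)"
    "\<And>e. e \<in> T \<Longrightarrow> \<exists>C. compactin K C \<and> e \<subseteq> C"
    using CW_structure_countable_hull[OF E gD] by metis
  have "small_in S (h ` e)" if e: "e \<in> T" for e
  proof -
    obtain C where C: "compactin K C" "e \<subseteq> C" using T(4)[OF e] by blast
    have "compactin S (h ` C)" using C(1) h by (rule image_compactin)
    then show ?thesis
      using small_in_compact[OF lsc] small_in_subset C(2) by (metis image_mono)
  qed
  then have "small_in S (\<Union>e\<in>T. h ` e)"
    using T(1) by (intro small_in_UN) auto
  then have "small_in S (h ` \<Union>T)"
    by (simp add: image_Union)
  then have "\<exists>M. openin S M \<and> second_countable (subtopology S M) \<and> h ` \<Union>T \<subseteq> M"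
    by (simp only: small_in_def)
  then obtain M where M: "openin S M" "second_countable (subtopology S M)" "h ` \<Union>T \<subseteq> M"
    by metis
  have "g ` X \<subseteq> \<Union>T"
  proof -
    have "g ` X \<subseteq> g ` (S closure_of D)" using X by (rule image_mono)
    also have "\<dots> \<subseteq> K closure_of (g ` D)"
      using g by (rule continuous_map_image_closure_subset)
    also have "\<dots> \<subseteq> \<Union>T" using T(2,3) by (rule closure_of_minimal)
    finally show ?thesis .
  qed
  then have hgX: "h (g x) \<in> M" if "x \<in> X" for x
    using M(3) that by blast
  obtain H where H: "continuous_map (prod_topology (top_of_set {0..1}) S) S H"
    "\<And>x. H (0::real, x) = id x" "\<And>x. H (1, x) = (h \<circ> g) x"
    using homotopic_with_symD[OF hom] unfolding homotopic_with_def by blast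
  show thesis
  proof (rule that)
    show "continuous_map (prod_topology (top_of_set {0..1}) (subtopology S X)) S H"
      using continuous_map_from_subtopology[OF H(1), of "UNIV \<times> X"]
      by (simp add: subtopology_Times)
    show "H (0, x) = x" if "x \<in> X" for x using H(2) by simp
    show "H (1, x) \<in> M" if x: "x \<in> X" for x using H(3) hgX[OF x] by simp
    show "openin S M" by fact
    show "small_in S M" unfolding small_in_def using M(1,2) by (intro exI[of _ M]) simp
  qed
qed

section \<open>Crossing a two-sided closed set\<close>

text \<open>
  Consider the double cover of \<open>S\<close> that interchanges its two sheets whenever a path passes through
  the closed set \<open>A\<close> from \<open>U\<close> to the complement of \<open>U\<close>. A function \<open>s\<close> with this property is a
  section over \<open>N\<close> of the pullback of this cover along \<open>G\<close>: away from \<open>A\<close> it is locally constant, and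
  near a point that \<open>G\<close> maps to \<open>A\<close> it is equal or opposite to the label telling whether \<open>G\<close>
  takes its value in \<open>U\<close>. On \<open>A\<close> itself the label is that of the side \<open>U\<close>.
\<close>
definition sheet :: "('q::topological_space \<Rightarrow> 'a) \<Rightarrow> 'a set \<Rightarrow> 'a set \<Rightarrow> 'q set \<Rightarrow> ('q \<Rightarrow> bool) \<Rightarrow> bool" where
  "sheet G A U N s \<longleftrightarrow>
     (\<forall>q\<in>N. \<exists>W. open W \<and> q \<in> W \<and> (\<forall>q'\<in>N \<inter> W. (s q' = s q) = (G q \<in> A \<longrightarrow> G q' \<in> U)))"

lemma sheetE:
  assumes "sheet G A U N s" "q \<in> N"
  obtains W where "open W" "q \<in> W" "\<And>q'. q' \<in> N \<Longrightarrow> q' \<in> W \<Longrightarrow> (s q' = s q) = (G q \<in> A \<longrightarrow> G q' \<in> U)"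
proof -
  have "\<exists>W. open W \<and> q \<in> W \<and> (\<forall>q'\<in>N \<inter> W. (s q' = s q) = (G q \<in> A \<longrightarrow> G q' \<in> U))"
    using assms(1)[unfolded sheet_def] assms(2) by (rule bspec)
  then obtain W where W: "open W" "q \<in> W" "\<forall>q'\<in>N \<inter> W. (s q' = s q) = (G q \<in> A \<longrightarrow> G q' \<in> U)"
    by (elim exE conjE) (rule that)
  show thesis
    by (rule that[OF W(1,2)], rule W(3)[rule_format], rule IntI)
qed

lemma sheet_subset:
  assumes s: "sheet G A U N s" and "N' \<subseteq> N"
  shows "sheet G A U N' s"
  unfolding sheet_def
proof
  fix q assume "q \<in> N'"
  then have "q \<in> N" using assms(2) by blast
  then obtain W where "open W" "q \<in> W" "\<And>q'. q' \<in> N \<Longrightarrow> q' \<in> W \<Longrightarrow> (s q' = s q) = (G q \<in> A \<longrightarrow> G q' \<in> U)"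
    by (rule sheetE[OF s]) blast
  then show "\<exists>W. open W \<and> q \<in> W \<and> (\<forall>q'\<in>N' \<inter> W. (s q' = s q) = (G q \<in> A \<longrightarrow> G q' \<in> U))"
    using assms(2) by (intro exI[of _ W]) auto
qed

lemma sheet_compose:
  assumes s: "sheet G A U N s" and \<phi>: "continuous_on N' \<phi>" "\<phi> ` N' \<subseteq> N"
  shows "sheet (\<lambda>q. G (\<phi> q)) A U N' (\<lambda>q. s (\<phi> q))"
  unfolding sheet_def
proof
  fix q assume q: "q \<in> N'"
  then have "\<phi> q \<in> N" using \<phi>(2) by blast
  then obtain W where W: "open W" "\<phi> q \<in> W"
    "\<And>q'. q' \<in> N \<Longrightarrow> q' \<in> W \<Longrightarrow> (s q' = s (\<phi> q)) = (G (\<phi> q) \<in> A \<longrightarrow> G q' \<in> U)"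
    by (rule sheetE[OF s]) blast
  obtain W' where W': "open W'" "W' \<inter> N' = \<phi> -` W \<inter> N'"
    using \<phi>(1) W(1) unfolding continuous_on_open_invariant by metis
  have "\<forall>q'\<in>N' \<inter> W'. (s (\<phi> q') = s (\<phi> q)) = (G (\<phi> q) \<in> A \<longrightarrow> G (\<phi> q') \<in> U)"
  proof
    fix q' assume q': "q' \<in> N' \<inter> W'"
    then have "\<phi> q' \<in> W" using W'(2) by blast
    moreover have "\<phi> q' \<in> N" using q' \<phi>(2) by blast
    ultimately show "(s (\<phi> q') = s (\<phi> q)) = (G (\<phi> q) \<in> A \<longrightarrow> G (\<phi> q') \<in> U)"
      using W(3) by blast
  qed
  moreover have "q \<in> W'" using W' W(2) q by blast
  ultimately show "\<exists>W. open W \<and> q \<in> W \<and> (\<forall>q'\<in>N' \<inter> W. (s (\<phi> q') = s (\<phi> q)) = (G (\<phi> q) \<in> A \<longrightarrow> G (\<phi> q') \<in> U))"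
    using W'(1) by blast
qed

lemma sheet_Not: "sheet G A U N s \<Longrightarrow> sheet G A U N (\<lambda>q. \<not> s q)"
  unfolding sheet_def by simp

lemma connected_locally_const:
  fixes f :: "'q::topological_space \<Rightarrow> 'b"
  assumes "connected N" "a \<in> N" "b \<in> N"
    and loc: "\<And>q. q \<in> N \<Longrightarrow> \<exists>W. open W \<and> q \<in> W \<and> (\<forall>q'\<in>N \<inter> W. f q' = f q)"
  shows "f a = f b"
proof (rule connected_local_const[OF assms(1-3)])
  show "\<forall>q\<in>N. \<forall>\<^sub>F q' in at q within N. f q = f q'"
  proof
    fix q assume "q \<in> N"
    then obtain W where "open W" "q \<in> W" "\<forall>q'\<in>N \<inter> W. f q' = f q"
      using loc by blast
    then show "\<forall>\<^sub>F q' in at q within N. f q = f q'"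
      unfolding eventually_at_topological by (metis IntI)
  qed
qed

text \<open>
  Two sections of a double cover agree everywhere or nowhere on a connected set.
\<close>
lemma sheet_unique:
  assumes "connected N" "a \<in> N" "b \<in> N" and s: "sheet G A U N s" and s': "sheet G A U N s'"
  shows "(s a = s' a) = (s b = s' b)"
proof (rule connected_locally_const[OF assms(1-3)])
  fix q assume q: "q \<in> N"
  obtain W where W: "open W" "q \<in> W" "\<And>q'. q' \<in> N \<Longrightarrow> q' \<in> W \<Longrightarrow> (s q' = s q) = (G q \<in> A \<longrightarrow> G q' \<in> U)"
    by (rule sheetE[OF s q]) blast
  obtain W' where W': "open W'" "q \<in> W'" "\<And>q'. q' \<in> N \<Longrightarrow> q' \<in> W' \<Longrightarrow> (s' q' = s' q) = (G q \<in> A \<longrightarrow> G q' \<in> U)"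
    by (rule sheetE[OF s' q]) blast
  have "\<forall>q'\<in>N \<inter> (W \<inter> W'). (s q' = s' q') = (s q = s' q)"
  proof
    fix q' assume q': "q' \<in> N \<inter> (W \<inter> W')"
    then have "(s q' = s q) = (s' q' = s' q)"
      using W(3)[of q'] W'(3)[of q'] by blast
    then show "(s q' = s' q') = (s q = s' q)" by argo
  qed
  then show "\<exists>W. open W \<and> q \<in> W \<and> (\<forall>q'\<in>N \<inter> W. (s q' = s' q') = (s q = s' q))"
    using W(1,2) W'(1,2) by (intro exI[of _ "W \<inter> W'"]) auto
qed

lemma sheet_const:
  assumes "connected N" "a \<in> N" "b \<in> N" and s: "sheet G A U N s"
    and "(\<forall>q\<in>N. G q \<notin> A) \<or> (\<forall>q\<in>N. G q \<in> U)"
  shows "s a = s b"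
proof (rule connected_locally_const[OF assms(1-3)])
  fix q assume q: "q \<in> N"
  obtain W where W: "open W" "q \<in> W" "\<And>q'. q' \<in> N \<Longrightarrow> q' \<in> W \<Longrightarrow> (s q' = s q) = (G q \<in> A \<longrightarrow> G q' \<in> U)"
    by (rule sheetE[OF s q]) blast
  have "\<forall>q'\<in>N \<inter> W. s q' = s q"
    using W(3) assms(5) q by blast
  then show "\<exists>W. open W \<and> q \<in> W \<and> (\<forall>q'\<in>N \<inter> W. s q' = s q)"
    using W(1,2) by blast
qed

lemma sheet_glue_agreeing:
  assumes "closed N1" "closed N2" and s1: "sheet G A U N1 s1" and s2: "sheet G A U N2 s2"
    and agree: "\<And>q. q \<in> N1 \<Longrightarrow> q \<in> N2 \<Longrightarrow> s1 q = s2 q"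
  shows "sheet G A U (N1 \<union> N2) (\<lambda>q. if q \<in> N1 then s1 q else s2 q)"
  unfolding sheet_def
proof
  fix q assume "q \<in> N1 \<union> N2"
  have "\<exists>W. open W \<and> q \<in> W \<and> (\<forall>q'\<in>N1 \<inter> W. ((if q' \<in> N1 then s1 q' else s2 q') = (if q \<in> N1 then s1 q else s2 q)) = (G q \<in> A \<longrightarrow> G q' \<in> U))"
  proof (cases "q \<in> N1")
    case True
    then obtain W where "open W" "q \<in> W" "\<And>q'. q' \<in> N1 \<Longrightarrow> q' \<in> W \<Longrightarrow> (s1 q' = s1 q) = (G q \<in> A \<longrightarrow> G q' \<in> U)"
      by (rule sheetE[OF s1]) blast
    then show ?thesis using True by (intro exI[of _ W]) simp
  next
    case False
    then show ?thesis using assms(1) by (intro exI[of _ "- N1"]) auto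
  qed
  then obtain W1 where W1: "open W1" "q \<in> W1" "\<forall>q'\<in>N1 \<inter> W1. ((if q' \<in> N1 then s1 q' else s2 q') = (if q \<in> N1 then s1 q else s2 q)) = (G q \<in> A \<longrightarrow> G q' \<in> U)"
    by blast
  have eq2: "(if q' \<in> N1 then s1 q' else s2 q') = s2 q'" if "q' \<in> N2" for q'
    using agree that by auto
  have "\<exists>W. open W \<and> q \<in> W \<and> (\<forall>q'\<in>N2 \<inter> W. ((if q' \<in> N1 then s1 q' else s2 q') = (if q \<in> N1 then s1 q else s2 q)) = (G q \<in> A \<longrightarrow> G q' \<in> U))"
  proof (cases "q \<in> N2")
    case True
    then obtain W where "open W" "q \<in> W" "\<And>q'. q' \<in> N2 \<Longrightarrow> q' \<in> W \<Longrightarrow> (s2 q' = s2 q) = (G q \<in> A \<longrightarrow> G q' \<in> U)"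
      by (rule sheetE[OF s2]) blast
    then show ?thesis using True by (intro exI[of _ W]) (simp add: eq2)
  next
    case False
    then show ?thesis using assms(2) by (intro exI[of _ "- N2"]) auto
  qed
  then obtain W2 where W2: "open W2" "q \<in> W2" "\<forall>q'\<in>N2 \<inter> W2. ((if q' \<in> N1 then s1 q' else s2 q') = (if q \<in> N1 then s1 q else s2 q)) = (G q \<in> A \<longrightarrow> G q' \<in> U)"
    by blast
  show "\<exists>W. open W \<and> q \<in> W \<and> (\<forall>q'\<in>(N1 \<union> N2) \<inter> W. ((if q' \<in> N1 then s1 q' else s2 q') = (if q \<in> N1 then s1 q else s2 q)) = (G q \<in> A \<longrightarrow> G q' \<in> U))"
  proof (intro exI[of _ "W1 \<inter> W2"] conjI ballI)
    show "open (W1 \<inter> W2)" using W1(1) W2(1) by (rule open_Int)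
    show "q \<in> W1 \<inter> W2" using W1(2) W2(2) by (rule IntI)
    fix q' assume q': "q' \<in> (N1 \<union> N2) \<inter> (W1 \<inter> W2)"
    then consider "q' \<in> N1 \<inter> W1" | "q' \<in> N2 \<inter> W2" by blast
    then show "((if q' \<in> N1 then s1 q' else s2 q') = (if q \<in> N1 then s1 q else s2 q)) = (G q \<in> A \<longrightarrow> G q' \<in> U)"
      by cases (rule W1(3)[rule_format], assumption, rule W2(3)[rule_format], assumption)
  qed
qed

text \<open>
  Over the connected seam the two sections agree or are opposite. In the second case one of them is
  negated before gluing.
\<close>
lemma sheet_glue:
  assumes "closed N1" "closed N2" "connected (N1 \<inter> N2)" and s1: "sheet G A U N1 s1" and s2: "sheet G A U N2 s2"
  shows "\<exists>s. sheet G A U (N1 \<union> N2) s"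
proof (cases "\<exists>a. a \<in> N1 \<inter> N2 \<and> s1 a \<noteq> s2 a")
  case True
  then obtain a where a: "a \<in> N1 \<inter> N2" "s1 a \<noteq> s2 a" by blast
  have s12: "sheet G A U (N1 \<inter> N2) s1" "sheet G A U (N1 \<inter> N2) s2"
    by (rule sheet_subset[OF s1], simp, rule sheet_subset[OF s2], simp)
  have flip: "s1 q = (\<not> s2 q)" if "q \<in> N1" "q \<in> N2" for q
  proof -
    have "q \<in> N1 \<inter> N2" using that by simp
    from sheet_unique[OF assms(3) a(1) this s12] show ?thesis using a(2) by simp
  qed
  show ?thesis
    by (rule exI, rule sheet_glue_agreeing[OF assms(1,2) s1 sheet_Not[OF s2]], rule flip)
next
  case False
  then have agree: "s1 q = s2 q" if "q \<in> N1" "q \<in> N2" for q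
    using that by auto
  show ?thesis
    by (rule exI, rule sheet_glue_agreeing[OF assms(1,2) s1 s2], rule agree)
qed

text \<open>
  The two open sets say that near \<open>A\<close> the label by membership in \<open>U\<close> is locally constant off \<open>A\<close>.
\<close>
definition two_sided :: "'a topology \<Rightarrow> 'a set \<Rightarrow> 'a set \<Rightarrow> bool" where
  "two_sided S A U \<longleftrightarrow> A \<subseteq> U \<and> closedin S A \<and>
     (\<forall>a\<in>A. \<exists>W. openin S W \<and> a \<in> W \<and> openin S (W \<inter> U - A) \<and> openin S (W - U))"

lemma sheet_local:
  assumes ts: "two_sided S A U" and G: "continuous_map (top_of_set Q) S G" and q0: "q0 \<in> Q"
  shows "\<exists>W s. open W \<and> q0 \<in> W \<and> sheet G A U (Q \<inter> W) s"
proof -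
  have AU: "A \<subseteq> U" and clA: "closedin S A" using ts unfolding two_sided_def by blast+
  have pre: "\<exists>W. open W \<and> {q \<in> Q. G q \<in> P} = Q \<inter> W" if "openin S P" for P
  proof -
    have "openin (top_of_set Q) {q \<in> topspace (top_of_set Q). G q \<in> P}"
      using G that by (rule openin_continuous_map_preimage)
    then show ?thesis unfolding openin_open by simp
  qed
  have GS: "G q \<in> topspace S" if "q \<in> Q" for q
    using continuous_map_image_subset_topspace[OF G] that by auto
  obtain WA where WA: "open WA" "{q \<in> Q. G q \<in> topspace S - A} = Q \<inter> WA"
    using pre clA by blast
  show ?thesis
  proof (cases "G q0 \<in> A")
    case False
    have "G q \<notin> A" if "q \<in> Q \<inter> WA" for q using that WA(2) by blast
    then have "sheet G A U (Q \<inter> WA) (\<lambda>q. True)"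
      unfolding sheet_def using WA(1) by blast
    moreover have "q0 \<in> WA" using WA(2) q0 False GS by blast
    ultimately show ?thesis using WA(1) by blast
  next
    case True
    then obtain P where P: "openin S P" "G q0 \<in> P" "openin S (P \<inter> U - A)" "openin S (P - U)"
      using ts unfolding two_sided_def by blast
    obtain W where W: "open W" "{q \<in> Q. G q \<in> P} = Q \<inter> W"
      using pre[OF P(1)] by blast
    obtain W1 where W1: "open W1" "{q \<in> Q. G q \<in> P \<inter> U - A} = Q \<inter> W1"
      using pre[OF P(3)] by blast
    obtain W2 where W2: "open W2" "{q \<in> Q. G q \<in> P - U} = Q \<inter> W2"
      using pre[OF P(4)] by blast
    have "sheet G A U (Q \<inter> W) (\<lambda>q. G q \<in> U)"
      unfolding sheet_def
    proof
      fix q assume q: "q \<in> Q \<inter> W"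
      then have qP: "G q \<in> P" using W(2) by blast
      consider "G q \<in> A" | "G q \<in> P \<inter> U - A" | "G q \<in> P - U" using qP by blast
      then show "\<exists>W'. open W' \<and> q \<in> W' \<and> (\<forall>q'\<in>Q \<inter> W \<inter> W'. ((G q' \<in> U) = (G q \<in> U)) = (G q \<in> A \<longrightarrow> G q' \<in> U))"
      proof cases
        case 1
        then show ?thesis using AU by (intro exI[of _ UNIV]) auto
      next
        case 2
        then have "q \<in> W1" using W1(2) q by blast
        moreover have "G q' \<in> U" if "q' \<in> Q \<inter> W1" for q' using W1(2) that by blast
        ultimately show ?thesis using W1(1) 2 by (intro exI[of _ W1]) auto
      next
        case 3
        then have "q \<in> W2" using W2(2) q by blast
        moreover have "G q' \<notin> U" if "q' \<in> Q \<inter> W2" for q' using W2(2) that by blast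
        ultimately show ?thesis using W2(1) 3 AU by (intro exI[of _ W2]) auto
      qed
    qed
    moreover have "q0 \<in> W" using W(2) P(2) q0 by blast
    ultimately show ?thesis using W(1) by blast
  qed
qed

text \<open>
  The square is simply connected, so the pulled back double cover has a section. Local sections are
  glued by bisection, first along thin vertical strips and then across the strips. In the first step the
  width of the strip has to be kept as a parameter, because it shrinks with each gluing.
\<close>
lemma sheet_square:
  fixes G :: "real \<times> real \<Rightarrow> 'a"
  assumes ts: "two_sided S A U" and G: "continuous_map (top_of_set ({0..1} \<times> {0..1})) S G"
  shows "\<exists>s. sheet G A U ({0..1} \<times> {0..1}) s"
proof -
  define R where "R a b c e = ({a..b} \<inter> {0..1}) \<times> ({c..e} \<inter> {0..1::real})" for a b c e :: real
  have R_closed: "closed (R a b c e)" for a b c e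
    unfolding R_def by (intro closed_Times closed_Int) auto
  have R_conn: "connected (R a b c e)" for a b c e
    unfolding R_def Int_atLeastAtMost by (intro connected_Times) auto
  have R_sub: "R a b c e \<subseteq> {0..1} \<times> {0..1}" for a b c e
    unfolding R_def by auto
  \<comment> \<open>\<open>Q x c e\<close>: sections exist over all rectangles of height from \<open>c\<close> to \<open>e\<close> around the abscissa \<open>x\<close> that are thin enough\<close>
  define Q where "Q x c e \<longleftrightarrow> (\<exists>d>0. \<forall>a b. a \<le> x \<and> x \<le> b \<and> b - a < d \<longrightarrow> (\<exists>s. sheet G A U (R a b c e) s))" for x c e
  have strip: "Q x 0 1" if x: "0 \<le> x" "x \<le> 1" for x
  proof (rule Bolzano[of 0 1 "Q x"])
    show "(0::real) \<le> 1" by simp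
  next
    fix c m e assume cm: "Q x c m" and me: "Q x m e" and "c \<le> m" "m \<le> e"
    obtain d1 where d1: "d1 > 0" "\<forall>a b. a \<le> x \<and> x \<le> b \<and> b - a < d1 \<longrightarrow> (\<exists>s. sheet G A U (R a b c m) s)"
      using cm unfolding Q_def by (elim exE conjE) (rule that)
    obtain d2 where d2: "d2 > 0" "\<forall>a b. a \<le> x \<and> x \<le> b \<and> b - a < d2 \<longrightarrow> (\<exists>s. sheet G A U (R a b m e) s)"
      using me unfolding Q_def by (elim exE conjE) (rule that)
    show "Q x c e"
      unfolding Q_def
    proof (intro exI[of _ "min d1 d2"] conjI allI impI)
      show "min d1 d2 > 0" using d1(1) d2(1) by simp
      fix a b assume ab: "a \<le> x \<and> x \<le> b \<and> b - a < min d1 d2"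
      have "\<exists>s. sheet G A U (R a b c m) s" using ab by (intro d1(2)[rule_format]) auto
      then obtain s1 where s1: "sheet G A U (R a b c m) s1" by (elim exE) (rule that)
      have "\<exists>s. sheet G A U (R a b m e) s" using ab by (intro d2(2)[rule_format]) auto
      then obtain s2 where s2: "sheet G A U (R a b m e) s2" by (elim exE) (rule that)
      have "R a b c m \<inter> R a b m e = R a b m m" "R a b c m \<union> R a b m e = R a b c e"
        using \<open>c \<le> m\<close> \<open>m \<le> e\<close> unfolding R_def by auto
      then show "\<exists>s. sheet G A U (R a b c e) s"
        using sheet_glue[OF R_closed R_closed _ s1 s2] R_conn by simp
    qed
  next
    fix y :: real assume "0 \<le> y" "y \<le> 1"
    then have "(x, y) \<in> {0..1} \<times> {0..1}" using x by auto
    from sheet_local[OF ts G this] obtain W s where W: "open W" "(x, y) \<in> W" "sheet G A U ({0..1} \<times> {0..1} \<inter> W) s"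
      by (elim exE conjE) (rule that)
    obtain \<epsilon> where \<epsilon>: "\<epsilon> > 0" "ball (x, y) \<epsilon> \<subseteq> W"
      by (rule openE[OF W(1,2)])
    have small: "sheet G A U (R a b c e) s" if "a \<le> x" "x \<le> b" "b - a < \<epsilon>/2" "c \<le> y" "y \<le> e" "e - c < \<epsilon>/2" for a b c e
    proof (rule sheet_subset[OF W(3)])
      have "R a b c e \<subseteq> ball (x, y) \<epsilon>"
      proof
        fix p assume p: "p \<in> R a b c e"
        obtain u v where uv: "p = (u, v)" by fastforce
        have "\<bar>x - u\<bar> < \<epsilon>/2" "\<bar>y - v\<bar> < \<epsilon>/2"
          using p that unfolding uv R_def abs_less_iff by auto
        moreover have "dist (x, y) (u, v) \<le> \<bar>x - u\<bar> + \<bar>y - v\<bar>"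
          unfolding dist_Pair_Pair dist_real_def using sqrt_sum_squares_le_sum_abs[of "\<bar>x - u\<bar>" "\<bar>y - v\<bar>"] by simp
        ultimately show "p \<in> ball (x, y) \<epsilon>" unfolding uv mem_ball by linarith
      qed
      then show "R a b c e \<subseteq> {0..1} \<times> {0..1} \<inter> W"
        using \<epsilon>(2) R_sub[of a b c e] by auto
    qed
    show "\<exists>d>0. \<forall>c e. c \<le> y \<and> y \<le> e \<and> e - c < d \<longrightarrow> Q x c e"
    proof (intro exI[of _ "\<epsilon>/2"] conjI allI impI)
      show "\<epsilon>/2 > 0" using \<epsilon>(1) by simp
      fix c e assume ce: "c \<le> y \<and> y \<le> e \<and> e - c < \<epsilon>/2"
      show "Q x c e"
        unfolding Q_def
      proof (intro exI[of _ "\<epsilon>/2"] conjI allI impI)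
        show "\<epsilon>/2 > 0" using \<epsilon>(1) by simp
        fix a b assume "a \<le> x \<and> x \<le> b \<and> b - a < \<epsilon>/2"
        then have "sheet G A U (R a b c e) s" using ce by (intro small) auto
        then show "\<exists>s. sheet G A U (R a b c e) s" by (intro exI[of _ s])
      qed
    qed
  qed
  have "\<exists>s. sheet G A U (R 0 1 0 1) s"
  proof (rule Bolzano[of 0 1 "\<lambda>a b. \<exists>s. sheet G A U (R a b 0 1) s"])
    show "(0::real) \<le> 1" by simp
  next
    fix a m b :: real
    assume am: "\<exists>s. sheet G A U (R a m 0 1) s" and mb: "\<exists>s. sheet G A U (R m b 0 1) s" and le: "a \<le> m" "m \<le> b"
    obtain s1 where s1: "sheet G A U (R a m 0 1) s1" using am by (elim exE) (rule that)
    obtain s2 where s2: "sheet G A U (R m b 0 1) s2" using mb by (elim exE) (rule that)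
    have "R a m 0 1 \<inter> R m b 0 1 = R m m 0 1" "R a m 0 1 \<union> R m b 0 1 = R a b 0 1"
      using le unfolding R_def by auto
    then show "\<exists>s. sheet G A U (R a b 0 1) s"
      using sheet_glue[OF R_closed R_closed _ s1 s2] R_conn by simp
  next
    fix x :: real assume "0 \<le> x" "x \<le> 1"
    then show "\<exists>d>0. \<forall>a b. a \<le> x \<and> x \<le> b \<and> b - a < d \<longrightarrow> (\<exists>s. sheet G A U (R a b 0 1) s)"
      using strip[of x] unfolding Q_def by simp
  qed
  then show ?thesis unfolding R_def by simp
qed

lemma continuous_map_homotopy_square:
  assumes H: "continuous_map (prod_topology (top_of_set {0..1::real}) (subtopology S X)) S H"
    and \<alpha>: "pathin (subtopology S U) \<alpha>" and UX: "U \<subseteq> X"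
  shows "continuous_map (top_of_set ({0..1} \<times> {0..1})) S (\<lambda>z. H (snd z, \<alpha> (fst z)))"
proof -
  have "continuous_map (top_of_set {0..1}) (subtopology S X) \<alpha>"
    using \<alpha> UX unfolding pathin_def by (auto simp: continuous_map_in_subtopology)
  moreover have f: "continuous_map (top_of_set ({0..1::real} \<times> {0..1::real})) (top_of_set {0..1}) fst"
    by (auto simp: continuous_map_in_subtopology intro!: continuous_on_fst)
  ultimately have "continuous_map (top_of_set ({0..1::real} \<times> {0..1::real})) (subtopology S X) (\<alpha> \<circ> fst)"
    by (rule continuous_map_compose[rotated])
  moreover have "continuous_map (top_of_set ({0..1::real} \<times> {0..1::real})) (top_of_set {0..1}) snd"
    by (auto simp: continuous_map_in_subtopology intro!: continuous_on_snd)
  ultimately have "continuous_map (top_of_set ({0..1::real} \<times> {0..1::real})) (prod_topology (top_of_set {0..1}) (subtopology S X)) (\<lambda>z. (snd z, (\<alpha> \<circ> fst) z))"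
    by (rule continuous_map_pairedI[rotated])
  from continuous_map_compose[OF this H] show ?thesis by (simp add: o_def)
qed

text \<open>
  The paths \<open>\<alpha>\<close> and \<open>\<beta>\<close> form a loop that crosses \<open>A\<close> exactly once, at \<open>q\<close>, in the sense of parity,
  although each of them may touch \<open>A\<close> many times from its own side. Its homotopy cannot end off
  \<open>A\<close>. Rather than a homotopy of loops, two squares over \<open>\<alpha>\<close> and \<open>\<beta>\<close> with common vertical edges are
  compared: along these edges the quotient of the two sections is constant, at the end of the
  homotopy both sections are constant, but at its start they differ by a sign at \<open>q\<close>.
\<close>
lemma two_sided_crossing_persists:
  assumes ts: "two_sided S A U"
    and V: "\<And>a. a \<in> A \<Longrightarrow> \<exists>W. openin S W \<and> a \<in> W \<and> W \<inter> U \<inter> V \<subseteq> A"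
    and H: "continuous_map (prod_topology (top_of_set {0..1::real}) (subtopology S (U \<union> V))) S H"
    and H0: "\<And>x. x \<in> U \<union> V \<Longrightarrow> H (0, x) = x" and H1: "\<And>x. x \<in> U \<union> V \<Longrightarrow> H (1, x) \<notin> A"
    and \<alpha>: "pathin (subtopology S U) \<alpha>" "\<alpha> 0 = p" "\<alpha> 1 = q"
    and \<beta>: "pathin (subtopology S V) \<beta>" "\<beta> 0 = p" "\<beta> 1 = q"
    and p: "p \<notin> A" and q: "q \<in> A"
  shows False
proof -
  let ?I = "{0..1::real}" and ?f = "\<lambda>z :: real \<times> real. H (snd z, \<alpha> (fst z))" and ?g = "\<lambda>z :: real \<times> real. H (snd z, \<beta> (fst z))"
  have AU: "A \<subseteq> U" and clA: "closedin S A" using ts unfolding two_sided_def by simp_all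
  have conn: "connected ?I" by simp
  have \<alpha>U: "\<alpha> t \<in> U" and \<beta>V: "\<beta> t \<in> V" if "t \<in> ?I" for t
    using \<alpha>(1) \<beta>(1) that unfolding pathin_def continuous_map_in_subtopology by auto
  obtain s where s: "sheet ?f A U (?I \<times> ?I) s"
    using sheet_square[OF ts continuous_map_homotopy_square[OF H \<alpha>(1) Un_upper1]] by (elim exE) (rule that)
  obtain s' where s': "sheet ?g A U (?I \<times> ?I) s'"
    using sheet_square[OF ts continuous_map_homotopy_square[OF H \<beta>(1) Un_upper2]] by (elim exE) (rule that)
  have vert: "continuous_on ?I (\<lambda>y. (c, y))" "(\<lambda>y. (c, y)) ` ?I \<subseteq> ?I \<times> ?I"
    and horiz: "continuous_on ?I (\<lambda>x. (x, c))" "(\<lambda>x. (x, c)) ` ?I \<subseteq> ?I \<times> ?I" if "c \<in> ?I" for c :: real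
    using that by (auto intro!: continuous_on_Pair continuous_on_const continuous_on_id)
  have zero: "(0::real) \<in> ?I" and one: "(1::real) \<in> ?I" by simp_all
  \<comment> \<open>both squares have the same left edge and the same right edge\<close>
  have left: "(s (0, 0) = s' (0, 0)) = (s (0, 1) = s' (0, 1))"
  proof (rule sheet_unique[OF conn zero one])
    show "sheet (\<lambda>y. H (y, p)) A U ?I (\<lambda>y. s (0, y))"
      using sheet_compose[OF s vert[OF zero]] \<alpha>(2) by simp
    show "sheet (\<lambda>y. H (y, p)) A U ?I (\<lambda>y. s' (0, y))"
      using sheet_compose[OF s' vert[OF zero]] \<beta>(2) by simp
  qed
  have right: "(s (1, 0) = s' (1, 0)) = (s (1, 1) = s' (1, 1))"
  proof (rule sheet_unique[OF conn zero one])
    show "sheet (\<lambda>y. H (y, q)) A U ?I (\<lambda>y. s (1, y))"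
      using sheet_compose[OF s vert[OF one]] \<alpha>(3) by simp
    show "sheet (\<lambda>y. H (y, q)) A U ?I (\<lambda>y. s' (1, y))"
      using sheet_compose[OF s' vert[OF one]] \<beta>(3) by simp
  qed
  have top: "s (0, 1) = s (1, 1)"
  proof (rule sheet_const[OF conn zero one])
    show "sheet (\<lambda>x. H (1, \<alpha> x)) A U ?I (\<lambda>x. s (x, 1))"
      using sheet_compose[OF s horiz[OF one]] by simp
    show "(\<forall>x\<in>?I. H (1, \<alpha> x) \<notin> A) \<or> (\<forall>x\<in>?I. H (1, \<alpha> x) \<in> U)"
      using H1 \<alpha>U by simp
  qed
  have top': "s' (0, 1) = s' (1, 1)"
  proof (rule sheet_const[OF conn zero one])
    show "sheet (\<lambda>x. H (1, \<beta> x)) A U ?I (\<lambda>x. s' (x, 1))"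
      using sheet_compose[OF s' horiz[OF one]] by simp
    show "(\<forall>x\<in>?I. H (1, \<beta> x) \<notin> A) \<or> (\<forall>x\<in>?I. H (1, \<beta> x) \<in> U)"
      using H1 \<beta>V by simp
  qed
  have bottom: "s (0, 0) = s (1, 0)"
  proof (rule sheet_const[OF conn zero one])
    show "sheet (\<lambda>x. H (0, \<alpha> x)) A U ?I (\<lambda>x. s (x, 0))"
      using sheet_compose[OF s horiz[OF zero]] by simp
    show "(\<forall>x\<in>?I. H (0, \<alpha> x) \<notin> A) \<or> (\<forall>x\<in>?I. H (0, \<alpha> x) \<in> U)"
      using H0 \<alpha>U by simp
  qed
  have b: "sheet (\<lambda>x. H (0, \<beta> x)) A U ?I (\<lambda>x. s' (x, 0))"
    using sheet_compose[OF s' horiz[OF zero]] by simp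
  have H\<beta>: "H (0, \<beta> x) = \<beta> x" if "x \<in> ?I" for x using H0 \<beta>V[OF that] by simp
  \<comment> \<open>on the side of V the sheet has to be read with the opposite label on the set A itself\<close>
  have bottom': "(s' (0, 0) \<noteq> (\<beta> 0 \<in> A)) = (s' (1, 0) \<noteq> (\<beta> 1 \<in> A))"
  proof (rule connected_locally_const[OF conn zero one])
    fix t assume t: "t \<in> ?I"
    obtain W where W: "open W" "t \<in> W" "\<And>t'. t' \<in> ?I \<Longrightarrow> t' \<in> W \<Longrightarrow> (s' (t', 0) = s' (t, 0)) = (H (0, \<beta> t) \<in> A \<longrightarrow> H (0, \<beta> t') \<in> U)"
      by (rule sheetE[OF b t]) (rule that)
    have pre: "\<exists>W'. open W' \<and> t \<in> W' \<and> (\<forall>t'\<in>?I \<inter> W'. \<beta> t' \<in> N)" if N: "openin S N" "\<beta> t \<in> N" for N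
    proof -
      have "continuous_map (top_of_set ?I) S \<beta>"
        using \<beta>(1) unfolding pathin_def continuous_map_in_subtopology by simp
      then have "openin (top_of_set ?I) {x \<in> topspace (top_of_set ?I). \<beta> x \<in> N}"
        using N(1) by (rule openin_continuous_map_preimage)
      then obtain W' where "open W'" "{x \<in> ?I. \<beta> x \<in> N} = ?I \<inter> W'"
        unfolding openin_open by auto
      then show ?thesis using t N(2) by (intro exI[of _ W']) auto
    qed
    have "\<exists>N. openin S N \<and> \<beta> t \<in> N \<and> (if \<beta> t \<in> A then N \<inter> U \<inter> V \<subseteq> A else N \<inter> A = {})"
    proof (cases "\<beta> t \<in> A")
      case True
      then show ?thesis using V[OF True] by simp
    next
      case False
      have "\<beta> t \<in> topspace S - A"
        using False \<beta>(1) t unfolding pathin_def continuous_map_in_subtopology continuous_map_def by auto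
      then show ?thesis using False clA by (intro exI[of _ "topspace S - A"]) auto
    qed
    then obtain N where N: "openin S N" "\<beta> t \<in> N" "if \<beta> t \<in> A then N \<inter> U \<inter> V \<subseteq> A else N \<inter> A = {}"
      by (elim exE conjE) (rule that)
    obtain W' where W': "open W'" "t \<in> W'" "\<forall>t'\<in>?I \<inter> W'. \<beta> t' \<in> N"
      using pre[OF N(1,2)] by (elim exE conjE) (rule that)
    have "(s' (t', 0) \<noteq> (\<beta> t' \<in> A)) = (s' (t, 0) \<noteq> (\<beta> t \<in> A))" if t': "t' \<in> ?I \<inter> (W \<inter> W')" for t'
    proof -
      have sW: "(s' (t', 0) = s' (t, 0)) = (\<beta> t \<in> A \<longrightarrow> \<beta> t' \<in> U)"
        using W(3)[of t'] t' H\<beta> t by simp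
      have tN: "\<beta> t' \<in> N" "\<beta> t' \<in> V" using W'(3) t' \<beta>V by simp_all
      show ?thesis
      proof (cases "\<beta> t \<in> A")
        case True
        then have "\<beta> t' \<in> U \<longleftrightarrow> \<beta> t' \<in> A" using N(3) tN AU by auto
        then show ?thesis using sW True by argo
      next
        case False
        then have "\<beta> t' \<notin> A" using N(3) tN by auto
        then show ?thesis using sW False by argo
      qed
    qed
    then show "\<exists>W. open W \<and> t \<in> W \<and> (\<forall>t'\<in>?I \<inter> W. (s' (t', 0) \<noteq> (\<beta> t' \<in> A)) = (s' (t, 0) \<noteq> (\<beta> t \<in> A)))"
      using W(1,2) W'(1,2) by (intro exI[of _ "W \<inter> W'"]) auto
  qed
  have "s' (0, 0) = (\<not> s' (1, 0))" using bottom' \<beta>(2,3) p q by simp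
  then show False using left right top top' bottom by argo
qed

lemma continuous_map_prod_subtopology:
  assumes "continuous_map (prod_topology Z (subtopology S X)) Y H" "B \<subseteq> X"
  shows "continuous_map (prod_topology Z (subtopology S B)) Y H"
proof -
  have "subtopology (subtopology S X) B = subtopology S B"
    using assms(2) by (simp add: subtopology_subtopology inf.absorb2)
  then have "prod_topology Z (subtopology S B) = subtopology (prod_topology Z (subtopology S X)) (topspace Z \<times> B)"
    using prod_topology_subtopology(2)[of Z "subtopology S X" B] by simp
  then show ?thesis using continuous_map_from_subtopology[OF assms(1)] by simp
qed

section \<open>Components of a 1-manifold that are not small\<close>

text \<open>
  Inverse charts are used throughout, so that subarcs are images of intervals.
\<close>
definition arc_chart :: "'a topology \<Rightarrow> (real \<Rightarrow> 'a) \<Rightarrow> bool" where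
  "arc_chart T \<psi> \<longleftrightarrow> continuous_map euclideanreal T \<psi> \<and> open_map euclideanreal T \<psi> \<and> inj \<psi>"

lemma arc_chart_reparametrize:
  assumes \<psi>: "arc_chart T \<psi>" and \<theta>: "continuous_on UNIV \<theta>" "inj \<theta>"
  shows "arc_chart T (\<lambda>t::real. \<psi> (\<theta> t))"
proof -
  have "continuous_map euclideanreal T (\<psi> \<circ> \<theta>)"
    using \<psi> \<theta>(1) unfolding arc_chart_def by (intro continuous_map_compose[of _ euclideanreal]) auto
  moreover have "open_map euclideanreal T (\<psi> \<circ> \<theta>)"
  proof (rule open_map_compose)
    show "open_map euclideanreal euclideanreal \<theta>"
      unfolding open_map_def
    proof (intro allI impI)
      fix W :: "real set" assume "openin euclideanreal W"
      then have "open W" by simp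
      moreover have "continuous_on W \<theta>" using \<theta>(1) by (rule continuous_on_subset) simp
      moreover have "inj_on \<theta> W" using \<theta>(2) by (rule inj_on_subset) simp
      ultimately have "open (\<theta> ` W)" using invariance_of_domain by metis
      then show "openin euclideanreal (\<theta> ` W)" by simp
    qed
    show "open_map euclideanreal T \<psi>" using \<psi> unfolding arc_chart_def by blast
  qed
  moreover have "inj (\<psi> \<circ> \<theta>)"
    using \<psi> \<theta>(2) unfolding arc_chart_def by (intro inj_compose) auto
  ultimately show ?thesis unfolding arc_chart_def comp_def by blast
qed

lemma arc_chart_reverse:
  assumes "arc_chart T \<psi>"
  shows "arc_chart T (\<lambda>t. \<psi> (- t))"
proof (rule arc_chart_reparametrize[OF assms])
  show "continuous_on UNIV (\<lambda>t::real. - t)"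
    by (rule continuous_on_minus[OF continuous_on_id])
  show "inj (\<lambda>t::real. - t)"
    by (rule injI) simp
qed

lemma closure_of_meets:
  assumes "x \<in> T closure_of W" "openin T Q" "x \<in> Q"
  obtains y where "y \<in> W" "y \<in> Q"
proof -
  have "\<exists>y. y \<in> W \<and> y \<in> Q"
    using assms by (simp add: in_closure_of)
  then show thesis by (elim exE conjE) (rule that)
qed

lemma arc_chart_in_open:
  assumes \<psi>: "arc_chart T \<psi>" and W: "openin T W" "\<psi> 0 \<in> W"
  obtains \<psi>' where "arc_chart T \<psi>'" "\<psi>' 0 = \<psi> 0" "range \<psi>' \<subseteq> W"
proof -
  have "openin euclideanreal {t \<in> topspace euclideanreal. \<psi> t \<in> W}"
    using \<psi> W(1) unfolding arc_chart_def by (intro openin_continuous_map_preimage) auto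
  then have "open {t. \<psi> t \<in> W}" by simp
  then obtain \<delta> where \<delta>: "\<delta> > 0" "ball 0 \<delta> \<subseteq> {t. \<psi> t \<in> W}"
    using W(2) open_contains_ball by (metis mem_Collect_eq)
  \<comment> \<open>an embedding of the line onto the interval from \<open>-\<delta>\<close> to \<open>\<delta>\<close>\<close>
  define \<theta> where "\<theta> t = \<delta> * (2 / pi) * arctan t" for t
  have "continuous_on UNIV \<theta>"
    unfolding \<theta>_def by (intro continuous_intros)
  moreover have "inj \<theta>"
    unfolding \<theta>_def using \<delta>(1) by (auto intro!: injI simp: arctan_eq_iff)
  ultimately have 1: "arc_chart T (\<lambda>t. \<psi> (\<theta> t))"
    using arc_chart_reparametrize[OF \<psi>] by blast
  have 2: "\<psi> (\<theta> 0) = \<psi> 0" by (simp add: \<theta>_def)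
  have "\<psi> (\<theta> t) \<in> W" for t
  proof -
    have "\<bar>arctan t\<bar> < pi / 2"
      using arctan_bounded[of t] by (auto simp: abs_less_iff)
    then have "\<bar>arctan t\<bar> * (2 / pi) < 1"
      by (simp add: field_simps)
    then have "\<delta> * (\<bar>arctan t\<bar> * (2 / pi)) < \<delta> * 1"
      using \<delta>(1) by (intro mult_strict_left_mono)
    moreover have "\<bar>\<theta> t\<bar> = \<delta> * (\<bar>arctan t\<bar> * (2 / pi))"
      using \<delta>(1) by (simp add: \<theta>_def abs_mult)
    ultimately have "\<theta> t \<in> ball 0 \<delta>" by simp
    then show ?thesis using \<delta>(2) by blast
  qed
  then show thesis using that[OF 1 2] by blast
qed

lemma arc_chart_image:
  assumes \<psi>: "arc_chart T \<psi>"
  shows "open I \<Longrightarrow> openin T (\<psi> ` I)" "connected I \<Longrightarrow> connectedin T (\<psi> ` I)" "compact I \<Longrightarrow> compactin T (\<psi> ` I)"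
    "range \<psi> \<subseteq> topspace T"
proof -
  have c: "continuous_map euclideanreal T \<psi>" and o: "open_map euclideanreal T \<psi>"
    using \<psi> unfolding arc_chart_def by blast+
  show "open I \<Longrightarrow> openin T (\<psi> ` I)"
    using o[unfolded open_map_def, rule_format, of I] by simp
  show "connected I \<Longrightarrow> connectedin T (\<psi> ` I)"
    using connectedin_continuous_map_image[OF c] by simp
  show "compact I \<Longrightarrow> compactin T (\<psi> ` I)"
    using image_compactin[OF _ c] by simp
  show "range \<psi> \<subseteq> topspace T"
    using continuous_map_image_subset_topspace[OF c] by simp
qed

lemma clopen_eq_connected:
  assumes "connectedin T C" "openin T W" "W \<subseteq> C" "W \<noteq> {}" "C \<inter> T closure_of W \<subseteq> W"
  shows "W = C"
proof (rule ccontr)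
  assume "W \<noteq> C"
  then have "C \<inter> T frontier_of W \<noteq> {}"
    using assms by (intro connectedin_Int_frontier_of) auto
  then show False
    using assms(2,5) by (auto simp: frontier_of_def interior_of_openin)
qed

definition one_manifold :: "'a topology \<Rightarrow> bool" where
  "one_manifold T \<longleftrightarrow> Hausdorff_space T \<and> (\<forall>x\<in>topspace T. \<exists>\<psi>. arc_chart T \<psi> \<and> \<psi> 0 = x)"

lemma one_manifold_arc:
  assumes "one_manifold T" "openin T W" "x \<in> W"
  obtains \<psi> where "arc_chart T \<psi>" "\<psi> 0 = x" "range \<psi> \<subseteq> W"
proof -
  have "x \<in> topspace T" using assms(2,3) openin_subset by blast
  then obtain \<psi> where \<psi>: "arc_chart T \<psi>" "\<psi> 0 = x"
    using assms(1) unfolding one_manifold_def by blast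
  show thesis
    using arc_chart_in_open[OF \<psi>(1) assms(2)] \<psi>(2) assms(3) that by metis
qed

lemma one_manifold_locally_connected:
  assumes "one_manifold T"
  shows "locally_connected_space T"
  unfolding locally_connected_space
proof (intro allI impI)
  fix W x assume "openin T W \<and> x \<in> W"
  then obtain \<psi> where \<psi>: "arc_chart T \<psi>" "\<psi> 0 = x" "range \<psi> \<subseteq> W"
    using one_manifold_arc[OF assms] by metis
  show "\<exists>V. openin T V \<and> connectedin T V \<and> x \<in> V \<and> V \<subseteq> W"
    using arc_chart_image(1,2)[OF \<psi>(1), of UNIV] \<psi>(2,3) by (intro exI[of _ "range \<psi>"]) auto
qed

text \<open>
  The arguments about 1-manifolds use only these closure properties of the small sets. The
  smallness in question is that of the surrounding surface.
\<close>
definition small_ideal :: "'a topology \<Rightarrow> ('a set \<Rightarrow> bool) \<Rightarrow> bool" where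
  "small_ideal T sm \<longleftrightarrow> (\<forall>Y Z. sm Y \<longrightarrow> Z \<subseteq> Y \<longrightarrow> sm Z) \<and>
     (\<forall>Y :: nat \<Rightarrow> 'a set. (\<forall>n. sm (Y n)) \<longrightarrow> sm (\<Union>n. Y n)) \<and> (\<forall>K. compactin T K \<longrightarrow> sm K)"

lemma small_idealD:
  assumes "small_ideal T sm"
  shows "sm Y \<Longrightarrow> Z \<subseteq> Y \<Longrightarrow> sm Z" "(\<And>n::nat. sm (Y' n)) \<Longrightarrow> sm (\<Union>n. Y' n)" "compactin T K \<Longrightarrow> sm K"
    "sm Y \<Longrightarrow> sm Y'' \<Longrightarrow> sm (Y \<union> Y'')"
proof -
  show 2: "\<And>Y' :: nat \<Rightarrow> 'a set. (\<And>n::nat. sm (Y' n)) \<Longrightarrow> sm (\<Union>n. Y' n)"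
    using assms unfolding small_ideal_def by metis
  show 1: "\<And>Y Z. sm Y \<Longrightarrow> Z \<subseteq> Y \<Longrightarrow> sm Z" "compactin T K \<Longrightarrow> sm K"
    using assms unfolding small_ideal_def by metis+
  show "sm Y \<Longrightarrow> sm Y'' \<Longrightarrow> sm (Y \<union> Y'')"
  proof -
    assume "sm Y" "sm Y''"
    then have "sm (\<Union>n::nat. if n = 0 then Y else Y'')" by (intro 2) auto
    moreover have "Y \<union> Y'' \<subseteq> (\<Union>n::nat. if n = 0 then Y else Y'')"
      by (auto intro: exI[of _ 0] exI[of _ "Suc 0"])
    ultimately show ?thesis by (rule 1(1))
  qed
qed

text \<open>
  Removing a point \<open>\<psi> 0\<close> leaves at most two components, one for each of the two arcs that leave the
  point, because a further component would be open and closed. So one of them is not small. It is a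
  1-manifold with a distinguished end, given by the arc \<open>\<psi>\<close> that enters it at the removed point.
\<close>
lemma not_small_side_of_point:
  assumes T: "one_manifold T" and sm: "small_ideal T sm" and A: "openin T A" "connectedin T A" "\<not> sm A"
  obtains C \<psi> where "openin T C" "connectedin T C" "\<not> sm C" "arc_chart T \<psi>" "\<psi> 0 \<notin> C" "\<psi> ` {0<..} \<subseteq> C"
proof -
  have "sm {}" using small_idealD(3)[OF sm, of "{}"] by simp
  then obtain p where p: "p \<in> A" using A(3) by fastforce
  obtain \<psi> where \<psi>: "arc_chart T \<psi>" "\<psi> 0 = p" "range \<psi> \<subseteq> A"
    using one_manifold_arc[OF T A(1) p] by metis
  note im = arc_chart_image[OF \<psi>(1)]
  have inj: "\<psi> s = \<psi> t \<longleftrightarrow> s = t" for s t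
    using \<psi>(1) unfolding arc_chart_def inj_def by blast
  have haus: "Hausdorff_space T" using T unfolding one_manifold_def by blast
  have AT: "A \<subseteq> topspace T" using A(1) openin_subset by blast
  \<comment> \<open>the components of \<open>A - {p}\<close> that contain the right and the left half of the arc are \<open>comp 1\<close> and \<open>comp (-1)\<close>\<close>
  define X where "X = subtopology T (A - {p})"
  have open_Ap: "openin T (A - {p})"
    using A(1) haus p AT by (intro openin_diff closedin_Hausdorff_singleton) auto
  have lc: "locally_connected_space X"
    unfolding X_def using one_manifold_locally_connected[OF T] open_Ap by (rule locally_connected_space_open_subset)
  define comp where "comp t = Collect (connected_component_of X (\<psi> t))" for t
  have openX: "openin X W \<Longrightarrow> openin T W" for W
    unfolding X_def using open_Ap by (simp add: openin_open_subtopology)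
  have comp_open: "openin T (comp t)" for t
    unfolding comp_def by (intro openX openin_connected_component_of_locally_connected_space lc)
  have comp_sub: "comp t \<subseteq> A - {p}" for t
    using connected_component_of_subset_topspace[of X "\<psi> t"] unfolding comp_def X_def by auto
  have comp_conn: "connectedin T (comp t)" for t
    using connectedin_connected_component_of[of X "\<psi> t"] unfolding comp_def X_def connectedin_subtopology by blast
  have ray: "\<psi> ` I \<subseteq> comp t" if "connected I" "t \<in> I" "0 \<notin> I" for I t
    unfolding comp_def
  proof (rule connected_component_of_maximal)
    have "\<psi> ` I \<subseteq> A - {p}"
      using \<psi>(2,3) inj that(3) by fastforce
    then show "connectedin X (\<psi> ` I)"
      unfolding X_def connectedin_subtopology using im(2)[OF that(1)] by blast
    show "\<psi> t \<in> \<psi> ` I" using that(2) by blast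
  qed
  have r1: "\<psi> ` {0<..} \<subseteq> comp 1" and r2: "\<psi> ` {..<0} \<subseteq> comp (-1)"
    by (intro ray; simp)+
  have tX: "topspace X = A - {p}" unfolding X_def using AT by auto
  have "A = {p} \<union> comp 1 \<union> comp (-1)"
  proof -
    let ?W = "{p} \<union> comp 1 \<union> comp (-1)"
    have "range \<psi> \<subseteq> ?W"
    proof
      fix x assume "x \<in> range \<psi>"
      then obtain t where t: "x = \<psi> t" by blast
      consider "t = 0" | "t > 0" | "t < 0" by linarith
      then show "x \<in> ?W" using r1 r2 t \<psi>(2) by cases auto
    qed
    then have "?W = range \<psi> \<union> comp 1 \<union> comp (-1)"
      using \<psi>(2) by auto
    then have oW: "openin T ?W"
      using im(1)[of UNIV] comp_open by (metis openin_Un open_UNIV)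
    have "A \<inter> T closure_of ?W \<subseteq> ?W"
    proof
      fix x assume x: "x \<in> A \<inter> T closure_of ?W"
      show "x \<in> ?W"
      proof (rule ccontr)
        assume nx: "x \<notin> ?W"
        then have xX: "x \<in> topspace X" using x tX by auto
        let ?D = "Collect (connected_component_of X x)"
        have "openin T ?D"
          by (intro openX openin_connected_component_of_locally_connected_space lc)
        moreover have "x \<in> ?D" using xX by (simp add: connected_component_of_refl)
        moreover have "x \<in> T closure_of ?W" using x by simp
        ultimately obtain y where y: "y \<in> ?W" "y \<in> ?D" by (elim closure_of_meets)
        have "p \<notin> ?D"
          using connected_component_of_subset_topspace[of X x] tX by auto
        then have "y \<in> comp 1 \<or> y \<in> comp (-1)" using y by auto
        then obtain t :: real where t: "y \<in> comp t" "t = 1 \<or> t = -1" by auto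
        have "connected_component_of X (\<psi> t) y" "connected_component_of X x y"
          using t(1) y(2) unfolding comp_def by simp_all
        then have "x \<in> comp t"
          unfolding comp_def mem_Collect_eq by (metis connected_component_of_trans connected_component_of_sym)
        then show False using nx t(2) by auto
      qed
    qed
    then show ?thesis
      using clopen_eq_connected[OF A(2) oW] p comp_sub by blast
  qed
  then have "\<not> (sm {p} \<and> sm (comp 1) \<and> sm (comp (-1)))"
    using A(3) small_idealD(4)[OF sm] by metis
  moreover have "sm {p}" using p AT by (intro small_idealD(3)[OF sm]) auto
  ultimately consider "\<not> sm (comp 1)" | "\<not> sm (comp (-1))" by blast
  then show thesis
  proof cases
    case 1
    then show ?thesis
      using that[OF comp_open comp_conn _ \<psi>(1)] r1 comp_sub \<psi>(2) by blast
  next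
    case 2
    have "arc_chart T (\<lambda>t. \<psi> (- t))"
      using \<psi>(1) by (rule arc_chart_reverse)
    moreover have "(\<lambda>t. \<psi> (- t)) ` {0<..} \<subseteq> comp (-1)"
      using r2 by auto
    moreover have "\<psi> (- 0) \<notin> comp (-1)" using comp_sub \<psi>(2) by auto
    ultimately show ?thesis
      using that[OF comp_open comp_conn 2] by blast
  qed
qed

text \<open>
  The indices \<open>K\<close> are open sets, ordered by inclusion, and stand for initial segments of a long ray;
  \<open>e K\<close> is the endpoint of \<open>K\<close>. The last condition says that an increasing sequence of segments has an
  upper bound in the family to whose endpoint the endpoints converge. It makes countable families
  bounded and replaces both countable ordinals and an explicit order on the manifold.
\<close>
definition long_line :: "'a topology \<Rightarrow> 'a set set \<Rightarrow> ('a set \<Rightarrow> 'a) \<Rightarrow> bool" where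
  "long_line T \<K> e \<longleftrightarrow> \<K> \<noteq> {} \<and> (\<forall>K\<in>\<K>. \<forall>K'\<in>\<K>. K \<subseteq> K' \<or> K' \<subseteq> K) \<and> (\<forall>K\<in>\<K>. \<exists>K'\<in>\<K>. K \<subset> K') \<and>
     (\<forall>K\<in>\<K>. e K \<in> topspace T) \<and> (\<forall>K\<in>\<K>. \<forall>K'\<in>\<K>. K \<subset> K' \<longrightarrow> e K \<noteq> e K') \<and>
     (\<forall>k. (\<forall>n::nat. k n \<in> \<K> \<and> k n \<subset> k (Suc n)) \<longrightarrow>
        (\<exists>K\<in>\<K>. (\<forall>n. k n \<subseteq> K) \<and> limitin T (\<lambda>n. e (k n)) (e K) sequentially))"

text \<open>
  The segments are the small connected open subsets of one side \<open>C\<close> of a point that contain the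
  initial arc \<open>J\<close> and have a single boundary point in \<open>C\<close>. A connected set that meets such a segment
  without lying in it contains its endpoint, and a nonempty small open set is never closed in \<open>C\<close>.
  These two facts give everything. Two segments are nested, since otherwise each would contain the
  endpoint of the other and their union would be open and closed. A segment is enlarged by an arc
  through its endpoint. The union \<open>K\<close> of an increasing sequence of segments is small and so has a
  boundary point; every small arc around such a point meets almost all segments without lying in
  them and hence contains almost all endpoints. So the endpoints converge to it, and \<open>K\<close> has no
  second boundary point.
\<close>
lemma non_small_imp_long_line:
  assumes T: "one_manifold T" and sm: "small_ideal T sm" and A: "openin T A" "connectedin T A" "\<not> sm A"
  obtains \<K> e where "long_line T \<K> e"
proof -
  obtain C \<psi> where C: "openin T C" "connectedin T C" "\<not> sm C" and \<psi>: "arc_chart T \<psi>" "\<psi> 0 \<notin> C" "\<psi> ` {0<..} \<subseteq> C"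
    by (rule not_small_side_of_point[OF assms])
  have haus: "Hausdorff_space T" using T unfolding one_manifold_def by blast
  have CT: "C \<subseteq> topspace T" using C(1) openin_subset by blast
  define J where "J = \<psi> ` {0<..<1}"
  define ends where "ends K = C \<inter> T closure_of K - K" for K
  define \<K> where "\<K> = {K. openin T K \<and> K \<subseteq> C \<and> connectedin T K \<and> sm K \<and> J \<subseteq> K \<and> (\<exists>x. ends K = {x})}"
  define e where "e K = the_elem (ends K)" for K
  have KD: "openin T K" "K \<subseteq> C" "connectedin T K" "sm K" "J \<subseteq> K" "ends K = {e K}" if "K \<in> \<K>" for K
    using that unfolding \<K>_def e_def by auto
  have KI: "K \<in> \<K> \<and> e K = x" if "openin T K" "K \<subseteq> C" "connectedin T K" "sm K" "J \<subseteq> K" "ends K = {x}" for K x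
    using that unfolding \<K>_def e_def by auto
  have J_ne: "J \<noteq> {}" unfolding J_def by auto
  have eC: "e K \<in> C" "e K \<notin> K" "e K \<in> T closure_of K" if "K \<in> \<K>" for K
    using KD(6)[OF that] unfolding ends_def by auto
  have closure_K: "C \<inter> T closure_of K \<subseteq> insert (e K) K" if "K \<in> \<K>" for K
    using KD(6)[OF that] unfolding ends_def by auto
  have meets: "e K \<in> N" if K: "K \<in> \<K>" and N: "connectedin T N" "N \<subseteq> C" "N \<inter> K \<noteq> {}" "N - K \<noteq> {}" for K N
  proof -
    have "N \<inter> T frontier_of K \<noteq> {}"
      using N(1,3,4) by (rule connectedin_Int_frontier_of)
    then have "N \<inter> (T closure_of K - K) \<noteq> {}"
      using KD(1)[OF K] by (simp add: frontier_of_def interior_of_openin)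
    then obtain y where y: "y \<in> N" "y \<in> T closure_of K" "y \<notin> K" by auto
    then have "y \<in> ends K" using N(2) unfolding ends_def by auto
    then show ?thesis using KD(6)[OF K] y(1) by simp
  qed
  have not_clopen: "\<not> C \<inter> T closure_of W \<subseteq> W" if "openin T W" "W \<subseteq> C" "W \<noteq> {}" "sm W" for W
    using clopen_eq_connected[OF C(2) that(1-3)] that(4) C(3) by blast
  have points_small: "sm {x}" if "x \<in> C" for x
    using that CT by (intro small_idealD(3)[OF sm]) auto
  have J: "J \<in> \<K>"
  proof -
    have "\<psi> 1 \<in> C" using \<psi>(3) by auto
    have inj: "\<psi> s = \<psi> t \<longleftrightarrow> s = t" for s t
      using \<psi>(1) unfolding arc_chart_def inj_def by blast
    have sub: "T closure_of J \<subseteq> \<psi> ` {0..1}"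
      using arc_chart_image(3)[OF \<psi>(1), of "{0..1}"] compactin_imp_closedin[OF haus]
      by (intro closure_of_minimal) (auto simp: J_def)
    have sup: "\<psi> ` {0..1} \<subseteq> T closure_of J"
    proof -
      have "continuous_map euclideanreal T \<psi>" using \<psi>(1) unfolding arc_chart_def by blast
      then have "\<psi> ` (euclideanreal closure_of {0<..<1}) \<subseteq> T closure_of (\<psi> ` {0<..<1})"
        using continuous_map_image_closure_subset by blast
      then show ?thesis unfolding J_def by simp
    qed
    have "ends J = {\<psi> 1}"
    proof
      show "{\<psi> 1} \<subseteq> ends J"
        using sup \<open>\<psi> 1 \<in> C\<close> inj unfolding ends_def by (auto simp: J_def)
      show "ends J \<subseteq> {\<psi> 1}"
      proof
        fix y assume y: "y \<in> ends J"
        then obtain t where t: "y = \<psi> t" "0 \<le> t" "t \<le> 1"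
          using sub unfolding ends_def by auto
        have "t \<noteq> 0" using y t \<psi>(2) unfolding ends_def by auto
        moreover have "\<not> (0 < t \<and> t < 1)" using y t unfolding ends_def J_def by auto
        ultimately show "y \<in> {\<psi> 1}" using t by auto
      qed
    qed
    moreover have "sm J"
    proof (rule small_idealD(1)[OF sm])
      show "sm (\<psi> ` {0..1})"
        by (intro small_idealD(3)[OF sm] arc_chart_image(3)[OF \<psi>(1)]) simp
      show "J \<subseteq> \<psi> ` {0..1}" unfolding J_def by (rule image_mono) auto
    qed
    moreover have "J \<subseteq> C" using \<psi>(3) unfolding J_def by auto
    ultimately show ?thesis
      using arc_chart_image(1,2)[OF \<psi>(1), of "{0<..<1}"] KI[of J] unfolding J_def by simp
  qed
  have chain: "K \<subseteq> K' \<or> K' \<subseteq> K" if K: "K \<in> \<K>" and K': "K' \<in> \<K>" for K K'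
  proof (rule ccontr)
    assume n: "\<not> ?thesis"
    have ne: "K \<inter> K' \<noteq> {}" using KD(5)[OF K] KD(5)[OF K'] J_ne by blast
    have "e K' \<in> K" "e K \<in> K'"
      using meets[OF K' KD(3)[OF K] KD(2)[OF K]] meets[OF K KD(3)[OF K'] KD(2)[OF K']] ne n by blast+
    then have "C \<inter> T closure_of (K \<union> K') \<subseteq> K \<union> K'"
      using closure_K[OF K] closure_K[OF K'] by (auto simp: closure_of_Un)
    moreover have "openin T (K \<union> K')" "K \<union> K' \<subseteq> C" "K \<union> K' \<noteq> {}" "sm (K \<union> K')"
      using KD[OF K] KD[OF K'] ne small_idealD(4)[OF sm] by auto
    ultimately show False using not_clopen by blast
  qed
  have enlarge: "\<exists>K'\<in>\<K>. K \<subset> K'" if K: "K \<in> \<K>" for K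
  proof -
    obtain \<phi> where \<phi>: "arc_chart T \<phi>" "\<phi> 0 = e K" "range \<phi> \<subseteq> C"
      by (rule one_manifold_arc[OF T C(1) eC(1)[OF K]])
    have "\<exists>\<phi>. arc_chart T \<phi> \<and> \<phi> 0 = e K \<and> range \<phi> \<subseteq> C \<and> \<phi> ` {..<0} \<inter> K \<noteq> {}"
    proof (cases "\<phi> ` {..<0} \<inter> K = {}")
      case False
      then show ?thesis using \<phi> by blast
    next
      case True
      have "openin T (range \<phi>)" using arc_chart_image(1)[OF \<phi>(1), of UNIV] by simp
      moreover have "e K \<in> range \<phi>" using \<phi>(2) by (metis rangeI)
      ultimately obtain y where "y \<in> K" "y \<in> range \<phi>"
        by (rule closure_of_meets[OF eC(3)[OF K]])
      then obtain t where t: "\<phi> t \<in> K" by auto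
      have "t \<noteq> 0" using t \<phi>(2) eC(2)[OF K] by auto
      moreover have "\<not> t < 0" using t True by auto
      ultimately have "- t < 0" by simp
      then have "(\<lambda>t. \<phi> (- t)) ` {..<0} \<inter> K \<noteq> {}" using t by (force intro: image_eqI[of _ _ "- t"])
      moreover have "arc_chart T (\<lambda>t. \<phi> (- t))"
        using \<phi>(1) by (rule arc_chart_reverse)
      moreover have "range (\<lambda>t. \<phi> (- t)) \<subseteq> C" using \<phi>(3) by auto
      ultimately show ?thesis using \<phi>(2) by (intro exI[of _ "\<lambda>t. \<phi> (- t)"]) simp
    qed
    then obtain \<phi> where \<phi>: "arc_chart T \<phi>" "\<phi> 0 = e K" "range \<phi> \<subseteq> C" "\<phi> ` {..<0} \<inter> K \<noteq> {}" by blast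
    note im = arc_chart_image[OF \<phi>(1)]
    have inj: "\<phi> s = \<phi> t \<longleftrightarrow> s = t" for s t
      using \<phi>(1) unfolding arc_chart_def inj_def by blast
    have side: "\<phi> ` I \<subseteq> K" if "connected I" "0 \<notin> I" "\<phi> ` I \<inter> K \<noteq> {}" for I
    proof (rule ccontr)
      assume "\<not> \<phi> ` I \<subseteq> K"
      then have "e K \<in> \<phi> ` I"
        using that \<phi>(3) by (intro meets[OF K im(2)[OF that(1)]]) auto
      then show False using \<phi>(2) inj that(2) by auto
    qed
    \<comment> \<open>the arc \<open>\<phi>\<close> leaves \<open>K\<close> at its endpoint; if it came back to \<open>K\<close>, adding the endpoint would make \<open>K\<close> open and closed in \<open>C\<close>\<close>
    have left: "\<phi> ` {..<0} \<subseteq> K" using \<phi>(4) by (intro side) auto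
    have right: "\<phi> ` {0<..} \<inter> K = {}"
    proof (rule ccontr)
      assume "\<phi> ` {0<..} \<inter> K \<noteq> {}"
      then have "\<phi> ` {0<..} \<subseteq> K" by (intro side) auto
      moreover have "range \<phi> = \<phi> ` {..<0} \<union> {\<phi> 0} \<union> \<phi> ` {0<..}"
      proof -
        have "(UNIV :: real set) = {..<0} \<union> {0} \<union> {0<..}" by auto
        then show ?thesis by (metis image_Un image_insert image_empty)
      qed
      ultimately have eq: "K \<union> {e K} = K \<union> range \<phi>" using left \<phi>(2) by auto
      have "openin T (K \<union> {e K})"
        unfolding eq by (intro openin_Un KD(1)[OF K] im(1)) simp
      moreover have "C \<inter> T closure_of (K \<union> {e K}) \<subseteq> K \<union> {e K}"
      proof -
        have "T closure_of {e K} \<subseteq> {e K}"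
          using haus eC(1)[OF K] CT by (intro closure_of_minimal closedin_Hausdorff_singleton) auto
        then show ?thesis
          using closure_K[OF K] unfolding closure_of_Un Int_Un_distrib by auto
      qed
      moreover have "sm (K \<union> {e K})"
        using small_idealD(4)[OF sm KD(4)[OF K] points_small[OF eC(1)[OF K]]] .
      ultimately show False using not_clopen[of "K \<union> {e K}"] KD(2)[OF K] eC(1)[OF K] by auto
    qed
    define K' where "K' = K \<union> \<phi> ` {..<1}"
    have K'_alt: "K' = K \<union> \<phi> ` {0..<1}"
    proof -
      have "{..<1::real} = {..<0} \<union> {0..<1}" by auto
      then show ?thesis unfolding K'_def using left by (auto simp: image_Un)
    qed
    have K'C: "K' \<subseteq> C" unfolding K'_def using KD(2)[OF K] \<phi>(3) by auto
    have cl: "T closure_of (\<phi> ` {0..<1}) \<subseteq> \<phi> ` {0..1}"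
      using im(3)[of "{0..1}"] compactin_imp_closedin[OF haus]
      by (intro closure_of_minimal) auto
    have "ends K' = {\<phi> 1}"
    proof
      have "C \<inter> T closure_of K' \<subseteq> insert (e K) K \<union> \<phi> ` {0..1}"
        using closure_K[OF K] cl unfolding K'_alt by (auto simp: closure_of_Un)
      also have "\<dots> \<subseteq> insert (\<phi> 1) K'"
      proof -
        have "{0..1::real} \<subseteq> insert 1 {0..<1}" by auto
        then have "\<phi> ` {0..1} \<subseteq> insert (\<phi> 1) (\<phi> ` {0..<1})" by auto
        moreover have "e K \<in> \<phi> ` {0..<1}" using \<phi>(2) by (intro image_eqI[of _ _ 0]) auto
        ultimately show ?thesis unfolding K'_alt by auto
      qed
      finally show "ends K' \<subseteq> {\<phi> 1}" unfolding ends_def by blast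
      have "\<phi> 1 \<in> T closure_of K'"
      proof -
        have "continuous_map euclideanreal T \<phi>" using \<phi>(1) unfolding arc_chart_def by blast
        then have "\<phi> ` (euclideanreal closure_of {0<..<1}) \<subseteq> T closure_of (\<phi> ` {0<..<1})"
          using continuous_map_image_closure_subset by blast
        then have "\<phi> 1 \<in> T closure_of (\<phi> ` {0<..<1})" by auto
        moreover have "\<phi> ` {0<..<1} \<subseteq> K'" unfolding K'_def by auto
        ultimately show ?thesis using closure_of_mono by blast
      qed
      moreover have "\<phi> 1 \<notin> K'"
      proof -
        have "\<phi> 1 \<in> \<phi> ` {0<..}" by (rule imageI) simp
        then have "\<phi> 1 \<notin> K" using right by (metis disjoint_iff)
        then show ?thesis using inj unfolding K'_def by auto
      qed
      ultimately show "{\<phi> 1} \<subseteq> ends K'" using \<phi>(3) unfolding ends_def by auto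
    qed
    moreover have "openin T K'" unfolding K'_def using KD(1)[OF K] im(1)[of "{..<1}"] by auto
    moreover have "connectedin T K'"
    proof -
      have "\<phi> ` {..<0} \<subseteq> \<phi> ` {..<1}" by auto
      then have "K \<inter> \<phi> ` {..<1} \<noteq> {}" using \<phi>(4) by blast
      then show ?thesis
        unfolding K'_def using KD(3)[OF K] im(2)[of "{..<1}"] by (intro connectedin_Un) auto
    qed
    moreover have "sm K'"
    proof -
      have "sm (K \<union> \<phi> ` {0..1})"
        by (intro small_idealD(4)[OF sm] KD(4)[OF K] small_idealD(3)[OF sm] im(3)) simp
      moreover have "K' \<subseteq> K \<union> \<phi> ` {0..1}" unfolding K'_alt by auto
      ultimately show ?thesis by (rule small_idealD(1)[OF sm])
    qed
    moreover have "J \<subseteq> K'" using KD(5)[OF K] unfolding K'_def by blast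
    ultimately have "K' \<in> \<K>" using KI[of K'] K'C by blast
    moreover have "e K \<in> K'" unfolding K'_def using \<phi>(2) by (intro UnI2 image_eqI[of _ _ 0]) auto
    then have "K \<subset> K'" using eC(2)[OF K] unfolding K'_def by blast
    ultimately show ?thesis by blast
  qed
  have distinct: "e K \<noteq> e K'" if K: "K \<in> \<K>" and K': "K' \<in> \<K>" and "K \<subset> K'" for K K'
  proof -
    have "e K \<in> K'"
      using that(3) KD(5)[OF K] J_ne by (intro meets[OF K KD(3)[OF K'] KD(2)[OF K']]) auto
    then show ?thesis using eC(2)[OF K'] by auto
  qed
  have sup: "\<exists>K\<in>\<K>. (\<forall>n. k n \<subseteq> K) \<and> limitin T (\<lambda>n. e (k n)) (e K) sequentially"
    if k: "\<forall>n::nat. k n \<in> \<K> \<and> k n \<subset> k (Suc n)" for k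
  proof -
    define K where "K = (\<Union>n. k n)"
    have kK: "k n \<in> \<K>" for n using k by blast
    have step: "k n \<subseteq> k (Suc n)" for n using k by (metis psubset_imp_subset)
    have mono: "k m \<subseteq> k n" if "m \<le> n" for m n
      by (rule lift_Suc_mono_le[of k, OF step that])
    have oK: "openin T K" unfolding K_def using KD(1)[OF kK] by (intro openin_Union) auto
    have KC: "K \<subseteq> C" unfolding K_def using KD(2)[OF kK] by blast
    have JK: "J \<subseteq> K" unfolding K_def using KD(5)[OF kK] by blast
    have smK: "sm K" unfolding K_def using KD(4)[OF kK] by (intro small_idealD(2)[OF sm])
    have cK: "connectedin T K"
      unfolding K_def
    proof (rule connectedin_Union)
      show "\<And>S. S \<in> range k \<Longrightarrow> connectedin T S" using KD(3)[OF kK] by blast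
      have "J \<subseteq> \<Inter>(range k)" using KD(5)[OF kK] by blast
      then show "\<Inter>(range k) \<noteq> {}" using J_ne by blast
    qed
    have lim: "limitin T (\<lambda>n. e (k n)) c sequentially" if c: "c \<in> ends K" for c
      unfolding limitin_def
    proof (intro conjI allI impI)
      show "c \<in> topspace T" using c CT unfolding ends_def by blast
      fix W assume W: "openin T W \<and> c \<in> W"
      have "openin T (W \<inter> C)" "c \<in> W \<inter> C" using W C(1) c unfolding ends_def by auto
      then obtain \<phi> where \<phi>: "arc_chart T \<phi>" "\<phi> 0 = c" "range \<phi> \<subseteq> W \<inter> C"
        by (rule one_manifold_arc[OF T])
      have cr: "c \<in> range \<phi>" using \<phi>(2) by (metis rangeI)
      have "openin T (range \<phi>)" "connectedin T (range \<phi>)"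
        using arc_chart_image(1,2)[OF \<phi>(1), of UNIV] by simp_all
      have "c \<in> T closure_of K" using c unfolding ends_def by simp
      then obtain y where "y \<in> K" "y \<in> range \<phi>"
        using \<open>openin T (range \<phi>)\<close> cr by (rule closure_of_meets)
      then obtain m where m: "range \<phi> \<inter> k m \<noteq> {}" unfolding K_def by auto
      have "e (k n) \<in> W" if "n \<ge> m" for n
      proof -
        have "c \<notin> k n" using c unfolding ends_def K_def by blast
        then have "e (k n) \<in> range \<phi>"
          using m mono[OF that] cr \<phi>(3) by (intro meets[OF kK \<open>connectedin T (range \<phi>)\<close>]) auto
        then show ?thesis using \<phi>(3) by blast
      qed
      then show "\<forall>\<^sub>F n in sequentially. e (k n) \<in> W"
        unfolding eventually_sequentially by blast
    qed
    have "ends K \<noteq> {}"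
      using not_clopen[OF oK KC _ smK] JK J_ne unfolding ends_def by blast
    then obtain c where c: "c \<in> ends K" by blast
    have "ends K = {c}"
    proof
      show "ends K \<subseteq> {c}"
      proof
        fix c' assume c': "c' \<in> ends K"
        have "c' = c"
          using limitin_Hausdorff_unique[OF lim[OF c'] lim[OF c]] haus by simp
        then show "c' \<in> {c}" by simp
      qed
    qed (use c in simp)
    then have "K \<in> \<K>" "e K = c" using KI[OF oK KC cK smK JK] by auto
    then show ?thesis
      using lim[OF c] unfolding K_def by (intro bexI[of _ K]) (auto simp: K_def)
  qed
  have "long_line T \<K> e"
    unfolding long_line_def
    using J chain enlarge distinct sup eC(1) CT by (intro conjI ballI allI impI) auto
  then show thesis by (rule that)
qed

section \<open>Maps and homotopies along a long line\<close>

lemma long_lineD: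
  assumes "long_line T \<K> e"
  shows "\<K> \<noteq> {}" "\<And>K K'. K \<in> \<K> \<Longrightarrow> K' \<in> \<K> \<Longrightarrow> K \<subseteq> K' \<or> K' \<subseteq> K" "\<And>K. K \<in> \<K> \<Longrightarrow> \<exists>K'\<in>\<K>. K \<subset> K'"
    "\<And>K. K \<in> \<K> \<Longrightarrow> e K \<in> topspace T" "\<And>K K'. K \<in> \<K> \<Longrightarrow> K' \<in> \<K> \<Longrightarrow> K \<subset> K' \<Longrightarrow> e K \<noteq> e K'"
    "\<And>k. (\<And>n::nat. k n \<in> \<K>) \<Longrightarrow> (\<And>n. k n \<subset> k (Suc n)) \<Longrightarrow>
        \<exists>K\<in>\<K>. (\<forall>n. k n \<subseteq> K) \<and> limitin T (\<lambda>n. e (k n)) (e K) sequentially"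
  using assms unfolding long_line_def by simp_all

text \<open>
  Unbounded conditions can be interlaced: given a sequence of properties each of which holds
  arbitrarily far out, there are segments satisfying them in turn whose endpoints converge. With two
  alternating closed conditions this says that closed unbounded sets intersect.
\<close>
lemma long_line_interlace:
  assumes L: "long_line T \<K> e" and V: "V \<in> \<K>"
    and P: "\<And>n V. V \<in> \<K> \<Longrightarrow> \<exists>K\<in>\<K>. V \<subset> K \<and> P n K"
  obtains k K where "\<And>n::nat. k n \<in> \<K>" "\<And>n. P n (k n)" "K \<in> \<K>" "V \<subset> K" "\<And>n. k n \<subseteq> K"
    "limitin T (\<lambda>n. e (k n)) (e K) sequentially"
proof -
  have "\<exists>k. \<forall>n. (k n \<in> \<K> \<and> V \<subset> k n \<and> P n (k n)) \<and> k n \<subset> k (Suc n)"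
  proof (rule dependent_nat_choice)
    show "\<exists>K. K \<in> \<K> \<and> V \<subset> K \<and> P 0 K" using P[OF V] by metis
    fix K n assume K: "K \<in> \<K> \<and> V \<subset> K \<and> P n K"
    then obtain K' where "K' \<in> \<K>" "K \<subset> K'" "P (Suc n) K'" using P by metis
    then show "\<exists>K'. (K' \<in> \<K> \<and> V \<subset> K' \<and> P (Suc n) K') \<and> K \<subset> K'"
      using K by (intro exI[of _ K']) (metis psubset_trans)
  qed
  then obtain k where k: "\<And>n. k n \<in> \<K>" "\<And>n. V \<subset> k n" "\<And>n. P n (k n)" "\<And>n. k n \<subset> k (Suc n)"
    by metis
  obtain K where K: "K \<in> \<K>" "\<forall>n. k n \<subseteq> K" "limitin T (\<lambda>n. e (k n)) (e K) sequentially"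
    using long_lineD(6)[OF L, of k, OF k(1,4)] by metis
  have "V \<subset> K" using k(2)[of 0] K(2) by (metis psubset_subset_trans)
  then show thesis using that[OF k(1,3) K(1)] K(2,3) by simp
qed

lemma long_line_bound:
  assumes L: "long_line T \<K> e" and V: "\<And>n::nat. V n \<in> \<K>"
  obtains K where "K \<in> \<K>" "\<And>n. V n \<subseteq> K"
proof -
  have "\<exists>K\<in>\<K>. V' \<subset> K \<and> V n \<subseteq> K" if V': "V' \<in> \<K>" for n V'
  proof (cases "V n \<subseteq> V'")
    case True
    then show ?thesis using long_lineD(3)[OF L V'] by (metis order_trans psubset_imp_subset)
  next
    case False
    then have "V' \<subseteq> V n" using long_lineD(2)[OF L V' V] by metis
    obtain K where "K \<in> \<K>" "V n \<subset> K" using long_lineD(3)[OF L V] by metis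
    then show ?thesis using \<open>V' \<subseteq> V n\<close> by (metis psubset_imp_subset subset_psubset_trans)
  qed
  then obtain k K where "\<And>n. V n \<subseteq> k n" "K \<in> \<K>" "\<And>n. k n \<subseteq> K"
    using long_line_interlace[OF L V[of 0], of "\<lambda>n K. V n \<subseteq> K"] by metis
  then show thesis using that by (metis order_trans)
qed

lemma long_line_bound_countable:
  assumes L: "long_line T \<K> e" and I: "countable I" and V: "\<And>i. i \<in> I \<Longrightarrow> V i \<in> \<K>"
  obtains K where "K \<in> \<K>" "\<And>i. i \<in> I \<Longrightarrow> V i \<subseteq> K"
proof (cases "I = {}")
  case True
  then show ?thesis using that long_lineD(1)[OF L] by auto
next
  case False
  have "V (from_nat_into I n) \<in> \<K>" for n
    using V from_nat_into[OF False] by simp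
  then obtain K where K: "K \<in> \<K>" "\<And>n. V (from_nat_into I n) \<subseteq> K"
    using long_line_bound[OF L, of "\<lambda>n. V (from_nat_into I n)"] by metis
  have "V i \<subseteq> K" if i: "i \<in> I" for i
    using K(2) from_nat_into_surj[OF I i] by metis
  then show ?thesis using K(1) that by metis
qed

definition eventually_constant :: "'a set set \<Rightarrow> ('a set \<Rightarrow> 'b) \<Rightarrow> bool" where
  "eventually_constant \<K> f \<longleftrightarrow> (\<exists>V\<in>\<K>. \<exists>c. \<forall>K\<in>\<K>. V \<subset> K \<longrightarrow> f K = c)"

lemma eventually_constantI: "V \<in> \<K> \<Longrightarrow> (\<And>K. K \<in> \<K> \<Longrightarrow> V \<subset> K \<Longrightarrow> f K = c) \<Longrightarrow> eventually_constant \<K> f"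
  unfolding eventually_constant_def by metis

lemma separate_points_regular:
  assumes "Hausdorff_space S" "regular_space S" "a \<in> topspace S" "b \<in> topspace S" "a \<noteq> b"
  obtains N1 N2 C where "openin S N1" "openin S N2" "a \<in> N1" "b \<in> N2" "closedin S C" "N1 \<subseteq> C" "C \<inter> S closure_of N2 = {}"
proof -
  obtain P Q where PQ: "openin S P" "openin S Q" "a \<in> P" "b \<in> Q" "disjnt P Q"
    using assms(1,3,4,5) unfolding Hausdorff_space_def by metis
  have "neighbourhood_base_of (closedin S) S"
    using assms(2) by (simp add: neighbourhood_base_of_closedin)
  then obtain N C where N: "openin S N" "closedin S C" "a \<in> N" "N \<subseteq> C" "C \<subseteq> P"
    using PQ(1,3) unfolding neighbourhood_base_of by metis
  have "P \<inter> S closure_of Q = {}"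
    using PQ by (simp add: openin_Int_closure_of_eq_empty disjnt_def)
  then have "C \<inter> S closure_of Q = {}" using N(5) by blast
  then show thesis using that[OF N(1) PQ(2) N(3) PQ(4) N(2,4)] by simp
qed

text \<open>
  Beyond some segment \<open>B\<close> every basic open set that is still visited is visited arbitrarily far out,
  since the basis is countable. If two different values occurred beyond \<open>B\<close>, then neighbourhoods of them
  with disjoint closures would be visited alternately, and the limit of such a sequence would
  be mapped to both closures.
\<close>
lemma long_line_eventually_constant:
  assumes L: "long_line T \<K> e" and \<phi>: "continuous_map T S \<phi>"
    and S: "Hausdorff_space S" "regular_space S"
    and W: "openin S W" "second_countable (subtopology S W)"
    and V: "V \<in> \<K>" "\<And>K. K \<in> \<K> \<Longrightarrow> V \<subset> K \<Longrightarrow> \<phi> (e K) \<in> W"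
  shows "eventually_constant \<K> (\<lambda>K. \<phi> (e K))"
proof -
  obtain \<N> where \<N>: "countable \<N>" "\<forall>N\<in>\<N>. openin (subtopology S W) N"
    "\<forall>W' x. openin (subtopology S W) W' \<and> x \<in> W' \<longrightarrow> (\<exists>N\<in>\<N>. x \<in> N \<and> N \<subseteq> W')"
    using W(2) unfolding second_countable_def by (elim exE conjE)
  \<comment> \<open>\<open>rare N V\<close> means that \<open>N\<close> is not visited beyond \<open>V\<close>\<close>
  define rare where "rare N V' \<longleftrightarrow> V' \<in> \<K> \<and> (\<forall>K\<in>\<K>. V' \<subset> K \<longrightarrow> \<phi> (e K) \<notin> N)" for N V'
  define \<R> where "\<R> = {N\<in>\<N>. \<exists>V'. rare N V'}"
  define v where "v N = (SOME V'. rare N V')" for N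
  have v: "rare N (v N)" if "N \<in> \<R>" for N
    using that someI_ex[of "rare N"] unfolding \<R>_def v_def by simp
  have "countable \<R>" using \<N>(1) unfolding \<R>_def by simp
  moreover have "v N \<in> \<K>" if "N \<in> \<R>" for N using v[OF that] unfolding rare_def by simp
  ultimately obtain B0 where B0: "B0 \<in> \<K>" "\<And>N. N \<in> \<R> \<Longrightarrow> v N \<subseteq> B0"
    using long_line_bound_countable[OF L, of \<R> v] by metis
  obtain B where B: "B \<in> \<K>" "B0 \<subseteq> B" "V \<subseteq> B"
    using long_lineD(2)[OF L B0(1) V(1)] B0(1) V(1) by (metis order_refl)
  have often: "\<exists>K\<in>\<K>. V' \<subset> K \<and> \<phi> (e K) \<in> N" if N: "N \<in> \<N>" and K: "K \<in> \<K>" "B \<subset> K" "\<phi> (e K) \<in> N" and V': "V' \<in> \<K>" for N K V'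
  proof (rule ccontr)
    assume "\<not> ?thesis"
    then have "rare N V'" using V' unfolding rare_def by metis
    then have NR: "N \<in> \<R>" using N unfolding \<R>_def by auto
    then have "v N \<subset> K" using B0(2) B(2) K(2) by (metis order_trans subset_psubset_trans)
    then show False using v[OF NR] K unfolding rare_def by metis
  qed
  have img: "\<phi> (e K) \<in> topspace S" if "K \<in> \<K>" for K
    using continuous_map_image_subset_topspace[OF \<phi>] long_lineD(4)[OF L that] by blast
  have equal: "\<phi> (e K) = \<phi> (e K')" if K: "K \<in> \<K>" "B \<subset> K" and K': "K' \<in> \<K>" "B \<subset> K'" for K K'
  proof (rule ccontr)
    assume "\<phi> (e K) \<noteq> \<phi> (e K')"
    then obtain N1 N2 C where N: "openin S N1" "openin S N2" "\<phi> (e K) \<in> N1" "\<phi> (e K') \<in> N2"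
      "closedin S C" "N1 \<subseteq> C" "C \<inter> S closure_of N2 = {}"
      using separate_points_regular[OF S img[OF K(1)] img[OF K'(1)]] by metis
    have "V \<subset> K" "V \<subset> K'" using B(3) K(2) K'(2) by (metis subset_psubset_trans)+
    then have inW: "\<phi> (e K) \<in> W" "\<phi> (e K') \<in> W" using V(2) K(1) K'(1) by simp_all
    have "openin (subtopology S W) (N1 \<inter> W)" "openin (subtopology S W) (N2 \<inter> W)"
      using N(1,2) by (simp_all add: openin_subtopology_Int)
    then obtain M1 M2 where M: "M1 \<in> \<N>" "M2 \<in> \<N>" "\<phi> (e K) \<in> M1" "\<phi> (e K') \<in> M2" "M1 \<subseteq> N1 \<inter> W" "M2 \<subseteq> N2 \<inter> W"
      using \<N>(3) N(3,4) inW by (metis IntI)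
    have step: "\<exists>K\<in>\<K>. V' \<subset> K \<and> \<phi> (e K) \<in> (if even n then N1 else N2)" if V': "V' \<in> \<K>" for n :: nat and V'
    proof (cases "even n")
      case True
      obtain K2 where "K2 \<in> \<K>" "V' \<subset> K2" "\<phi> (e K2) \<in> M1"
        using often[OF M(1) K M(3) V'] by metis
      then show ?thesis using M(5) True by auto
    next
      case False
      obtain K2 where "K2 \<in> \<K>" "V' \<subset> K2" "\<phi> (e K2) \<in> M2"
        using often[OF M(2) K' M(4) V'] by metis
      then show ?thesis using M(6) False by auto
    qed
    obtain k Z where k: "\<And>n::nat. \<phi> (e (k n)) \<in> (if even n then N1 else N2)" "Z \<in> \<K>"
      "limitin T (\<lambda>n. e (k n)) (e Z) sequentially"
      using long_line_interlace[OF L B(1) step, of "\<lambda>n. n"] by metis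
    have lim: "limitin S (\<lambda>n. \<phi> (e (k n))) (\<phi> (e Z)) sequentially"
      using continuous_map_limit[OF \<phi> k(3)] by (simp add: o_def)
    have no: False if P: "openin S P" "\<phi> (e Z) \<in> P" and out: "\<And>n. \<exists>n'\<ge>n. \<phi> (e (k n')) \<notin> P" for P
    proof -
      obtain n0 where "\<And>n. n \<ge> n0 \<Longrightarrow> \<phi> (e (k n)) \<in> P"
        using lim P unfolding limitin_sequentially by metis
      then show False using out[of n0] by auto
    qed
    have "\<phi> (e Z) \<in> C"
    proof (rule ccontr)
      assume "\<phi> (e Z) \<notin> C"
      then have "\<phi> (e Z) \<in> topspace S - C" using img[OF k(2)] by simp
      moreover have "\<exists>n'\<ge>n. \<phi> (e (k n')) \<notin> topspace S - C" for n
        using k(1)[of "2 * n"] N(6) by (intro exI[of _ "2 * n"]) auto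
      ultimately show False using no[of "topspace S - C"] N(5) by auto
    qed
    then have "\<phi> (e Z) \<in> topspace S - S closure_of N2" using N(7) img[OF k(2)] by auto
    moreover have "\<exists>n'\<ge>n. \<phi> (e (k n')) \<notin> topspace S - S closure_of N2" for n
    proof -
      have "\<phi> (e (k (Suc (2 * n)))) \<in> N2" using k(1)[of "Suc (2 * n)"] by simp
      then have "\<phi> (e (k (Suc (2 * n)))) \<in> S closure_of N2"
        using closure_of_subset[OF openin_subset[OF N(2)]] by blast
      then show ?thesis by (intro exI[of _ "Suc (2 * n)"]) simp
    qed
    moreover have "openin S (topspace S - S closure_of N2)" by (intro openin_diff) auto
    ultimately show False using no[of "topspace S - S closure_of N2"] by metis
  qed
  obtain K1 where K1: "K1 \<in> \<K>" "B \<subset> K1" using long_lineD(3)[OF L B(1)] by metis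
  show ?thesis
    by (rule eventually_constantI[OF B(1)]) (rule equal[OF _ _ K1])
qed

text \<open>
  The set \<open>Z\<close> of times at which the homotopy is eventually constant contains 1 but not 0. It is closed,
  because countably many bounds have a common bound. It is open: if the eventual value at time \<open>t\<close> is
  \<open>c\<close> and there were bad times \<open>x n\<close> converging to \<open>t\<close>, then at these times a chart \<open>W\<close> around \<open>c\<close> would be
  left arbitrarily far out; interlacing these exits gives a limit point that is mapped out of \<open>W\<close> at
  time \<open>t\<close>, although its value is \<open>c\<close>.
\<close>
lemma long_line_no_homotopy_into_small:
  assumes L: "long_line T \<K> e"
    and S: "Hausdorff_space S" "regular_space S" "locally_second_countable S"
    and H: "continuous_map (prod_topology (top_of_set {0..1}) T) S H"
    and H0: "\<And>x. x \<in> topspace T \<Longrightarrow> H (0::real, x) = x" and H1: "\<And>x. x \<in> topspace T \<Longrightarrow> H (1, x) \<in> M"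
    and M: "openin S M" "second_countable (subtopology S M)"
  shows False
proof -
  define Z where "Z = {t \<in> {0..1}. eventually_constant \<K> (\<lambda>K. H (t, e K))}"
  have slice: "continuous_map T S (\<lambda>x. H (t, x))" if "t \<in> {0..1}" for t
  proof -
    have "continuous_map T (prod_topology (top_of_set {0..1}) T) (\<lambda>x. (t, x))"
      using that by (intro continuous_map_pairedI) auto
    from continuous_map_compose[OF this H] show ?thesis by (simp add: o_def)
  qed
  have eT: "e K \<in> topspace T" if "K \<in> \<K>" for K using long_lineD(4)[OF L that] .
  have HS: "H (t, e K) \<in> topspace S" if "t \<in> {0..1}" "K \<in> \<K>" for t K
    using continuous_map_image_subset_topspace[OF slice[OF that(1)]] eT[OF that(2)] by blast
  obtain V0 where V0: "V0 \<in> \<K>" using long_lineD(1)[OF L] by auto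
  have one: "1 \<in> Z"
  proof -
    have "eventually_constant \<K> (\<lambda>K. H (1, e K))"
      by (rule long_line_eventually_constant[OF L slice S(1,2) M V0]) (simp_all add: H1 eT)
    then show ?thesis unfolding Z_def by simp
  qed
  have zero: "0 \<notin> Z"
  proof
    assume "0 \<in> Z"
    then obtain V c where V: "V \<in> \<K>" "\<And>K. K \<in> \<K> \<Longrightarrow> V \<subset> K \<Longrightarrow> H (0, e K) = c"
      unfolding Z_def eventually_constant_def by auto
    obtain K1 where K1: "K1 \<in> \<K>" "V \<subset> K1" using long_lineD(3)[OF L V(1)] by metis
    obtain K2 where K2: "K2 \<in> \<K>" "K1 \<subset> K2" using long_lineD(3)[OF L K1(1)] by metis
    have "H (0, e K1) = H (0, e K2)"
      using V(2)[OF K1] V(2)[OF K2(1)] K1(2) K2(2) by (metis psubset_trans)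
    then have "e K1 = e K2" using H0 eT K1(1) K2(1) by simp
    then show False using long_lineD(5)[OF L K1(1) K2] by simp
  qed
  have limit: "limitin S (\<lambda>n. H (x n, y n)) (H (t, z)) sequentially"
    if "\<And>n. x n \<in> {0..1}" "x \<longlonglongrightarrow> t" "t \<in> {0..1}" "limitin T y z sequentially" for x t y z
  proof -
    have "limitin (top_of_set {0..1}) x t sequentially"
      using that(1-3) by (simp add: limitin_subtopology)
    then have "limitin (prod_topology (top_of_set {0..1}) T) (\<lambda>n. (x n, y n)) (t, z) sequentially"
      using that(4) by (simp add: limitin_pairwise o_def)
    from continuous_map_limit[OF H this] show ?thesis by (simp add: o_def)
  qed
  have "closed Z"
    unfolding closed_sequential_limits
  proof (intro allI impI)
    fix x t assume x: "(\<forall>n. x n \<in> Z) \<and> x \<longlonglongrightarrow> t"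
    have xI: "x n \<in> {0..1}" for n using x unfolding Z_def by simp
    have tI: "t \<in> {0..1}" using x xI closed_sequentially[of "{0..1::real}" x t] by simp
    have "\<forall>n. \<exists>V c. V \<in> \<K> \<and> (\<forall>K\<in>\<K>. V \<subset> K \<longrightarrow> H (x n, e K) = c)"
      using x unfolding Z_def eventually_constant_def by simp metis
    then obtain V c where V: "\<And>n. V n \<in> \<K>" "\<And>n K. K \<in> \<K> \<Longrightarrow> V n \<subset> K \<Longrightarrow> H (x n, e K) = c n"
      by metis
    obtain B where B: "B \<in> \<K>" "\<And>n. V n \<subseteq> B" using long_line_bound[OF L, of V] V(1) by metis
    have lim: "limitin S c (H (t, e K)) sequentially" if K: "K \<in> \<K>" "B \<subset> K" for K
    proof -
      have "H (x n, e K) = c n" for n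
        using V(2)[OF K(1)] B(2)[of n] K(2) by (metis subset_psubset_trans)
      moreover have "limitin T (\<lambda>n. e K) (e K) sequentially"
        using eT[OF K(1)] by (simp add: limitin_const)
      ultimately show ?thesis using limit[OF xI conjunct2[OF x] tI, of "\<lambda>n. e K" "e K"] by simp
    qed
    obtain K1 where K1: "K1 \<in> \<K>" "B \<subset> K1" using long_lineD(3)[OF L B(1)] by metis
    have "eventually_constant \<K> (\<lambda>K. H (t, e K))"
    proof (rule eventually_constantI[OF B(1)])
      fix K assume K: "K \<in> \<K>" "B \<subset> K"
      show "H (t, e K) = H (t, e K1)"
        using limitin_Hausdorff_unique[OF lim[OF K] lim[OF K1]] S(1) by simp
    qed
    then show "t \<in> Z" using tI unfolding Z_def by simp
  qed
  moreover have "openin (top_of_set {0..1}) Z"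
    unfolding openin_euclidean_subtopology_iff
  proof (intro conjI ballI)
    show "Z \<subseteq> {0..1}" unfolding Z_def by blast
    fix t assume t: "t \<in> Z"
    then have tI: "t \<in> {0..1}" unfolding Z_def by blast
    obtain V c where V: "V \<in> \<K>" "\<And>K. K \<in> \<K> \<Longrightarrow> V \<subset> K \<Longrightarrow> H (t, e K) = c"
      using t unfolding Z_def eventually_constant_def by auto
    obtain K1 where K1: "K1 \<in> \<K>" "V \<subset> K1" using long_lineD(3)[OF L V(1)] by metis
    have "c \<in> topspace S" using V(2)[OF K1] HS[OF tI K1(1)] by simp
    then obtain W where W: "openin S W" "c \<in> W" "second_countable (subtopology S W)"
      using S(3) unfolding locally_second_countable_def by metis
    show "\<exists>\<epsilon>>0. \<forall>t'\<in>{0..1}. dist t' t < \<epsilon> \<longrightarrow> t' \<in> Z"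
    proof (rule ccontr)
      assume neg: "\<not> ?thesis"
      have "\<forall>n::nat. \<exists>t'. t' \<in> {0..1} \<and> dist t' t < 1 / (real n + 1) \<and> t' \<notin> Z"
      proof
        fix n :: nat
        have "1 / (real n + 1) > 0" by simp
        then show "\<exists>t'. t' \<in> {0..1} \<and> dist t' t < 1 / (real n + 1) \<and> t' \<notin> Z" using neg by metis
      qed
      then obtain x where x: "\<And>n. x n \<in> {0..1}" "\<And>n. dist (x n) t < 1 / (real n + 1)" "\<And>n. x n \<notin> Z"
        by metis
      have "x \<longlonglongrightarrow> t"
      proof (rule metric_LIMSEQ_I)
        fix r :: real assume "0 < r"
        then obtain N where N: "1 / real (Suc N) < r" using nat_approx_posE by metis
        have "dist (x n) t < r" if "n \<ge> N" for n
        proof -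
          have "1 / (real n + 1) \<le> 1 / real (Suc N)" using that by (simp add: frac_le)
          then show ?thesis using x(2)[of n] N by linarith
        qed
        then show "\<exists>N. \<forall>n\<ge>N. dist (x n) t < r" by metis
      qed
      have "\<exists>K\<in>\<K>. V' \<subset> K \<and> H (x n, e K) \<notin> W" if V': "V' \<in> \<K>" for n V'
      proof (rule ccontr)
        assume "\<not> ?thesis"
        then have "eventually_constant \<K> (\<lambda>K. H (x n, e K))"
          using long_line_eventually_constant[OF L slice[OF x(1)] S(1,2) W(1,3) V'] by metis
        then show False using x(1,3) unfolding Z_def by simp
      qed
      then obtain k K where k: "\<And>n::nat. H (x n, e (k n)) \<notin> W" "K \<in> \<K>" "V \<subset> K"
        "limitin T (\<lambda>n. e (k n)) (e K) sequentially"
        using long_line_interlace[OF L V(1), of "\<lambda>n K. H (x n, e K) \<notin> W"] by metis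
      have "limitin S (\<lambda>n. H (x n, e (k n))) (H (t, e K)) sequentially"
        by (rule limit[OF x(1) \<open>x \<longlonglongrightarrow> t\<close> tI k(4)])
      moreover have "H (t, e K) \<in> W" using V(2)[OF k(2,3)] W(2) by simp
      ultimately obtain N where "\<And>n. n \<ge> N \<Longrightarrow> H (x n, e (k n)) \<in> W"
        using W(1) unfolding limitin_sequentially by metis
      then show False using k(1) by auto
    qed
  qed
  moreover have "closedin (top_of_set {0..1}) Z"
    using \<open>closed Z\<close> by (intro closed_subset) (auto simp: Z_def)
  moreover have "connected {0..1::real}" by simp
  ultimately have "Z = {} \<or> Z = {0..1}"
    unfolding connected_clopen by simp
  then show False using one zero by auto
qed

section \<open>Bordered subsurfaces of a surface\<close>

definition half_plane :: "(real \<times> real) set" where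
  "half_plane = {p. 0 \<le> snd p}"

lemma homeomorphic_map_Euclidean_plane:
  "homeomorphic_maps (Euclidean_space 2) (euclidean :: (real \<times> real) topology)
     (\<lambda>v. (v 0, v 1)) (\<lambda>p i. if i < 2 then (if i = 0 then fst p else snd p) else 0)"
proof -
  have "continuous_map euclidean (Euclidean_space 2) (\<lambda>p :: real \<times> real. \<lambda>i. if i < 2 then (if i = 0 then fst p else snd p) else 0)"
    unfolding continuous_map_componentwise_Euclidean_space
  proof (intro allI impI)
    fix i :: nat
    show "continuous_map euclidean euclideanreal (\<lambda>p :: real \<times> real. if i = 0 then fst p else snd p)"
      by (cases "i = 0") (auto intro!: continuous_intros)
  qed
  moreover have "continuous_map (Euclidean_space 2) euclidean (\<lambda>v. (v 0, v 1))"
    unfolding continuous_map_Euclidean_space_iff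
    by (intro continuous_intros continuous_on_product_coordinates continuous_on_subset[OF continuous_on_product_coordinates]) auto
  moreover have "(\<lambda>i. if i < 2 then (if i = 0 then fst (v 0, v 1) else snd (v 0, v 1)) else 0) = v"
    if "v \<in> topspace (Euclidean_space 2)" for v :: "nat \<Rightarrow> real"
  proof
    fix i :: nat
    show "(if i < 2 then (if i = 0 then fst (v 0, v 1) else snd (v 0, v 1)) else 0) = v i"
      using that by (cases "i < 2"; cases "i = 0"; cases "i = 1") (auto simp: topspace_Euclidean_space)
  qed
  ultimately show ?thesis
    unfolding homeomorphic_maps_def by simp
qed

lemma homeomorphic_maps_half_plane:
  "homeomorphic_maps (half_space 2) (top_of_set half_plane)
     (\<lambda>q. (fst q 0, snd q)) (\<lambda>p. (\<lambda>i. if i < 1 then fst p else 0, snd p))"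
proof -
  have 1: "continuous_map (top_of_set half_plane) (Euclidean_space 1) (\<lambda>p i. if i < 1 then fst p else 0)"
    unfolding continuous_map_componentwise_Euclidean_space
    by (auto intro!: continuous_intros)
  have 2: "continuous_map (top_of_set half_plane) (top_of_set {0..}) snd"
    unfolding continuous_map_in_subtopology half_plane_def by (auto intro!: continuous_intros)
  have half2: "half_space 2 = prod_topology (Euclidean_space 1) (top_of_set {0..})"
    by (simp add: half_space_def)
  have 3: "continuous_map (half_space 2) (top_of_set {0..}) snd"
    unfolding half2 by (rule continuous_map_snd)
  have "continuous_map (Euclidean_space 1) euclideanreal (\<lambda>v. v 0)"
    unfolding continuous_map_Euclidean_space_iff
    by (intro continuous_on_subset[OF continuous_on_product_coordinates]) auto
  then have "continuous_map (half_space 2) euclideanreal ((\<lambda>v. v 0) \<circ> fst)"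
    unfolding half2 by (rule continuous_map_compose[OF continuous_map_fst])
  then have 4: "continuous_map (half_space 2) euclideanreal (\<lambda>q. fst q 0)"
    by (simp add: o_def)
  have 5: "continuous_map (half_space 2) euclideanreal snd"
    using 3 by (simp add: continuous_map_in_subtopology)
  have "continuous_map (half_space 2) (prod_topology euclideanreal euclideanreal) (\<lambda>q. (fst q 0, snd q))"
    using 4 5 by (rule continuous_map_pairedI)
  moreover have "snd q \<ge> 0" if "q \<in> topspace (half_space 2)" for q
    using that by (auto simp: half2)
  ultimately have 6: "continuous_map (half_space 2) (top_of_set half_plane) (\<lambda>q. (fst q 0, snd q))"
    unfolding continuous_map_in_subtopology half_plane_def by auto
  have 7: "continuous_map (top_of_set half_plane) (half_space 2) (\<lambda>p. (\<lambda>i. if i < 1 then fst p else 0, snd p))"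
    using 1 2 unfolding half2 by (simp add: continuous_map_pairwise o_def)
  have 8: "(\<lambda>i. if i < 1 then fst (fst q 0, snd q) else 0, snd (fst q 0, snd q)) = q"
    if "q \<in> topspace (half_space 2)" for q :: "(nat \<Rightarrow> real) \<times> real"
  proof (rule prod_eqI)
    have "\<forall>i\<ge>1. fst q i = 0"
      using that by (auto simp: half2 topspace_Euclidean_space)
    then show "fst (\<lambda>i. if i < 1 then fst (fst q 0, snd q) else 0, snd (fst q 0, snd q)) = fst q"
      by (intro ext) auto
  qed simp
  show ?thesis
    unfolding homeomorphic_maps_def by (intro conjI ballI 6 7 8) auto
qed

text \<open>
  The image \<open>P\<close> will be the plane or the closed half plane. Taking it inside \<open>real \<times> real\<close> makes
  interior, closure and convexity available for both cases at once.
\<close>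
definition plane_chart :: "'a topology \<Rightarrow> 'a set \<Rightarrow> (real \<times> real) set \<Rightarrow> ('a \<Rightarrow> real \<times> real) \<Rightarrow> (real \<times> real \<Rightarrow> 'a) \<Rightarrow> bool" where
  "plane_chart X W P f g \<longleftrightarrow> openin X W \<and> homeomorphic_maps (subtopology X W) (top_of_set P) f g"

lemma plane_chartD:
  assumes "plane_chart X W P f g"
  shows "openin X W" "W \<subseteq> topspace X" "\<And>w. w \<in> W \<Longrightarrow> f w \<in> P" "\<And>w. w \<in> W \<Longrightarrow> g (f w) = w"
    "\<And>p. p \<in> P \<Longrightarrow> g p \<in> W" "\<And>p. p \<in> P \<Longrightarrow> f (g p) = p"
    "continuous_map (subtopology X W) euclidean f" "continuous_map (top_of_set P) (subtopology X W) g"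
    "continuous_map (top_of_set P) X g"
proof -
  show W: "openin X W" using assms by (simp add: plane_chart_def)
  show WX: "W \<subseteq> topspace X" using W by (rule openin_subset)
  have tW: "topspace (subtopology X W) = W" using WX by auto
  have h: "continuous_map (subtopology X W) (top_of_set P) f" "continuous_map (top_of_set P) (subtopology X W) g"
    "\<forall>x\<in>topspace (subtopology X W). g (f x) = x" "\<forall>y\<in>topspace (top_of_set P). f (g y) = y"
    using assms unfolding plane_chart_def homeomorphic_maps_def by blast+
  show "continuous_map (subtopology X W) euclidean f"
    using h(1) by (simp add: continuous_map_in_subtopology)
  show "continuous_map (top_of_set P) (subtopology X W) g" by fact
  show "continuous_map (top_of_set P) X g"
    using h(2) by (simp add: continuous_map_in_subtopology)
  show "f w \<in> P" if "w \<in> W" for w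
    using continuous_map_image_subset_topspace[OF h(1)] that tW by auto
  show "g (f w) = w" if "w \<in> W" for w using h(3) that tW by auto
  show "g p \<in> W" if "p \<in> P" for p
    using continuous_map_image_subset_topspace[OF h(2)] that tW by auto
  show "f (g p) = p" if "p \<in> P" for p using h(4) that by auto
qed

lemma plane_chart_preimage_open:
  assumes "plane_chart X W P f g" "open Q"
  shows "openin X {w \<in> W. f w \<in> Q}"
proof -
  have "openin (subtopology X W) {w \<in> topspace (subtopology X W). f w \<in> Q}"
    using plane_chartD(7)[OF assms(1)] assms(2) by (intro openin_continuous_map_preimage) auto
  moreover have "topspace (subtopology X W) = W"
    using plane_chartD(2)[OF assms(1)] by auto
  ultimately have "openin (subtopology X W) {w \<in> W. f w \<in> Q}"
    by (simp only:)
  then show ?thesis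
    using openin_open_subtopology[OF plane_chartD(1)[OF assms(1)]] by blast
qed

lemma surface_chart:
  assumes "surface S" "x \<in> topspace S"
  obtains W f g where "x \<in> W" "plane_chart S W UNIV f g"
proof -
  obtain W where W: "openin S W" "x \<in> W" "subtopology S W homeomorphic_space Euclidean_space 2"
    using assms unfolding manifold_def by blast
  obtain f g where "homeomorphic_maps (subtopology S W) (Euclidean_space 2) f g"
    using W(3) unfolding homeomorphic_space_def by blast
  from homeomorphic_maps_compose[OF conjI, OF this homeomorphic_map_Euclidean_plane]
  show thesis using W that unfolding plane_chart_def by auto
qed

lemma second_countable_euclidean:
  "second_countable (euclidean :: 'a :: second_countable_topology topology)"
proof -
  obtain \<B> :: "'a set set" where "countable \<B>" "topological_basis \<B>"
    using ex_countable_basis by blast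
  then show ?thesis
    unfolding second_countable_def
    by (metis open_openin topological_basisE topological_basis_open)
qed

lemma surface_locally_second_countable:
  assumes "surface S"
  shows "locally_second_countable S"
  unfolding locally_second_countable_def
proof
  fix x assume "x \<in> topspace S"
  then obtain W f g where W: "x \<in> W" "plane_chart S W UNIV f g"
    by (rule surface_chart[OF assms])
  then have "subtopology S W homeomorphic_space (euclidean :: (real \<times> real) topology)"
    unfolding plane_chart_def homeomorphic_space_def by (metis subtopology_UNIV)
  then have "second_countable (subtopology S W)"
    using homeomorphic_space_second_countability second_countable_euclidean by blast
  then show "\<exists>W. openin S W \<and> x \<in> W \<and> second_countable (subtopology S W)"
    using W(1) plane_chartD(1)[OF W(2)] by (intro exI[of _ W]) simp
qed

text \<open>
  Brouwer's invariance of domain, transported by charts of the surface.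
\<close>
lemma surface_invariance_of_domain:
  fixes \<psi> :: "real \<times> real \<Rightarrow> 'a"
  assumes "surface S" "open D" and \<psi>: "continuous_map (top_of_set D) S \<psi>" "inj_on \<psi> D"
  shows "openin S (\<psi> ` D)"
proof (subst openin_subopen, intro ballI)
  fix y assume "y \<in> \<psi> ` D"
  then obtain z where z: "z \<in> D" "y = \<psi> z" by auto
  have "y \<in> topspace S"
    using continuous_map_image_subset_topspace[OF \<psi>(1)] z by auto
  then obtain W f g where W: "y \<in> W" "plane_chart S W UNIV f g"
    by (rule surface_chart[OF assms(1)])
  note c = plane_chartD[OF W(2)]
  define D' where "D' = {w \<in> D. \<psi> w \<in> W}"
  have "openin (top_of_set D) {w \<in> topspace (top_of_set D). \<psi> w \<in> W}"
    using \<psi>(1) c(1) by (rule openin_continuous_map_preimage)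
  then have D': "open D'"
    using assms(2) by (simp add: D'_def openin_open_eq)
  have "continuous_map (top_of_set D') (subtopology S W) \<psi>"
    using continuous_map_from_subtopology_mono[OF \<psi>(1), of D'] by (auto simp: continuous_map_in_subtopology D'_def)
  then have "continuous_map (top_of_set D') euclidean (f \<circ> \<psi>)"
    using c(7) by (rule continuous_map_compose)
  then have "continuous_on D' (f \<circ> \<psi>)" by simp
  moreover have "inj_on (f \<circ> \<psi>) D'"
  proof (rule inj_onI)
    fix a b assume ab: "a \<in> D'" "b \<in> D'" "(f \<circ> \<psi>) a = (f \<circ> \<psi>) b"
    have m: "\<psi> a \<in> W" "\<psi> b \<in> W" "a \<in> D" "b \<in> D"
      using ab(1,2) by (simp_all add: D'_def)
    have "f (\<psi> a) = f (\<psi> b)" using ab(3) by simp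
    then have "\<psi> a = \<psi> b" using c(4)[OF m(1)] c(4)[OF m(2)] by metis
    then show "a = b" using \<psi>(2) m(3,4) by (metis inj_onD)
  qed
  ultimately have "open ((f \<circ> \<psi>) ` D')"
    using D' invariance_of_domain by blast
  then have "openin S {w \<in> W. f w \<in> (f \<circ> \<psi>) ` D'}"
    by (rule plane_chart_preimage_open[OF W(2)])
  moreover have "{w \<in> W. f w \<in> (f \<circ> \<psi>) ` D'} = \<psi> ` D'"
  proof -
    have "w = \<psi> a" if "w \<in> W" "a \<in> D'" "f w = f (\<psi> a)" for w a
    proof -
      have "\<psi> a \<in> W" using that(2) by (simp add: D'_def)
      then show ?thesis using c(4)[OF that(1)] c(4)[of "\<psi> a"] that(3) by metis
    qed
    moreover have "\<psi> a \<in> W" if "a \<in> D'" for a using that by (simp add: D'_def)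
    ultimately show ?thesis by (intro set_eqI) auto
  qed
  ultimately show "\<exists>T. openin S T \<and> y \<in> T \<and> T \<subseteq> \<psi> ` D"
    using z W(1) by (intro exI[of _ "\<psi> ` D'"]) (auto simp: D'_def)
qed

lemma bordered_chart:
  assumes "bordered_submanifold 2 S U" "x \<in> U"
  obtains W P f g where "x \<in> W" "plane_chart (subtopology S U) W P f g" "P = UNIV \<or> P = half_plane"
proof -
  have US: "topspace (subtopology S U) = U"
    using assms unfolding bordered_submanifold_def by auto
  then obtain W where W: "openin (subtopology S U) W" "x \<in> W"
    "subtopology (subtopology S U) W homeomorphic_space Euclidean_space 2 \<or>
     subtopology (subtopology S U) W homeomorphic_space half_space 2"
    using assms unfolding bordered_submanifold_def bordered_manifold_def by blast
  from W(3) show thesis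
  proof
    assume "subtopology (subtopology S U) W homeomorphic_space Euclidean_space 2"
    then obtain f g where "homeomorphic_maps (subtopology (subtopology S U) W) (Euclidean_space 2) f g"
      unfolding homeomorphic_space_def by blast
    from homeomorphic_maps_compose[OF conjI, OF this homeomorphic_map_Euclidean_plane]
    show thesis using W that[of W UNIV] unfolding plane_chart_def by auto
  next
    assume "subtopology (subtopology S U) W homeomorphic_space half_space 2"
    then obtain f g where "homeomorphic_maps (subtopology (subtopology S U) W) (half_space 2) f g"
      unfolding homeomorphic_space_def by blast
    from homeomorphic_maps_compose[OF conjI, OF this homeomorphic_maps_half_plane]
    show thesis using W that[of W half_plane] unfolding plane_chart_def by auto
  qed
qed

lemma manifold_boundary_iff_half_plane_chart:
  "x \<in> manifold_boundary 2 X \<longleftrightarrow> (\<exists>W f g. x \<in> W \<and> plane_chart X W half_plane f g \<and> snd (f x) = 0)"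
proof
  assume "x \<in> manifold_boundary 2 X"
  then obtain W f where W: "openin X W" "x \<in> W" "homeomorphic_map (subtopology X W) (half_space 2) f" "snd (f x) = 0"
    unfolding manifold_boundary_def by blast
  obtain g where "homeomorphic_maps (subtopology X W) (half_space 2) f g"
    using W(3) unfolding homeomorphic_map_maps by blast
  from homeomorphic_maps_compose[OF conjI, OF this homeomorphic_maps_half_plane]
  have "plane_chart X W half_plane ((\<lambda>q. (fst q 0, snd q)) \<circ> f) (g \<circ> (\<lambda>p. (\<lambda>i. if i < 1 then fst p else 0, snd p)))"
    using W(1) unfolding plane_chart_def by simp
  moreover have "snd (((\<lambda>q. (fst q 0, snd q)) \<circ> f) x) = 0" using W(4) by simp
  ultimately show "\<exists>W f g. x \<in> W \<and> plane_chart X W half_plane f g \<and> snd (f x) = 0"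
    using W(2) by blast
next
  assume "\<exists>W f g. x \<in> W \<and> plane_chart X W half_plane f g \<and> snd (f x) = 0"
  then obtain W f g where W: "x \<in> W" "plane_chart X W half_plane f g" "snd (f x) = 0" by blast
  have "homeomorphic_maps (top_of_set half_plane) (half_space 2)
     (\<lambda>p. (\<lambda>i. if i < 1 then fst p else 0, snd p)) (\<lambda>q. (fst q 0, snd q))"
    by (rule homeomorphic_maps_sym[THEN iffD1, OF homeomorphic_maps_half_plane])
  with W(2) have "homeomorphic_maps (subtopology X W) (half_space 2)
     ((\<lambda>p. (\<lambda>i. if i < 1 then fst p else 0, snd p)) \<circ> f) (g \<circ> (\<lambda>q. (fst q 0, snd q)))"
    unfolding plane_chart_def using homeomorphic_maps_compose by blast
  then have "homeomorphic_map (subtopology X W) (half_space 2) ((\<lambda>p. (\<lambda>i. if i < 1 then fst p else 0, snd p)) \<circ> f)"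
    using homeomorphic_maps_imp_map by blast
  moreover have "snd (((\<lambda>p. (\<lambda>i. if i < (1::nat) then fst p else 0, snd p)) \<circ> f) x) = 0"
    using W(3) by simp
  moreover have "openin X W" "x \<in> topspace X"
    using W plane_chartD(1,2)[OF W(2)] by auto
  ultimately show "x \<in> manifold_boundary 2 X"
    unfolding manifold_boundary_def using W(1)
    by (intro CollectI conjI exI[of _ W] exI[of _ "(\<lambda>p. (\<lambda>i. if i < 1 then fst p else 0, snd p)) \<circ> f"]) simp_all
qed

lemma connected_imp_path_connected_space:
  assumes "connected_space X"
    and loc: "\<And>x. x \<in> topspace X \<Longrightarrow> \<exists>W. openin X W \<and> x \<in> W \<and> path_connectedin X W"
  shows "path_connected_space X"
  unfolding path_connected_space_iff_path_component
proof (intro ballI)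
  fix x y assume x: "x \<in> topspace X" and y: "y \<in> topspace X"
  let ?P = "Collect (path_component_of X x)"
  have sub: "W \<subseteq> ?P" if "path_connectedin X W" "z \<in> W" "z \<in> ?P" for W z
  proof
    fix w assume "w \<in> W"
    then have "path_component_of X z w"
      using path_component_of_maximal[OF that(1,2)] by auto
    then show "w \<in> ?P" using that(3) path_component_of_trans by (metis mem_Collect_eq)
  qed
  have PX: "?P \<subseteq> topspace X" by (rule path_component_of_subset_topspace)
  have "openin X ?P"
  proof (subst openin_subopen, intro ballI)
    fix z assume z: "z \<in> ?P"
    then obtain W where "openin X W" "z \<in> W" "path_connectedin X W"
      using loc[of z] PX by auto
    then show "\<exists>T. openin X T \<and> z \<in> T \<and> T \<subseteq> ?P" using sub z by (intro exI[of _ W]) simp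
  qed
  moreover have "openin X (topspace X - ?P)"
  proof (subst openin_subopen, intro ballI)
    fix z assume z: "z \<in> topspace X - ?P"
    then obtain W where W: "openin X W" "z \<in> W" "path_connectedin X W"
      using loc[of z] by auto
    have "W \<inter> ?P = {}" using sub[OF W(3)] z W(2) by auto
    then show "\<exists>T. openin X T \<and> z \<in> T \<and> T \<subseteq> topspace X - ?P"
      using W openin_subset[OF W(1)] by (intro exI[of _ W]) auto
  qed
  then have "closedin X ?P" using PX by (simp add: closedin_def)
  moreover have "x \<in> ?P" using x by (simp add: path_component_of_refl)
  ultimately have "?P = topspace X"
    using assms(1) unfolding connected_space_clopen_in by auto
  then show "path_component_of X x y" using y by auto
qed

lemma interior_half_plane: "interior half_plane = {p. snd p > 0}" "closure (interior half_plane) = half_plane"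
  "convex half_plane" "convex (interior half_plane)"
proof -
  have h: "half_plane = {p. (0, 1) \<bullet> p \<ge> 0}" "{p :: real \<times> real. snd p > 0} = {p. (0, 1) \<bullet> p > 0}"
    unfolding half_plane_def by (auto simp: inner_prod_def)
  show i: "interior half_plane = {p. snd p > 0}"
    unfolding h by (rule interior_halfspace_ge) (simp add: zero_prod_def)
  show "closure (interior half_plane) = half_plane"
    unfolding i unfolding h by (rule closure_halfspace_gt) (simp add: zero_prod_def)
  show "convex half_plane" unfolding h(1) by (rule convex_halfspace_ge)
  then show "convex (interior half_plane)" by (rule convex_interior)
qed

lemma chart_domain:
  assumes "P = UNIV \<or> P = half_plane"
  shows "closure (interior P) = P" "convex P" "convex (interior P)" "closed P"
    "p \<in> P \<Longrightarrow> p \<notin> interior P \<Longrightarrow> P = half_plane \<and> snd p = 0"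
proof -
  show 1: "closure (interior P) = P" "convex P" "convex (interior P)"
    using assms interior_half_plane by auto
  show "closed P" using 1(1) closed_closure by metis
  show "p \<in> P \<Longrightarrow> p \<notin> interior P \<Longrightarrow> P = half_plane \<and> snd p = 0"
    using assms interior_half_plane(1) unfolding half_plane_def by auto
qed

text \<open>
  By invariance of domain, \<open>U - B\<close> is open in \<open>S\<close>, and in any chart of \<open>U\<close> the set \<open>B\<close> consists of the
  points whose image is not interior to the image of the chart.
\<close>
locale bordered_subsurface =
  fixes S :: "'a topology" and U B :: "'a set"
  assumes surface: "surface S" and bordered: "bordered_submanifold 2 S U"
    and B_def: "B = manifold_boundary 2 (subtopology S U)"
begin

lemma US: "U \<subseteq> topspace S" and US_eq: "topspace (subtopology S U) = U"
  using bordered unfolding bordered_submanifold_def by auto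

lemma haus: "Hausdorff_space S"
  using surface unfolding manifold_def by simp

lemma regular_surface: "regular_space S"
proof -
  have "locally_compact_space S"
    unfolding locally_compact_space_def
  proof
    fix x assume "x \<in> topspace S"
    then obtain W f g where W: "x \<in> W" "plane_chart S W UNIV f g"
      by (rule surface_chart[OF surface])
    note d = plane_chartD[OF W(2)]
    have "compactin (top_of_set UNIV) (cball (f x) 1)" by simp
    then have "compactin S (g ` cball (f x) 1)" using d(9) by (rule image_compactin)
    moreover have "openin S {w \<in> W. f w \<in> ball (f x) 1}"
      by (rule plane_chart_preimage_open[OF W(2)]) simp
    moreover have "{w \<in> W. f w \<in> ball (f x) 1} \<subseteq> g ` cball (f x) 1"
    proof
      fix w assume w: "w \<in> {w \<in> W. f w \<in> ball (f x) 1}"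
      then have "f w \<in> cball (f x) 1" by simp
      then have "g (f w) \<in> g ` cball (f x) 1" by (rule imageI)
      then show "w \<in> g ` cball (f x) 1" using d(4)[of w] w by simp
    qed
    moreover have "x \<in> {w \<in> W. f w \<in> ball (f x) 1}" using W(1) by simp
    ultimately show "\<exists>N K. openin S N \<and> compactin S K \<and> x \<in> N \<and> N \<subseteq> K"
      by (intro exI[of _ "{w \<in> W. f w \<in> ball (f x) 1}"] exI[of _ "g ` cball (f x) 1"] conjI)
  qed
  then show ?thesis using haus by (simp add: locally_compact_Hausdorff_imp_regular_space)
qed

lemma BU: "B \<subseteq> U"
  unfolding B_def manifold_boundary_def US_eq by auto

definition chart :: "'a set \<Rightarrow> (real \<times> real) set \<Rightarrow> ('a \<Rightarrow> real \<times> real) \<Rightarrow> (real \<times> real \<Rightarrow> 'a) \<Rightarrow> bool" where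
  "chart W P f g \<longleftrightarrow> plane_chart (subtopology S U) W P f g \<and> (P = UNIV \<or> P = half_plane)"

lemma chart_exists:
  assumes "x \<in> U"
  obtains W P f g where "x \<in> W" "chart W P f g"
  by (rule bordered_chart[OF bordered assms]) (rule that, assumption, simp add: chart_def)

lemma chartD:
  assumes "chart W P f g"
  shows "openin (subtopology S U) W" "W \<subseteq> U" "\<And>w. w \<in> W \<Longrightarrow> f w \<in> P" "\<And>w. w \<in> W \<Longrightarrow> g (f w) = w"
    "\<And>p. p \<in> P \<Longrightarrow> g p \<in> W" "\<And>p. p \<in> P \<Longrightarrow> f (g p) = p"
    "continuous_map (subtopology S W) euclidean f" "continuous_map (top_of_set P) S g"
    "\<And>Q. open Q \<Longrightarrow> openin (subtopology S U) {w \<in> W. f w \<in> Q}" "P = UNIV \<or> P = half_plane"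
proof -
  have c: "plane_chart (subtopology S U) W P f g" and P: "P = UNIV \<or> P = half_plane"
    using assms unfolding chart_def by simp_all
  note d = plane_chartD[OF c]
  show "openin (subtopology S U) W" by (rule d(1))
  show WU: "W \<subseteq> U" using d(2) US_eq by simp
  show "\<And>w. w \<in> W \<Longrightarrow> f w \<in> P" "\<And>w. w \<in> W \<Longrightarrow> g (f w) = w"
    "\<And>p. p \<in> P \<Longrightarrow> g p \<in> W" "\<And>p. p \<in> P \<Longrightarrow> f (g p) = p" by (fact d(3), fact d(4), fact d(5), fact d(6))
  have "subtopology (subtopology S U) W = subtopology S W"
    using WU by (simp add: subtopology_subtopology inf.absorb2)
  then show "continuous_map (subtopology S W) euclidean f" using d(7) by simp
  show "continuous_map (top_of_set P) S g"
    using d(9) by (simp add: continuous_map_in_subtopology)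
  show "\<And>Q. open Q \<Longrightarrow> openin (subtopology S U) {w \<in> W. f w \<in> Q}"
    using plane_chart_preimage_open[OF c] .
  show "P = UNIV \<or> P = half_plane" by (rule P)
qed

lemma chart_interior_open:
  assumes "chart W P f g"
  shows "openin S (g ` interior P)"
proof (rule surface_invariance_of_domain[OF surface open_interior])
  note d = chartD[OF assms]
  show "continuous_map (top_of_set (interior P)) S g"
    using d(8) interior_subset by (rule continuous_map_from_subtopology_mono)
  show "inj_on g (interior P)"
  proof (rule inj_onI)
    fix a b assume ab: "a \<in> interior P" "b \<in> interior P" "g a = g b"
    then have "a \<in> P" "b \<in> P" using interior_subset by auto
    then show "a = b" using d(6)[of a] d(6)[of b] ab(3) by metis
  qed
qed

text \<open>
  Near a boundary point the chart of \<open>U\<close> would map an open subset of the plane homeomorphically onto a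
  neighbourhood of a point of the boundary line within the half plane, which is not open in the plane.
\<close>
lemma open_subset_disjoint_boundary:
  assumes N: "openin S N" "N \<subseteq> U"
  shows "N \<inter> B = {}"
proof (rule ccontr)
  assume "N \<inter> B \<noteq> {}"
  then obtain x where x: "x \<in> N" "x \<in> B" by auto
  obtain W f g where W: "x \<in> W" "plane_chart (subtopology S U) W half_plane f g" "snd (f x) = 0"
    using x(2) unfolding B_def manifold_boundary_iff_half_plane_chart by (elim exE conjE) (rule that)
  have ch: "chart W half_plane f g" using W(2) unfolding chart_def by simp
  note d = chartD[OF ch]
  have xS: "x \<in> topspace S" using x(1) N(2) US by auto
  obtain W0 f0 g0 where W0: "x \<in> W0" "plane_chart S W0 UNIV f0 g0"
    by (rule surface_chart[OF surface xS])
  note d0 = plane_chartD[OF W0(2)]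
  \<comment> \<open>\<open>C\<close> is open in \<open>S\<close> and lies in the domains of the chart \<open>f\<close> of \<open>U\<close> and the chart \<open>f0\<close> of \<open>S\<close>\<close>
  obtain W1 where W1: "openin S W1" "W = W1 \<inter> U"
    using d(1) unfolding openin_subtopology by (elim exE conjE) (rule that)
  define C where "C = W0 \<inter> N \<inter> W1"
  have CW: "C \<subseteq> W" using N(2) unfolding C_def W1(2) by auto
  have CW0: "C \<subseteq> W0" unfolding C_def by auto
  have "openin S C" unfolding C_def using d0(1) N(1) W1(1) by (intro openin_Int)
  define D where "D = {p. g0 p \<in> C}"
  have "openin (top_of_set UNIV) {p \<in> topspace (top_of_set UNIV). g0 p \<in> C}"
    using d0(9) \<open>openin S C\<close> by (rule openin_continuous_map_preimage)
  then have "open D" unfolding D_def by simp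
  have "continuous_map (top_of_set D) S g0"
    using d0(9) by (rule continuous_map_from_subtopology_mono) simp
  then have "continuous_map (top_of_set D) (subtopology S W) g0"
    using CW unfolding continuous_map_in_subtopology D_def by auto
  from continuous_map_compose[OF this d(7)] have "continuous_on D (f \<circ> g0)" by simp
  moreover have "inj_on (f \<circ> g0) D"
  proof (rule inj_onI)
    fix a b assume ab: "a \<in> D" "b \<in> D" "(f \<circ> g0) a = (f \<circ> g0) b"
    have "g0 a \<in> W" "g0 b \<in> W" using ab(1,2) CW unfolding D_def by auto
    moreover have "f (g0 a) = f (g0 b)" using ab(3) by simp
    ultimately have "g0 a = g0 b" using d(4)[of "g0 a"] d(4)[of "g0 b"] by metis
    moreover have "f0 (g0 a) = a" "f0 (g0 b) = b" using d0(6) by simp_all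
    ultimately show "a = b" by metis
  qed
  ultimately have op: "open ((f \<circ> g0) ` D)"
    using \<open>open D\<close> invariance_of_domain by metis
  have "f0 x \<in> D" unfolding D_def using d0(4)[OF W0(1)] W0(1) x(1) W(1) W1(2) by (simp add: C_def)
  then have fx: "f x \<in> (f \<circ> g0) ` D" using d0(4)[OF W0(1)] by (auto simp: image_iff intro!: bexI[of _ "f0 x"])
  obtain \<epsilon> where \<epsilon>: "\<epsilon> > 0" "ball (f x) \<epsilon> \<subseteq> (f \<circ> g0) ` D"
    by (rule openE[OF op fx])
  have "f x = (fst (f x), 0)" using W(3) by (simp add: prod_eq_iff)
  moreover have "dist (fst (f x), 0) (fst (f x), - (\<epsilon> / 2)) = \<epsilon> / 2"
    using \<epsilon>(1) by (simp add: dist_Pair_Pair dist_real_def)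
  ultimately have "dist (f x) (fst (f x), - (\<epsilon> / 2)) = \<epsilon> / 2" by metis
  then have "(fst (f x), - (\<epsilon> / 2)) \<in> (f \<circ> g0) ` D" using \<epsilon> by (intro subsetD[OF \<epsilon>(2)]) simp
  then obtain z where z: "z \<in> D" "f (g0 z) = (fst (f x), - (\<epsilon> / 2))" by auto
  have "f (g0 z) \<in> half_plane" using d(3) CW z(1) unfolding D_def by auto
  then show False using z(2) \<epsilon>(1) unfolding half_plane_def by simp
qed

lemma boundary_in_chart:
  assumes "chart W P f g" "w \<in> W"
  shows "w \<in> B \<longleftrightarrow> f w \<notin> interior P"
proof
  note d = chartD[OF assms(1)]
  assume "w \<in> B"
  have "g ` interior P \<subseteq> U" using d(2,5) interior_subset by blast
  then have "g ` interior P \<inter> B = {}"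
    using chart_interior_open[OF assms(1)] by (intro open_subset_disjoint_boundary)
  moreover have "w \<in> g ` interior P" if "f w \<in> interior P"
    using d(4)[OF assms(2)] that by (metis imageI)
  ultimately show "f w \<notin> interior P" using \<open>w \<in> B\<close> by auto
next
  note d = chartD[OF assms(1)]
  assume "f w \<notin> interior P"
  then have "P = half_plane" "snd (f w) = 0"
    using chart_domain(5)[OF d(10) d(3)[OF assms(2)]] by simp_all
  then show "w \<in> B"
    using assms unfolding B_def manifold_boundary_iff_half_plane_chart chart_def
    by (intro exI[of _ W] exI[of _ f] exI[of _ g]) simp
qed

lemma interior_in_chart:
  assumes "chart W P f g"
  shows "W \<inter> (U - B) = g ` interior P"
proof
  note d = chartD[OF assms]
  show "W \<inter> (U - B) \<subseteq> g ` interior P"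
  proof
    fix w assume w: "w \<in> W \<inter> (U - B)"
    then have "f w \<in> interior P" using boundary_in_chart[OF assms] by auto
    then show "w \<in> g ` interior P" using d(4) w by (metis IntD1 imageI)
  qed
  show "g ` interior P \<subseteq> W \<inter> (U - B)"
  proof
    fix w assume "w \<in> g ` interior P"
    then obtain p where p: "p \<in> interior P" "w = g p" by auto
    then have "p \<in> P" using interior_subset by auto
    then show "w \<in> W \<inter> (U - B)"
      using boundary_in_chart[OF assms d(5)] d(2) d(5)[OF \<open>p \<in> P\<close>] d(6)[OF \<open>p \<in> P\<close>] p by auto
  qed
qed

lemma openin_interior: "openin S (U - B)"
proof (subst openin_subopen, intro ballI)
  fix x assume x: "x \<in> U - B"
  then have "x \<in> U" by simp
  then obtain W P f g where W: "x \<in> W" "chart W P f g" by (rule chart_exists)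
  show "\<exists>T. openin S T \<and> x \<in> T \<and> T \<subseteq> U - B"
    using chart_interior_open[OF W(2)] interior_in_chart[OF W(2)] W(1) x
    by (intro exI[of _ "g ` interior P"]) auto
qed

lemma interior_dense: "U \<subseteq> S closure_of (U - B)"
proof
  fix x assume x: "x \<in> U"
  then obtain W P f g where W: "x \<in> W" "chart W P f g" by (rule chart_exists)
  note d = chartD[OF W(2)]
  show "x \<in> S closure_of (U - B)"
    unfolding in_closure_of
  proof (intro conjI allI impI)
    show "x \<in> topspace S" using x US by auto
    fix N assume N: "x \<in> N \<and> openin S N"
    have "openin (top_of_set P) {p \<in> topspace (top_of_set P). g p \<in> N}"
      using d(8) N by (intro openin_continuous_map_preimage) auto
    then obtain Q where Q: "open Q" "{p \<in> P. g p \<in> N} = P \<inter> Q"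
      unfolding openin_open by auto
    have "f x \<in> {p \<in> P. g p \<in> N}" using d(3)[OF W(1)] d(4)[OF W(1)] N by simp
    then have "f x \<in> Q" unfolding Q(2) by simp
    moreover have "f x \<in> closure (interior P)" using d(3)[OF W(1)] chart_domain(1)[OF d(10)] by simp
    ultimately obtain p where p: "p \<in> interior P" "p \<in> Q"
      using Q(1) by (meson closure_iff_nhds_not_empty disjoint_iff order_refl)
    have "p \<in> P" using p(1) interior_subset by auto
    then have "g p \<in> N" using p(2) Q(2) by auto
    moreover have "g p \<in> U - B" using interior_in_chart[OF W(2)] p(1) by auto
    ultimately show "\<exists>y. y \<in> U - B \<and> y \<in> N" by auto
  qed
qed

lemma path_connected: "path_connected_space (subtopology S U)"
proof (rule connected_imp_path_connected_space)
  show "connected_space (subtopology S U)"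
    using bordered unfolding bordered_submanifold_def bordered_manifold_def by simp
  fix x assume "x \<in> topspace (subtopology S U)"
  then have "x \<in> U" using US_eq by simp
  then obtain W P f g where W: "x \<in> W" "chart W P f g" by (rule chart_exists)
  note d = chartD[OF W(2)]
  have "g ` P = W" using d(3,4,5) by (metis (no_types, lifting) image_eqI image_subsetI subsetI subset_antisym)
  moreover have "path_connectedin S (g ` P)"
  proof (rule path_connectedin_continuous_map_image[OF d(8)])
    show "path_connectedin (top_of_set P) P"
      using chart_domain(2)[OF d(10)] convex_imp_path_connected by auto
  qed
  ultimately have "path_connectedin (subtopology S U) W"
    using d(2) by (simp add: path_connectedin_subtopology)
  then show "\<exists>W. openin (subtopology S U) W \<and> x \<in> W \<and> path_connectedin (subtopology S U) W"
    using d(1) W(1) by (intro exI[of _ W]) simp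
qed

text \<open>
  A compact neighbourhood of \<open>x\<close> in \<open>U\<close> is closed in the Hausdorff space \<open>S\<close>. This is how the complement of
  \<open>U\<close> becomes an open side of the boundary components of \<open>U\<close>.
\<close>
lemma locally_closed:
  assumes x: "x \<in> U"
  obtains N where "openin S N" "x \<in> N" "openin S (N - U)"
proof -
  obtain W P f g where W: "x \<in> W" "chart W P f g" using x by (rule chart_exists)
  note d = chartD[OF W(2)]
  define K where "K = g ` (cball (f x) 1 \<inter> P)"
  have "compactin (top_of_set P) (cball (f x) 1 \<inter> P)"
    using compact_Int_closed[OF compact_cball chart_domain(4)[OF d(10)]] by (simp add: compactin_subtopology)
  then have "compactin S K" unfolding K_def using d(8) by (rule image_compactin)
  then have clK: "closedin S K" using haus by (rule compactin_imp_closedin[rotated])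
  have KU: "K \<subseteq> U" unfolding K_def using d(2,5) by auto
  have "openin (subtopology S U) {w \<in> W. f w \<in> ball (f x) 1}" by (rule d(9)) simp
  then obtain N where N: "openin S N" "{w \<in> W. f w \<in> ball (f x) 1} = N \<inter> U"
    unfolding openin_subtopology by (elim exE conjE) (rule that)
  have "x \<in> N \<inter> U" using W(1) unfolding N(2)[symmetric] by simp
  moreover have "N \<inter> U \<subseteq> K"
  proof
    fix w assume "w \<in> N \<inter> U"
    then have w: "w \<in> W" "f w \<in> ball (f x) 1" unfolding N(2)[symmetric] by simp_all
    have "f w \<in> cball (f x) 1 \<inter> P" using w d(3) by auto
    then have "g (f w) \<in> K" unfolding K_def by (rule imageI)
    then show "w \<in> K" using d(4)[OF w(1)] by simp
  qed
  then have "N - U = N - K" using KU by auto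
  then have "openin S (N - U)" using N(1) clK by (simp add: openin_diff)
  ultimately show thesis using that[OF N(1)] by simp
qed

text \<open>
  A separation of \<open>U - B\<close> extends to a separation of \<open>U\<close>, because each point of \<open>U\<close> has a
  neighbourhood whose trace on \<open>U - B\<close> is connected.
\<close>
lemma connected_interior: "connectedin S (U - B)"
proof (rule ccontr)
  let ?G = "U - B"
  assume "\<not> connectedin S ?G"
  then obtain E1 E2 where E: "openin S E1" "openin S E2" "?G \<subseteq> E1 \<union> E2" "E1 \<inter> E2 \<inter> ?G = {}" "E1 \<inter> ?G \<noteq> {}" "E2 \<inter> ?G \<noteq> {}"
    using US unfolding connectedin by auto
  \<comment> \<open>the points of \<open>U\<close> near which the interior belongs to \<open>E\<close>\<close>
  define part where "part E = {x \<in> U. \<exists>W. openin (subtopology S U) W \<and> x \<in> W \<and> W \<inter> ?G \<subseteq> E}" for E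
  have part_open: "openin (subtopology S U) (part E)" for E
  proof (subst openin_subopen, intro ballI)
    fix x assume "x \<in> part E"
    then obtain W where W: "openin (subtopology S U) W" "x \<in> W" "W \<inter> ?G \<subseteq> E"
      unfolding part_def by auto
    have "W \<subseteq> part E" using W openin_subset[OF W(1)] US_eq unfolding part_def by auto
    then show "\<exists>T. openin (subtopology S U) T \<and> x \<in> T \<and> T \<subseteq> part E" using W(1,2) by (intro exI[of _ W]) simp
  qed
  have part_ne: "part E \<noteq> {}" if E: "openin S E" "E \<inter> ?G \<noteq> {}" for E
  proof -
    obtain x where x: "x \<in> E" "x \<in> ?G" using E(2) by auto
    have "x \<in> part E"
      unfolding part_def using x openin_subtopology_Int[OF E(1), of U]
      by (intro CollectI conjI exI[of _ "E \<inter> U"]) auto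
    then show ?thesis by auto
  qed
  have cover: "U \<subseteq> part E1 \<union> part E2"
  proof
    fix x assume x: "x \<in> U"
    then obtain W P f g where W: "x \<in> W" "chart W P f g" by (rule chart_exists)
    note d = chartD[OF W(2)]
    have "connectedin (top_of_set (interior P)) (interior P)"
      using convex_connected[OF chart_domain(3)[OF d(10)]] by (simp add: connectedin_subtopology)
    moreover have "continuous_map (top_of_set (interior P)) S g"
      using d(8) interior_subset by (rule continuous_map_from_subtopology_mono)
    ultimately have c: "connectedin S (W \<inter> ?G)"
      unfolding interior_in_chart[OF W(2)] by (intro connectedin_continuous_map_image)
    have "W \<inter> ?G \<subseteq> E1 \<or> W \<inter> ?G \<subseteq> E2"
    proof (rule ccontr)
      assume "\<not> ?thesis"
      then have "E1 \<inter> (W \<inter> ?G) \<noteq> {}" "E2 \<inter> (W \<inter> ?G) \<noteq> {}" using E(3) by auto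
      moreover have "W \<inter> ?G \<subseteq> E1 \<union> E2" "E1 \<inter> E2 \<inter> (W \<inter> ?G) = {}" using E(3,4) by auto
      ultimately show False using c E(1,2) unfolding connectedin by metis
    qed
    then show "x \<in> part E1 \<union> part E2" using x W(1) d(1) unfolding part_def by auto
  qed
  have disj: "part E1 \<inter> part E2 = {}"
  proof (rule ccontr)
    assume "part E1 \<inter> part E2 \<noteq> {}"
    then obtain x where x: "x \<in> part E1" "x \<in> part E2" by auto
    obtain W1 where W1: "openin (subtopology S U) W1" "x \<in> W1" "W1 \<inter> ?G \<subseteq> E1" using x(1) unfolding part_def by auto
    obtain W2 where W2: "openin (subtopology S U) W2" "x \<in> W2" "W2 \<inter> ?G \<subseteq> E2" using x(2) unfolding part_def by auto
    have "openin (subtopology S U) (W1 \<inter> W2)" using W1(1) W2(1) by (rule openin_Int)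
    then obtain N where N: "openin S N" "W1 \<inter> W2 = N \<inter> U"
      unfolding openin_subtopology by (elim exE conjE) (rule that)
    have "x \<in> U" using x(1) unfolding part_def by simp
    have "x \<in> N \<inter> U" using W1(2) W2(2) N(2) by auto
    then have "x \<in> N" by simp
    have "x \<in> S closure_of ?G" using interior_dense \<open>x \<in> U\<close> by auto
    then obtain y where y: "y \<in> ?G" "y \<in> N" using N(1) \<open>x \<in> N\<close> by (rule closure_of_meets)
    then have "y \<in> W1 \<inter> W2" using N(2) by auto
    then show False using y(1) W1(3) W2(3) E(4) by auto
  qed
  have "connected_space (subtopology S U)"
    using bordered unfolding bordered_submanifold_def bordered_manifold_def by simp
  then show False
    using part_open[of E1] part_open[of E2] part_ne[OF E(1,5)] part_ne[OF E(2,6)] cover disj US_eq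
    unfolding connected_space_def by metis
qed

text \<open>
  The boundary line of a half plane chart gives an arc in \<open>B\<close>. It is open in \<open>B\<close> because all points
  of \<open>B\<close> in the domain of the chart lie on that line.
\<close>
lemma one_manifold_boundary: "one_manifold (subtopology S B)"
  unfolding one_manifold_def
proof (intro conjI ballI)
  show "Hausdorff_space (subtopology S B)" using haus by (rule Hausdorff_space_subtopology)
  have BS: "topspace (subtopology S B) = B" using BU US by auto
  fix x assume "x \<in> topspace (subtopology S B)"
  then have x: "x \<in> B" "x \<in> U" using BS BU by auto
  obtain W P f g where W: "x \<in> W" "chart W P f g" using x(2) by (rule chart_exists)
  note d = chartD[OF W(2)]
  have P: "P = half_plane" "snd (f x) = 0"
    using boundary_in_chart[OF W(2,1)] x(1) chart_domain(5)[OF d(10) d(3)[OF W(1)]] by simp_all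
  define c where "c = fst (f x)"
  define \<psi> where "\<psi> t = g (t + c, 0)" for t
  have in_P: "(t, 0) \<in> P" for t :: real unfolding P(1) half_plane_def by simp
  have f\<psi>: "f (\<psi> t) = (t + c, 0)" and \<psi>W: "\<psi> t \<in> W" for t unfolding \<psi>_def using d(5,6) in_P by simp_all
  have \<psi>B: "\<psi> t \<in> B" for t
    using boundary_in_chart[OF W(2) \<psi>W] f\<psi> unfolding P(1) interior_half_plane(1) by simp
  have "continuous_map euclideanreal (top_of_set P) (\<lambda>t. (t + c, 0))"
    using in_P by (auto simp: continuous_map_in_subtopology intro!: continuous_on_Pair continuous_on_add continuous_on_const continuous_on_id)
  from continuous_map_compose[OF this d(8)] have "continuous_map euclideanreal S \<psi>"
    by (simp add: o_def \<psi>_def[abs_def])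
  then have "continuous_map euclideanreal (subtopology S B) \<psi>"
    using \<psi>B by (simp add: continuous_map_in_subtopology)
  moreover have "open_map euclideanreal (subtopology S B) \<psi>"
    unfolding open_map_def
  proof (intro allI impI)
    fix I :: "real set" assume "openin euclideanreal I"
    then have "open I" by simp
    define Q where "Q = {p :: real \<times> real. fst p - c \<in> I}"
    have "open Q"
    proof -
      have "Q = (\<lambda>p. fst p - c) -` I" unfolding Q_def by auto
      moreover have "open ((\<lambda>p :: real \<times> real. fst p - c) -` I)"
        using \<open>open I\<close> by (rule open_vimage) (intro continuous_on_diff continuous_on_fst continuous_on_id continuous_on_const)
      ultimately show ?thesis by simp
    qed
    then obtain N where N: "openin S N" "{w \<in> W. f w \<in> Q} = N \<inter> U"
      using d(9) unfolding openin_subtopology by metis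
    have "\<psi> ` I = N \<inter> B"
    proof
      show "\<psi> ` I \<subseteq> N \<inter> B"
      proof
        fix w assume "w \<in> \<psi> ` I"
        then obtain t where t: "t \<in> I" "w = \<psi> t" by auto
        have "w \<in> {w \<in> W. f w \<in> Q}" using t \<psi>W f\<psi> unfolding Q_def by simp
        then show "w \<in> N \<inter> B" using N(2) \<psi>B t(2) by simp
      qed
      show "N \<inter> B \<subseteq> \<psi> ` I"
      proof
        fix w assume w: "w \<in> N \<inter> B"
        then have "w \<in> N \<inter> U" using BU by auto
        then have "w \<in> {w \<in> W. f w \<in> Q}" using N(2) by simp
        then have wW: "w \<in> W" and wQ: "fst (f w) - c \<in> I" unfolding Q_def by simp_all
        have "snd (f w) = 0"
          using boundary_in_chart[OF W(2) wW] w chart_domain(5)[OF d(10) d(3)[OF wW]] by simp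
        then have "\<psi> (fst (f w) - c) = g (f w)" unfolding \<psi>_def by (metis diff_add_cancel prod.collapse)
        then have "w = \<psi> (fst (f w) - c)" using d(4)[OF wW] by simp
        then show "w \<in> \<psi> ` I" using wQ by (rule image_eqI)
      qed
    qed
    then show "openin (subtopology S B) (\<psi> ` I)" using N(1) by (simp add: openin_subtopology_Int)
  qed
  moreover have "inj \<psi>"
  proof (rule injI)
    fix s t assume "\<psi> s = \<psi> t"
    then have "(s + c, 0::real) = (t + c, 0)" using f\<psi> by metis
    then show "s = t" by simp
  qed
  moreover have "\<psi> 0 = x"
  proof -
    have "(0 + c, 0) = f x" unfolding c_def using P(2) by (simp add: prod_eq_iff)
    then show ?thesis unfolding \<psi>_def using d(4)[OF W(1)] by simp
  qed
  ultimately show "\<exists>\<psi>. arc_chart (subtopology S B) \<psi> \<and> \<psi> 0 = x"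
    unfolding arc_chart_def by (intro exI[of _ \<psi>]) simp
qed

end

section \<open>Surfaces with a full system of infinitesimal bridges\<close>

lemma small_ideal_small_in:
  assumes "locally_second_countable S"
  shows "small_ideal (subtopology S B) (small_in S)"
  unfolding small_ideal_def
proof (intro conjI allI impI)
  fix Y Z :: "'a set" assume "small_in S Y" "Z \<subseteq> Y"
  then show "small_in S Z" by (rule small_in_subset)
next
  fix Y :: "nat \<Rightarrow> 'a set" assume "\<forall>n. small_in S (Y n)"
  then show "small_in S (\<Union>n. Y n)" by (intro small_in_UN) simp_all
next
  fix K assume "compactin (subtopology S B) K"
  then have "compactin S K" by (simp add: compactin_subtopology)
  then show "small_in S K" by (rule small_in_compact[OF assms])
qed

text \<open>
  Components are open in \<open>B\<close>, so each one that meets \<open>M\<close> contains a point of a countable dense subset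
  of \<open>B \<inter> M\<close>.
\<close>
lemma countable_components_meeting_small:
  assumes lc: "locally_connected_space (subtopology S B)" and M: "openin S M" "small_in S M"
  shows "countable {A \<in> connected_components_of (subtopology S B). A \<inter> M \<noteq> {}}"
proof -
  have "small_in S (topspace S \<inter> B \<inter> M)"
    using M(2) by (rule small_in_subset) auto
  then obtain D where D: "countable D" "D \<subseteq> topspace S \<inter> B \<inter> M" "topspace S \<inter> B \<inter> M \<subseteq> S closure_of D"
    by (rule small_in_separable) (auto intro: that)
  define comp where "comp d = Collect (connected_component_of (subtopology S B) d)" for d
  have "{A \<in> connected_components_of (subtopology S B). A \<inter> M \<noteq> {}} \<subseteq> comp ` D"
  proof
    fix A assume A: "A \<in> {A \<in> connected_components_of (subtopology S B). A \<inter> M \<noteq> {}}"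
    then have comp_A: "A \<in> connected_components_of (subtopology S B)" by simp
    obtain z where z: "z \<in> A" "z \<in> M" using A by auto
    have "openin (subtopology S B) A"
      using lc comp_A by (rule openin_connected_components_of_locally_connected_space)
    then obtain N where N: "openin S N" "A = N \<inter> B"
      unfolding openin_subtopology by (elim exE conjE) (rule that)
    have "z \<in> topspace S" using z(2) openin_subset[OF M(1)] by auto
    then have "z \<in> S closure_of D" using D(3) z N(2) by auto
    moreover have "openin S (N \<inter> M)" using N(1) M(1) by (rule openin_Int)
    moreover have "z \<in> N \<inter> M" using z N(2) by simp
    ultimately obtain d where d: "d \<in> D" "d \<in> N \<inter> M" by (rule closure_of_meets)
    then have "d \<in> A" using D(2) N(2) by auto
    obtain y where A_y: "A = Collect (connected_component_of (subtopology S B) y)"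
      using comp_A unfolding connected_components_of_def by auto
    then have yd: "connected_component_of (subtopology S B) y d" using \<open>d \<in> A\<close> by simp
    have "connected_component_of (subtopology S B) y = connected_component_of (subtopology S B) d"
      using iffD1[OF connected_component_of_equiv yd] by simp
    then have "A = comp d"
      unfolding comp_def A_y by (rule arg_cong)
    then show "A \<in> comp ` D" using d(1) by simp
  qed
  then show ?thesis using D(1) by (meson countable_image countable_subset)
qed

locale doubled_subsurface = U: bordered_subsurface S U B + V: bordered_subsurface S V B
  for S :: "'a topology" and U V B :: "'a set" +
  assumes disjoint: "(U - B) \<inter> (V - B) = {}"
begin

lemma Int_eq: "U \<inter> V = B"
  using disjoint U.BU V.BU by auto

lemma component_nbhd:
  assumes A: "A \<in> connected_components_of (subtopology S B)" and a: "a \<in> A"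
  obtains N where "openin S N" "a \<in> N" "N \<inter> B \<subseteq> A"
proof -
  have "openin (subtopology S B) A"
    using one_manifold_locally_connected[OF U.one_manifold_boundary] A
    by (rule openin_connected_components_of_locally_connected_space)
  then obtain N where N: "openin S N" "A = N \<inter> B"
    unfolding openin_subtopology by (elim exE conjE) (rule that)
  show thesis using that[OF N(1)] a N(2) by simp
qed

lemma component_subset: "A \<in> connected_components_of (subtopology S B) \<Longrightarrow> A \<subseteq> B"
  using connected_components_of_subset[of A "subtopology S B"] by auto

lemma component_two_sided:
  assumes A: "A \<in> connected_components_of (subtopology S B)" and cl: "closedin S A"
  shows "two_sided S A U"
  unfolding two_sided_def
proof (intro conjI ballI)
  show "A \<subseteq> U" using component_subset[OF A] U.BU by auto
  show "closedin S A" by (rule cl)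
  fix a assume a: "a \<in> A"
  then have "a \<in> U" using \<open>A \<subseteq> U\<close> by auto
  obtain N1 where N1: "openin S N1" "a \<in> N1" "N1 \<inter> B \<subseteq> A" by (rule component_nbhd[OF A a])
  obtain N2 where N2: "openin S N2" "a \<in> N2" "openin S (N2 - U)"
    by (rule U.locally_closed[OF \<open>a \<in> U\<close>])
  have "N1 \<inter> N2 \<inter> U - A = N1 \<inter> N2 \<inter> (U - B)"
    using N1(3) component_subset[OF A] by auto
  then have 1: "openin S (N1 \<inter> N2 \<inter> U - A)"
    using N1(1) N2(1) U.openin_interior by (simp add: openin_Int)
  have "N1 \<inter> N2 - U = N1 \<inter> (N2 - U)" by auto
  then have 2: "openin S (N1 \<inter> N2 - U)" using N1(1) N2(3) by (simp add: openin_Int)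
  show "\<exists>W. openin S W \<and> a \<in> W \<and> openin S (W \<inter> U - A) \<and> openin S (W - U)"
    using 1 2 N1(1,2) N2(1,2) by (intro exI[of _ "N1 \<inter> N2"]) (simp add: openin_Int)
qed

text \<open>
  The second component \<open>A'\<close> only provides a point off \<open>A\<close> from which \<open>A\<close> can be reached through \<open>U\<close> as
  well as through \<open>V\<close>.
\<close>
lemma homotopy_meets_component:
  assumes H: "continuous_map (prod_topology (top_of_set {0..1::real}) (subtopology S (U \<union> V))) S H"
    and H0: "\<And>x. x \<in> U \<union> V \<Longrightarrow> H (0, x) = x" and H1: "\<And>x. x \<in> U \<union> V \<Longrightarrow> H (1, x) \<in> M"
    and A: "A \<in> connected_components_of (subtopology S B)" "closedin S A"
    and A': "A' \<in> connected_components_of (subtopology S B)" "A' \<noteq> A"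
  shows "A \<inter> M \<noteq> {}"
proof
  assume AM: "A \<inter> M = {}"
  obtain q where q: "q \<in> A" using nonempty_connected_components_of[OF A(1)] by auto
  obtain p where p: "p \<in> A'" using nonempty_connected_components_of[OF A'(1)] by auto
  have "disjnt A A'"
    using pairwise_disjoint_connected_components_of[of "subtopology S B"] A A' unfolding pairwise_def by auto
  then have pA: "p \<notin> A" using p by (auto simp: disjnt_iff)
  have pB: "p \<in> B" and qB: "q \<in> B" using p q component_subset A(1) A'(1) by auto
  then have "p \<in> topspace (subtopology S U)" "q \<in> topspace (subtopology S U)"
    "p \<in> topspace (subtopology S V)" "q \<in> topspace (subtopology S V)"
    using U.BU V.BU U.US_eq V.US_eq by auto
  then obtain \<alpha> \<beta> where \<alpha>: "pathin (subtopology S U) \<alpha>" "\<alpha> 0 = p" "\<alpha> 1 = q"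
    and \<beta>: "pathin (subtopology S V) \<beta>" "\<beta> 0 = p" "\<beta> 1 = q"
    using U.path_connected V.path_connected unfolding path_connected_space_def by metis
  show False
  proof (rule two_sided_crossing_persists[OF component_two_sided[OF A] _ H H0 _ \<alpha> \<beta> pA q])
    show "H (1, x) \<notin> A" if "x \<in> U \<union> V" for x using H1[OF that] AM by auto
    show "\<exists>W. openin S W \<and> a \<in> W \<and> W \<inter> U \<inter> V \<subseteq> A" if a: "a \<in> A" for a
    proof -
      obtain N where N: "openin S N" "a \<in> N" "N \<inter> B \<subseteq> A" by (rule component_nbhd[OF A(1) a])
      have "N \<inter> U \<inter> V = N \<inter> B" using Int_eq by auto
      then show ?thesis using N by (intro exI[of _ N]) simp
    qed
  qed
qed

lemma non_small_boundary_not_CW: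
  assumes cl: "\<And>A. A \<in> connected_components_of (subtopology S B) \<Longrightarrow> closedin S A"
    and small: "small_in S ((U - B) \<union> (V - B))" and big: "\<not> small_in S B"
    and K: "CW_complex K" "S homotopy_equivalent_space K"
  shows False
proof -
  let ?T = "subtopology S B" and ?C = "connected_components_of (subtopology S B)"
  have lsc: "locally_second_countable S" using U.surface by (rule surface_locally_second_countable)
  have BX: "B \<subseteq> U \<union> V" using U.BU by auto
  have BT: "topspace ?T = B" using U.BU U.US by auto
  have "(U - B) \<union> (V - B) \<subseteq> topspace S" using U.US V.US by auto
  then obtain D where D: "countable D" "D \<subseteq> (U - B) \<union> (V - B)" "(U - B) \<union> (V - B) \<subseteq> S closure_of D"
    using small_in_separable[OF small] by metis
  have dense: "U \<union> V \<subseteq> S closure_of D"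
  proof -
    have "S closure_of ((U - B) \<union> (V - B)) \<subseteq> S closure_of D"
      using D(3) closedin_closure_of by (rule closure_of_minimal)
    then show ?thesis
      using U.interior_dense V.interior_dense unfolding closure_of_Un by auto
  qed
  have DS: "D \<subseteq> topspace S" using D(2) U.US V.US by auto
  obtain H M where H: "continuous_map (prod_topology (top_of_set {0..1::real}) (subtopology S (U \<union> V))) S H"
    and H0: "\<And>x. x \<in> U \<union> V \<Longrightarrow> H (0, x) = x" and H1: "\<And>x. x \<in> U \<union> V \<Longrightarrow> H (1, x) \<in> M"
    and M: "openin S M" "small_in S M"
    by (rule homotopic_into_small[OF K lsc D(1) DS dense]) (rule that, assumption+)
  have lc: "locally_connected_space ?T"
    using U.one_manifold_boundary by (rule one_manifold_locally_connected)
  show False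
  proof (cases "\<forall>A\<in>?C. small_in S A")
    case True
    have uncountable: "\<not> countable ?C"
    proof
      assume "countable ?C"
      then have "small_in S (\<Union>A\<in>?C. A)" using True by (intro small_in_UN) simp_all
      moreover have "(\<Union>A\<in>?C. A) = B" using Union_connected_components_of[of ?T] BT by simp
      ultimately show False using big by simp
    qed
    let ?far = "?C - {A \<in> ?C. A \<inter> M \<noteq> {}}"
    have "\<not> countable ?far"
      using uncountable countable_components_meeting_small[OF lc M]
      by (metis (no_types, lifting) uncountable_minus_countable)
    then have "?far \<noteq> {}" by (metis countable_empty)
    then obtain A where A: "A \<in> ?C" "A \<inter> M = {}" by auto
    have "?C \<noteq> {A}" using uncountable by (metis countable_empty countable_insert)
    then obtain A' where A': "A' \<in> ?C" "A' \<noteq> A" using A(1) by auto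
    show False
      using homotopy_meets_component[OF H H0 H1 A(1) cl[OF A(1)] A'] A(2) by simp
  next
    case False
    then obtain A where A: "A \<in> ?C" "\<not> small_in S A" by auto
    obtain \<K> e where L: "long_line ?T \<K> e"
    proof (rule non_small_imp_long_line[OF U.one_manifold_boundary small_ideal_small_in[OF lsc] _ _ A(2)])
      show "openin ?T A"
        using lc A(1) by (rule openin_connected_components_of_locally_connected_space)
      show "connectedin ?T A" using A(1) by (rule connectedin_connected_components_of)
    qed (rule that)
    have reg: "regular_space S"
      using lsc U.haus U.regular_surface by simp
    show False
    proof (rule long_line_no_homotopy_into_small[OF L U.haus reg lsc _ _ _ M(1)])
      show "continuous_map (prod_topology (top_of_set {0..1::real}) ?T) S H"
        using BX by (intro continuous_map_prod_subtopology[OF H])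
      show "H (0, x) = x" if "x \<in> topspace ?T" for x using that H0 BX BT by auto
      show "H (1, x) \<in> M" if "x \<in> topspace ?T" for x using that H1 BX BT by auto
      show "second_countable (subtopology S M)" using M(2) by (rule small_in_imp_second_countable)
    qed
  qed
qed

end

theorem theorem1:
  fixes S :: "'a topology" and U V :: "'a set"
  assumes "surface S"
    and "full_MSIB 2 S U V"
  shows "\<not> (\<exists>K :: 'b topology. CW_complex K \<and> S homotopy_equivalent_space K)"
proof
  assume "\<exists>K :: 'b topology. CW_complex K \<and> S homotopy_equivalent_space K"
  then obtain K :: "'b topology" where K: "CW_complex K" "S homotopy_equivalent_space K" by (elim exE conjE) (rule that)
  define B where "B = manifold_boundary 2 (subtopology S U)"
  have msib: "MSIB 2 S U V" and BV: "manifold_boundary 2 (subtopology S V) = B"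
    and cl: "\<And>A. A \<in> connected_components_of (subtopology S B) \<Longrightarrow> closedin S A"
    using assms(2) unfolding full_MSIB_def B_def by simp_all
  have bU: "bordered_submanifold 2 S U" and bV: "bordered_submanifold 2 S V"
    using msib unfolding MSIB_def by simp_all
  have tU: "topspace (subtopology S U) = U" and tV: "topspace (subtopology S V) = V"
    using bU bV unfolding bordered_submanifold_def by auto
  have m: "(U - B) \<inter> (V - B) = {}" "metrizable_space (subtopology S ((U - B) \<union> (V - B)))"
    "\<not> metrizable_space (subtopology S ((U - B) \<union> (V - B) \<union> B))"
    using msib unfolding MSIB_def manifold_interior_def Let_def tU tV BV B_def[symmetric] by simp_all
  interpret doubled_subsurface S U V B
    using assms(1) bU bV BV m(1) by unfold_locales (simp_all add: B_def)
  have lsc: "locally_second_countable S" using assms(1) by (rule surface_locally_second_countable)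
  have met: "metrizable_space (subtopology S G)" if "G \<subseteq> (U - B) \<union> (V - B)" for G
    using metrizable_space_subtopology[OF m(2), of G] that by (simp add: subtopology_subtopology inf.absorb2)
  have small: "small_in S ((U - B) \<union> (V - B))"
    by (intro small_in_Un connected_metrizable_imp_small[OF lsc] U.connected_interior V.connected_interior met) auto
  have "\<not> small_in S B"
  proof
    assume "small_in S B"
    then have "small_in S ((U - B) \<union> (V - B) \<union> B)" by (rule small_in_Un[OF small])
    then have "second_countable (subtopology S ((U - B) \<union> (V - B) \<union> B))" by (rule small_in_imp_second_countable)
    then have "metrizable_space (subtopology S ((U - B) \<union> (V - B) \<union> B))"
      using U.haus U.regular_surface
      by (intro regular_second_countable_imp_metrizable regular_space_subtopology Hausdorff_space_subtopology)
    then show False using m(3) by simp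
  qed
  then show False using non_small_boundary_not_CW[OF cl small _ K] by simp
qed

end
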